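(* Fix an ordinal $0<\xi<\omega_1$. (i) The complement of $\mathcal{S}_\xi$-$\mathfrak{Sl}_1$ admits a universal operator. (ii) The complement of $\mathcal{S}_\xi$-$\mathfrak{Sc}_0$ admits a universal operator. (iii) If $\xi\geqslant\omega$, the complement of $\mathfrak{Sc}_0^\xi$ admits a universal operator.
   Context: Operators are bounded linear maps between Banach spaces. $A:X\to Y$ factors through $B:Z\to W$ if there are operators $C:X\to Z$, $D:W\to Y$ with $A=DBC$. A universal operator for the complement $\complement\mathfrak{J}$ of a class $\mathfrak{J}$ of operators is an operator $U\notin\mathfrak{J}$ which factors through every operator not in $\mathfrak{J}$. Schreier families: finite subsets of $\mathbb{N}$ are identified with finite strictly increasing sequences. $\mathcal{S}_0=\{\varnothing\}\cup\{(n):n\in\mathbb{N}\}$; $\mathcal{S}_{\xi+1}=\{\bigcup_{i=1}^nE_i: n\leqslant E_1<\dots<E_n,\ E_i\in\mathcal{S}_\xi\}\cup\{\varnothing\}$, where $E<F$ means $\max E<\min F$ (or one is empty) and $n\leqslant E$ means $n\leqslant\min E$ (or $E$ empty); for a countable limit ordinal $\xi$ a specific sequence $\xi_n\uparrow\xi$ is fixed (chosen as is standard in the literature on Schreier families so that the standard results about them hold) and $\mathcal{S}_\xi=\{E:\exists n\leqslant E\in\mathcal{S}_{\xi_n}\}\cup\{\varnothing\}$. Let $E$ be $\ell_1$ or $c_0$ with its canonical unit vector basis $(e_i)$. An operator $A:X\to Y$ belongs to $\mathcal{S}_\xi$-$\mathfrak{S}E$ if for each normalized basic sequence $(x_n)$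 in $X$ and each $\varepsilon>0$ there are $(n_i)_{i=1}^\ell\in\mathcal{S}_\xi$ and scalars $(a_i)_{i=1}^\ell$ such that either $\|\sum_{i=1}^\ell a_iAx_{n_i}\|<\varepsilon\|\sum_{i=1}^\ell a_ie_i\|$ or $\|\sum_{i=1}^\ell a_ie_i\|<\varepsilon\|\sum_{i=1}^\ell a_ix_{n_i}\|$. The classes for $E=\ell_1$ and $E=c_0$ are written $\mathcal{S}_\xi$-$\mathfrak{Sl}_1$ and $\mathcal{S}_\xi$-$\mathfrak{Sc}_0$. Trees: a tree on a set $\Lambda$ is a set $T$ of finite sequences in $\Lambda$ closed under initial segments. $T'$ is $T$ with its maximal elements (with respect to extension) removed; $T^0=T$, $T^{\xi+1}=(T^\xi)'$, $T^\xi=\bigcap_{\zeta<\xi}T^\zeta$ for limit $\xi$; $o(T)$ is the least $\xi$ with $T^\xi=\varnothing$ if one exists, and $o(T)=\infty$ (larger than every ordinal) otherwise. For an operator $A:X\to Y$ and $K\geqslant1$, let $T_{\mathfrak{S}c_0}(A,X,Y,K)$ be the tree of all finite sequences $(x_i)_{i=1}^n$ in the unit sphere $S_X$ (including $\varnothing$) such that $(Ax_i)_{i=1}^n$ is $K$-basic (basic with basis constant at most $K$), $(Ax_i)_{i=1}^n$ $K$-dominates $(e_i)_{i=1}^n$, i.e. $\|\sum a_ie_i\|\leqslant K\|\sum a_iAx_i\|$ for all scalars, and $(e_i)_{i=1}^n$ $1$-dominates $(x_i)_{i=1}^n$, i.e. $\|\sum a_ix_i\|\leqslant\|\sum a_ie_i\|$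 for all scalars, where $(e_i)$ is the canonical basis of $c_0$. Then $\mathfrak{Sc}_0^\xi$ is the class of operators $A:X\to Y$ with $\sup_{K\geqslant1}o(T_{\mathfrak{S}c_0}(A,X,Y,K))\leqslant\omega^\xi$. *)

theory Defs
  imports "HOL-Analysis.Analysis" "HOL-Probability.Discrete_Topology"
    "HOL-Library.Extended" "HOL-Library.Sublist"
begin

section \<open>Countable ordinals\<close>

text \<open>The elements of \<open>omega1\<close>, a well-order isomorphic to the first uncountable ordinal,
  are the countable ordinals.\<close>

typedef omega1 = "Field (cardSuc natLeq)"
proof -
  have "infinite (Field (cardSuc natLeq))"
    using cardSuc_finite[OF natLeq_Card_order] by (simp add: Field_natLeq)
  then show ?thesis by (metis ex_in_conv finite.emptyI)
qed

instantiation omega1 :: wellorder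
begin

definition less_eq_omega1 :: "omega1 \<Rightarrow> omega1 \<Rightarrow> bool" where
  "x \<le> y \<longleftrightarrow> (Rep_omega1 x, Rep_omega1 y) \<in> cardSuc natLeq"

definition less_omega1 :: "omega1 \<Rightarrow> omega1 \<Rightarrow> bool" where
  "(x :: omega1) < y \<longleftrightarrow> x \<le> y \<and> x \<noteq> y"

lemma wo_rel_cardSuc_natLeq: "wo_rel (cardSuc natLeq)"
  unfolding wo_rel_def
  using cardSuc_Card_order[OF natLeq_Card_order] card_order_on_well_order_on by blast

instance
proof
  interpret wo_rel "cardSuc natLeq" by (rule wo_rel_cardSuc_natLeq)
  fix x y z :: omega1
  show total: "x \<le> y \<or> y \<le> x"
    unfolding less_eq_omega1_def using TOTALS Rep_omega1 by blast
  show antisym: "x = y" if "x \<le> y" "y \<le> x"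
    using that ANTISYM unfolding less_eq_omega1_def by (metis Rep_omega1_inject antisymD)
  show "x < y \<longleftrightarrow> x \<le> y \<and> \<not> y \<le> x"
    unfolding less_omega1_def using total antisym by blast
  show "x \<le> x"
    unfolding less_eq_omega1_def using TOTALS Rep_omega1 by blast
  show "x \<le> z" if "x \<le> y" "y \<le> z"
    using that TRANS unfolding less_eq_omega1_def by (meson transD)
  fix P :: "omega1 \<Rightarrow> bool" and a :: omega1
  assume step: "\<And>x. (\<And>y. y < x \<Longrightarrow> P y) \<Longrightarrow> P x"
  have "wf {(x, y). x < (y :: omega1)}"
  proof (rule wf_subset[OF wf_inv_image[of "cardSuc natLeq - Id" Rep_omega1]])
    show "wf (cardSuc natLeq - Id)" by (rule WF)
    show "{(x, y). x < (y :: omega1)} \<subseteq> inv_image (cardSuc natLeq - Id) Rep_omega1"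
      by (auto simp: less_omega1_def less_eq_omega1_def inv_image_def Rep_omega1_inject)
  qed
  then show "P a" using step by (induction a rule: wf_induct_rule) auto
qed

end

lemma countable_iff_ordLeq_natLeq:
  includes cardinal_syntax
  shows "countable A \<longleftrightarrow> |A| \<le>o natLeq"
proof
  assume "countable A"
  then obtain f :: "_ \<Rightarrow> nat" where "inj_on f A" by (auto simp: countable_def)
  then have "|A| \<le>o |UNIV :: nat set|" by (auto simp: card_of_ordLeq[symmetric])
  then show "|A| \<le>o natLeq" using card_of_nat ordLeq_ordIso_trans by blast
next
  assume "|A| \<le>o natLeq"
  then have "|A| \<le>o |UNIV :: nat set|"
    using card_of_nat ordIso_symmetric ordLeq_ordIso_trans by blast
  then obtain f :: "_ \<Rightarrow> nat" where "inj_on f A" by (auto simp: card_of_ordLeq[symmetric])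
  then show "countable A" by (auto simp: countable_def)
qed

lemma uncountable_omega1:
  includes cardinal_syntax
  shows "uncountable (UNIV :: omega1 set)"
proof
  assume "countable (UNIV :: omega1 set)"
  then have "countable (range Rep_omega1)" by simp
  also have "range Rep_omega1 = Field (cardSuc natLeq)"
    using type_definition.Rep_range[OF type_definition_omega1] .
  finally have "|Field (cardSuc natLeq)| \<le>o natLeq"
    by (simp only: countable_iff_ordLeq_natLeq)
  moreover have "natLeq <o |Field (cardSuc natLeq)|"
    using cardSuc_greater[OF natLeq_Card_order]
      card_of_Field_ordIso[OF cardSuc_Card_order[OF natLeq_Card_order]]
      ordIso_symmetric ordLess_ordIso_trans by blast
  ultimately show False using not_ordLess_ordLeq by blast
qed

lemma countable_lessThan_omega1:
  includes cardinal_syntax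
  shows "countable {..<x :: omega1}"
proof -
  have "Rep_omega1 ` {..<x} \<subseteq> underS (cardSuc natLeq) (Rep_omega1 x)"
    by (auto simp: underS_def less_omega1_def less_eq_omega1_def Rep_omega1_inject)
  moreover have "|underS (cardSuc natLeq) (Rep_omega1 x)| \<le>o natLeq"
    using card_of_underS[OF cardSuc_Card_order[OF natLeq_Card_order] Rep_omega1]
      cardSuc_ordLeq_ordLess[OF natLeq_Card_order card_of_Card_order] by blast
  ultimately have "countable (Rep_omega1 ` {..<x})"
    using countable_iff_ordLeq_natLeq countable_subset by blast
  then show ?thesis
    by (rule countable_image_inj_on) (auto simp: inj_on_def Rep_omega1_inject)
qed

lemma countable_bdd_omega1:
  assumes "countable A"
  shows "\<exists>u :: omega1. \<forall>a\<in>A. a < u"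
proof (rule ccontr)
  assume "\<nexists>u. \<forall>a\<in>A. a < u"
  then have "UNIV \<subseteq> (\<Union>a\<in>A. insert a {..<a})"
    by (auto simp: not_less le_less)
  moreover have "countable (\<Union>a\<in>A. insert a {..<a})"
    using assms countable_lessThan_omega1 by (intro countable_UN countable_insert)
  ultimately show False using uncountable_omega1 countable_subset by blast
qed

instantiation omega1 :: zero
begin
definition zero_omega1 :: omega1 where "0 = (LEAST x :: omega1. True)"
instance ..
end

definition osuc :: "omega1 \<Rightarrow> omega1" where
  "osuc x = (LEAST y. x < y)"

definition is_limit :: "omega1 \<Rightarrow> bool" where
  "is_limit x \<longleftrightarrow> x \<noteq> 0 \<and> (\<forall>y. x \<noteq> osuc y)"

definition opred :: "omega1 \<Rightarrow> omega1" where
  "opred x = (THE y. x = osuc y)"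

definition osup :: "omega1 set \<Rightarrow> omega1" where
  "osup A = (LEAST u. \<forall>a\<in>A. a \<le> u)"

lemma zero_le_omega1 [simp]: "0 \<le> (x :: omega1)"
  unfolding zero_omega1_def by (rule Least_le) simp

lemma less_osuc: "x < osuc x"
  unfolding osuc_def using countable_bdd_omega1[of "{x}"] by (auto intro: LeastI)

lemma less_osuc_iff: "x < osuc y \<longleftrightarrow> x \<le> y"
  by (metis Least_le leD le_less_linear le_less_trans less_osuc osuc_def)

lemma osuc_inject [simp]: "osuc x = osuc y \<longleftrightarrow> x = y"
  by (metis antisym less_osuc less_osuc_iff)

lemma osuc_neq_zero [simp]: "osuc x \<noteq> 0"
  using less_osuc[of x] zero_le_omega1 by (metis leD)

lemma not_is_limit_simps [simp]: "\<not> is_limit 0" "\<not> is_limit (osuc x)"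
  by (auto simp: is_limit_def)

lemma opred_osuc [simp]: "opred (osuc x) = x"
  by (simp add: opred_def)

lemma osuc_opred: "x \<noteq> 0 \<Longrightarrow> \<not> is_limit x \<Longrightarrow> osuc (opred x) = x"
  by (auto simp: is_limit_def)

lemma opred_less: "x \<noteq> 0 \<Longrightarrow> \<not> is_limit x \<Longrightarrow> opred x < x"
  by (metis less_osuc osuc_opred)

lemma osup_upper: "countable A \<Longrightarrow> a \<in> A \<Longrightarrow> a \<le> osup A"
  unfolding osup_def
  using LeastI_ex[of "\<lambda>u. \<forall>a\<in>A. a \<le> u"] countable_bdd_omega1[of A] less_imp_le by blast

lemma osup_least: "(\<And>a. a \<in> A \<Longrightarrow> a \<le> u) \<Longrightarrow> osup A \<le> u"
  unfolding osup_def by (rule Least_le) blast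

definition omega :: omega1 where
  "omega = osup (range (\<lambda>n. (osuc ^^ n) 0))"

text \<open>Addition and the powers \<open>\<omega>\<^sup>\<xi>\<close>. The recursions treat successors and limits
  uniformly: \<open>\<alpha> + \<beta> = sup {\<alpha> + \<gamma> + 1 | \<gamma> < \<beta>}\<close> and
  \<open>\<omega>\<^sup>\<beta> = sup {\<omega>\<^sup>\<gamma> \<cdot> n | \<gamma> < \<beta>, n < \<omega>}\<close> for \<open>\<beta> > 0\<close>.\<close>

function oadd :: "omega1 \<Rightarrow> omega1 \<Rightarrow> omega1" where
  "oadd \<alpha> \<beta> = (if \<beta> = 0 then \<alpha> else osup ((\<lambda>\<gamma>. osuc (oadd \<alpha> \<gamma>)) ` {..<\<beta>}))"
  by pat_completeness auto
termination
  by (relation "inv_image {(x, y). x < y} snd") (auto intro: wf_inv_image wf)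

declare oadd.simps [simp del]

definition omul_nat :: "omega1 \<Rightarrow> nat \<Rightarrow> omega1" where
  "omul_nat \<alpha> n = ((\<lambda>\<beta>. oadd \<beta> \<alpha>) ^^ n) 0"

function omega_pow :: "omega1 \<Rightarrow> omega1" where
  "omega_pow \<beta> = (if \<beta> = 0 then osuc 0
     else osup (\<Union> ((\<lambda>\<gamma>. range (omul_nat (omega_pow \<gamma>))) ` {..<\<beta>})))"
  by pat_completeness auto
termination
  by (relation "{(x, y). x < y}") (auto intro: wf)

declare omega_pow.simps [simp del]

lemma oadd_zero: "oadd \<alpha> 0 = \<alpha>"
  by (simp add: oadd.simps)

lemma oadd_upper: "\<gamma> < \<beta> \<Longrightarrow> oadd \<alpha> \<gamma> < oadd \<alpha> \<beta>"
proof -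
  assume *: "\<gamma> < \<beta>"
  then have "\<beta> \<noteq> 0" using zero_le_omega1 leD by blast
  then have "osuc (oadd \<alpha> \<gamma>) \<le> oadd \<alpha> \<beta>"
    using * by (subst (2) oadd.simps) (auto intro!: osup_upper countable_lessThan_omega1)
  then show ?thesis using less_osuc less_le_trans by blast
qed

lemma oadd_osuc: "oadd \<alpha> (osuc \<beta>) = osuc (oadd \<alpha> \<beta>)"
proof (rule antisym)
  have "osuc (oadd \<alpha> \<gamma>) \<le> osuc (oadd \<alpha> \<beta>)" if "\<gamma> \<le> \<beta>" for \<gamma>
    using that oadd_upper[of \<gamma> \<beta> \<alpha>] less_osuc
    by (metis le_less less_osuc_iff linorder_not_le)
  then show "oadd \<alpha> (osuc \<beta>) \<le> osuc (oadd \<alpha> \<beta>)"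
    by (subst oadd.simps) (auto intro: osup_least simp only: osuc_neq_zero if_False
        image_iff lessThan_iff less_osuc_iff)
  show "osuc (oadd \<alpha> \<beta>) \<le> oadd \<alpha> (osuc \<beta>)"
    using oadd_upper[OF less_osuc] by (meson less_osuc_iff linorder_not_le)
qed

lemma osuc_less_limit: "is_limit \<beta> \<Longrightarrow> \<gamma> < \<beta> \<Longrightarrow> osuc \<gamma> < \<beta>"
  unfolding is_limit_def by (metis less_osuc_iff linorder_neqE linorder_not_less)

lemma oadd_limit:
  assumes "is_limit \<beta>"
  shows "oadd \<alpha> \<beta> = osup (oadd \<alpha> ` {..<\<beta>})"
proof (rule antisym)
  have ne: "\<beta> \<noteq> 0" using assms by (simp add: is_limit_def)
  have "osuc (oadd \<alpha> \<gamma>) \<le> osup (oadd \<alpha> ` {..<\<beta>})" if "\<gamma> < \<beta>" for \<gamma>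
    using osuc_less_limit[OF assms that]
    by (auto intro!: osup_upper countable_lessThan_omega1 simp flip: oadd_osuc)
  then show "oadd \<alpha> \<beta> \<le> osup (oadd \<alpha> ` {..<\<beta>})"
    using ne by (subst oadd.simps) (auto intro!: osup_least)
  show "osup (oadd \<alpha> ` {..<\<beta>}) \<le> oadd \<alpha> \<beta>"
    by (rule osup_least) (auto intro: less_imp_le oadd_upper)
qed

lemma oadd_zero_left: "oadd 0 \<beta> = \<beta>"
proof (induction \<beta> rule: less_induct)
  case (less \<beta>)
  show ?case
  proof (cases "\<beta> = 0")
    case False
    have "oadd 0 \<beta> = osup (osuc ` {..<\<beta>})"
      using False less by (subst oadd.simps) (auto intro!: arg_cong[of _ _ osup] image_cong)
    also have "\<dots> = \<beta>"
    proof (rule antisym)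
      show "osup (osuc ` {..<\<beta>}) \<le> \<beta>"
        by (rule osup_least) (metis imageE lessThan_iff less_osuc_iff linorder_not_le)
      show "\<beta> \<le> osup (osuc ` {..<\<beta>})"
      proof (rule ccontr)
        let ?u = "osup (osuc ` {..<\<beta>})"
        assume "\<not> \<beta> \<le> ?u"
        then have "osuc ?u \<le> ?u"
          by (intro osup_upper countable_image countable_lessThan_omega1) auto
        then show False using less_osuc leD by blast
      qed
    qed
    finally show ?thesis .
  qed (simp add: oadd_zero)
qed

lemma omega_pow_zero: "omega_pow 0 = osuc 0"
  by (simp add: omega_pow.simps)

lemma omul_nat_le_omega_pow:
  assumes "\<gamma> < \<beta>"
  shows "omul_nat (omega_pow \<gamma>) n \<le> omega_pow \<beta>"
proof -
  have "\<beta> \<noteq> 0" using assms zero_le_omega1 leD by blast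
  then show ?thesis
    using assms by (subst (2) omega_pow.simps)
      (auto intro!: osup_upper countable_UN countable_lessThan_omega1)
qed

lemma omul_nat_1: "omul_nat \<alpha> 1 = \<alpha>"
  by (simp add: omul_nat_def oadd_zero_left)

lemma omega_pow_mono: "\<gamma> \<le> \<beta> \<Longrightarrow> omega_pow \<gamma> \<le> omega_pow \<beta>"
  using omul_nat_le_omega_pow[of \<gamma> \<beta> 1] omul_nat_1[of "omega_pow \<gamma>"]
  by (cases "\<gamma> = \<beta>") auto

lemma omega_pow_osuc: "omega_pow (osuc \<beta>) = osup (range (omul_nat (omega_pow \<beta>)))"
proof (rule antisym)
  have "omul_nat (omega_pow \<gamma>) n \<le> osup (range (omul_nat (omega_pow \<beta>)))" if "\<gamma> \<le> \<beta>" for \<gamma> n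
  proof (cases "\<gamma> = \<beta>")
    case False
    then have "omul_nat (omega_pow \<gamma>) n \<le> omul_nat (omega_pow \<beta>) 1"
      using that omul_nat_le_omega_pow[of \<gamma> \<beta> n] by (simp add: omul_nat_1 del: One_nat_def)
    also have "\<dots> \<le> osup (range (omul_nat (omega_pow \<beta>)))"
      by (auto intro!: osup_upper)
    finally show ?thesis .
  qed (auto intro!: osup_upper)
  then show "omega_pow (osuc \<beta>) \<le> osup (range (omul_nat (omega_pow \<beta>)))"
    by (subst omega_pow.simps) (auto intro!: osup_least simp: less_osuc_iff)
  show "osup (range (omul_nat (omega_pow \<beta>))) \<le> omega_pow (osuc \<beta>)"
    by (auto intro!: osup_least omul_nat_le_omega_pow less_osuc)
qed

lemma omega_pow_limit:
  assumes "is_limit \<beta>"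
  shows "omega_pow \<beta> = osup (omega_pow ` {..<\<beta>})"
proof (rule antisym)
  have ne: "\<beta> \<noteq> 0" using assms by (simp add: is_limit_def)
  have "omul_nat (omega_pow \<gamma>) n \<le> osup (omega_pow ` {..<\<beta>})" if "\<gamma> < \<beta>" for \<gamma> n
  proof -
    have "omul_nat (omega_pow \<gamma>) n \<le> omega_pow (osuc \<gamma>)"
      by (rule omul_nat_le_omega_pow[OF less_osuc])
    also have "\<dots> \<le> osup (omega_pow ` {..<\<beta>})"
      using osuc_less_limit[OF assms that] by (auto intro!: osup_upper countable_lessThan_omega1)
    finally show ?thesis .
  qed
  then show "omega_pow \<beta> \<le> osup (omega_pow ` {..<\<beta>})"
    using ne by (subst omega_pow.simps) (auto intro!: osup_least)
  show "osup (omega_pow ` {..<\<beta>}) \<le> omega_pow \<beta>"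
    by (auto intro!: osup_least omega_pow_mono)
qed

section \<open>Operators and factorization\<close>

text \<open>A Banach space is a closed subspace of a type of class \<open>banach\<close>. An operator
  \<open>A : X \<rightarrow> Y\<close> is a triple \<open>(X, Y, A)\<close>; the values of \<open>A\<close> outside \<open>X\<close> are irrelevant.\<close>

type_synonym ('a, 'b) oper = "'a set \<times> 'b set \<times> ('a \<Rightarrow> 'b)"

definition is_operator :: "('a::banach, 'b::banach) oper \<Rightarrow> bool" where
  "is_operator = (\<lambda>(X, Y, A).
     subspace X \<and> closed X \<and> subspace Y \<and> closed Y \<and> A ` X \<subseteq> Y \<and>
     (\<forall>x\<in>X. \<forall>y\<in>X. A (x + y) = A x + A y) \<and>
     (\<forall>c. \<forall>x\<in>X. A (c *\<^sub>R x) = c *\<^sub>R A x) \<and>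
     (\<exists>M. \<forall>x\<in>X. norm (A x) \<le> M * norm x))"

definition factors_through ::
    "('a::banach, 'b::banach) oper \<Rightarrow> ('z::banach, 'w::banach) oper \<Rightarrow> bool" where
  "factors_through = (\<lambda>(X, Y, A) (Z, W, B).
     \<exists>C D. is_operator (X, Z, C) \<and> is_operator (W, Y, D) \<and> (\<forall>x\<in>X. A x = D (B (C x))))"

section \<open>Universal operators\<close>

text \<open>A class of operators is given by its members at every pair of types. Here \<open>J\<close> and \<open>J'\<close>
  are meant to be two type instances of one class: \<open>J\<close> at the types of \<open>u\<close>, and \<open>J'\<close> at the
  types of the operators through which \<open>u\<close> has to factor.\<close>

definition universal_operator ::
    "('z::banach, 'w::banach) oper set \<Rightarrow> ('a::banach, 'b::banach) oper set
     \<Rightarrow> ('z, 'w) oper \<Rightarrow> bool" where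
  "universal_operator J J' u \<longleftrightarrow>
     is_operator u \<and> u \<notin> J \<and> (\<forall>A. is_operator A \<and> A \<notin> J' \<longrightarrow> factors_through u A)"

instance bcontfun :: (metric_space, banach) banach ..

type_synonym linf = "nat discrete \<Rightarrow>\<^sub>C real"

text \<open>The universal operator has to be chosen before the types \<open>'a\<close> and \<open>'b\<close> that carry the
  operators it is tested against. HOL cannot quantify over types inside a formula, so
  \<open>\<exists>u. \<forall>'a 'b. universal_operator J J' u\<close> is rendered by two conjuncts, the first of which
  does not mention \<open>'a\<close> and \<open>'b\<close>. The universal operator is sought between subspaces of
  \<open>\<ell>\<^sub>\<infinity>\<close>, which contains every separable Banach space.\<close>

definition complement_admits_universal ::
    "(linf, linf) oper set \<Rightarrow> ('a::banach, 'b::banach) oper set \<Rightarrow> bool" where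
  "complement_admits_universal J J' \<longleftrightarrow>
     (\<exists>u. universal_operator J J u) \<and>
     (\<forall>u. universal_operator J J u \<longrightarrow> universal_operator J J' u)"

lemma is_operator_compose:
  assumes "is_operator (X, Y, A)" "is_operator (Y, Z, B)"
  shows "is_operator (X, Z, \<lambda>x. B (A x))"
proof -
  obtain M where M: "\<forall>x\<in>X. norm (A x) \<le> M * norm x"
    using assms(1) by (auto simp: is_operator_def)
  obtain N where N: "\<forall>y\<in>Y. norm (B y) \<le> N * norm y"
    using assms(2) by (auto simp: is_operator_def)
  have AX: "A x \<in> Y" if "x \<in> X" for x
    using assms(1) that by (auto simp: is_operator_def)
  have "norm (B (A x)) \<le> (\<bar>N\<bar> * M) * norm x" if x: "x \<in> X" for x
  proof -
    have "norm (B (A x)) \<le> N * norm (A x)" using N AX[OF x] by blast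
    also have "\<dots> \<le> \<bar>N\<bar> * norm (A x)" by (simp add: mult_right_mono)
    also have "\<dots> \<le> \<bar>N\<bar> * (M * norm x)" using M x by (simp add: mult_left_mono)
    finally show ?thesis by (simp add: mult.assoc)
  qed
  then have "\<exists>M. \<forall>x\<in>X. norm (B (A x)) \<le> M * norm x" by blast
  then show ?thesis using assms AX by (auto simp: is_operator_def)
qed

lemma factors_through_trans:
  assumes "factors_through a b" "factors_through b c"
  shows "factors_through a c"
proof -
  obtain X Y A where a: "a = (X, Y, A)" by (cases a) auto
  obtain Z W B where b: "b = (Z, W, B)" by (cases b) auto
  obtain P Q G where c: "c = (P, Q, G)" by (cases c) auto
  obtain C D where 1: "is_operator (X, Z, C)" "is_operator (W, Y, D)" "\<forall>x\<in>X. A x = D (B (C x))"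
    using assms(1) by (auto simp: factors_through_def a b)
  obtain C' D' where 2: "is_operator (Z, P, C')" "is_operator (Q, W, D')"
      "\<forall>x\<in>Z. B x = D' (G (C' x))"
    using assms(2) by (auto simp: factors_through_def b c)
  have "C x \<in> Z" if "x \<in> X" for x
    using 1(1) that by (auto simp: is_operator_def)
  then have "\<forall>x\<in>X. A x = (\<lambda>y. D (D' y)) (G ((\<lambda>x. C' (C x)) x))"
    using 1(3) 2(3) by simp
  then show ?thesis
    using is_operator_compose[OF 1(1) 2(1)] is_operator_compose[OF 2(2) 1(2)]
    unfolding a c factors_through_def by blast
qed

text \<open>Universal operators factor through each other, so it makes no difference if the
  universal operator is allowed to depend on \<open>'a\<close> and \<open>'b\<close>.\<close>

lemma complement_admits_universal_iff:
  "complement_admits_universal J J' \<longleftrightarrow>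
     (\<exists>u. universal_operator J J u) \<and> (\<exists>u. universal_operator J J' u)"
  unfolding complement_admits_universal_def universal_operator_def
  by (meson factors_through_trans)

section \<open>Schreier families\<close>

text \<open>A choice of sequences \<open>\<xi>\<^sub>n \<up> \<xi>\<close> (\<open>n \<ge> 1\<close>), one for every limit ordinal \<open>\<xi>\<close>.\<close>

definition fundamental_sequences :: "(omega1 \<Rightarrow> nat \<Rightarrow> omega1) \<Rightarrow> bool" where
  "fundamental_sequences \<sigma> \<longleftrightarrow>
     (\<forall>\<xi>. is_limit \<xi> \<longrightarrow>
        strict_mono_on {1..} (\<sigma> \<xi>) \<and> (\<forall>n\<ge>1. \<sigma> \<xi> n < \<xi>) \<and> (\<forall>\<zeta><\<xi>. \<exists>n\<ge>1. \<zeta> < \<sigma> \<xi> n))"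

text \<open>The Schreier families consist of finite sets of positive integers. In the successor step
  the sets \<open>E\<^sub>i\<close> are nonempty: if \<open>E\<^sub>1\<close> could be empty, \<open>n \<le> E\<^sub>1\<close> would not restrict
  the remaining sets. The guard \<open>\<sigma> \<xi> n < \<xi>\<close> only serves termination.\<close>

function schreier :: "(omega1 \<Rightarrow> nat \<Rightarrow> omega1) \<Rightarrow> omega1 \<Rightarrow> nat set set" where
  "schreier \<sigma> \<xi> =
     (if \<xi> = 0 then insert {} {{n} |n. n \<ge> 1}
      else if is_limit \<xi> then
        insert {} {E. \<exists>n\<ge>1. (\<forall>k\<in>E. n \<le> k) \<and>
          E \<in> (if \<sigma> \<xi> n < \<xi> then schreier \<sigma> (\<sigma> \<xi> n) else {})}
      else
        insert {} {\<Union> (F ` {1..n}) |F n. n \<ge> 1 \<and>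
          (\<forall>i\<in>{1..n}. F i \<noteq> {} \<and> F i \<in> schreier \<sigma> (opred \<xi>)) \<and>
          (\<forall>k\<in>F 1. n \<le> k) \<and>
          (\<forall>i j. 1 \<le> i \<and> i < j \<and> j \<le> n \<longrightarrow> (\<forall>a\<in>F i. \<forall>b\<in>F j. a < b))})"
  by pat_completeness auto
termination
  by (relation "inv_image {(x, y). x < y} snd") (auto intro: wf_inv_image wf opred_less)

declare schreier.simps [simp del]

lemma schreier_zero: "schreier \<sigma> 0 = insert {} {{n} |n. n \<ge> 1}"
  by (simp add: schreier.simps)

lemma schreier_osuc:
  "schreier \<sigma> (osuc \<xi>) =
     insert {} {\<Union> (F ` {1..n}) |F n. n \<ge> 1 \<and>
       (\<forall>i\<in>{1..n}. F i \<noteq> {} \<and> F i \<in> schreier \<sigma> \<xi>) \<and>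
       (\<forall>k\<in>F 1. n \<le> k) \<and>
       (\<forall>i j. 1 \<le> i \<and> i < j \<and> j \<le> n \<longrightarrow> (\<forall>a\<in>F i. \<forall>b\<in>F j. a < b))}"
  by (subst schreier.simps) simp

lemma schreier_limit:
  assumes "fundamental_sequences \<sigma>" "is_limit \<xi>"
  shows "schreier \<sigma> \<xi> =
     insert {} {E. \<exists>n\<ge>1. (\<forall>k\<in>E. n \<le> k) \<and> E \<in> schreier \<sigma> (\<sigma> \<xi> n)}"
  using assms by (subst schreier.simps) (auto simp: fundamental_sequences_def)

section \<open>Basic sequences and the classes of strictly singular type\<close>

definition schauder_basis_of :: "(nat \<Rightarrow> 'a::banach) \<Rightarrow> 'a set \<Rightarrow> bool" where
  "schauder_basis_of x X \<longleftrightarrow>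
     (\<forall>n. x n \<in> X) \<and> (\<forall>y\<in>X. \<exists>!a :: nat \<Rightarrow> real. (\<lambda>n. a n *\<^sub>R x n) sums y)"

definition basic_sequence :: "(nat \<Rightarrow> 'a::banach) \<Rightarrow> bool" where
  "basic_sequence x \<longleftrightarrow> schauder_basis_of x (closure (span (range x)))"

text \<open>The finite sequence \<open>(y\<^sub>i)\<close> is basic with basis constant at most \<open>K\<close>.\<close>

definition K_basic :: "real \<Rightarrow> 'a::real_normed_vector list \<Rightarrow> bool" where
  "K_basic K ys \<longleftrightarrow>
     (\<forall>a :: nat \<Rightarrow> real. (\<Sum>i<length ys. a i *\<^sub>R ys ! i) = 0 \<longrightarrow> (\<forall>i<length ys. a i = 0)) \<and>
     (\<forall>(a :: nat \<Rightarrow> real). \<forall>m\<le>length ys.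
        norm (\<Sum>i<m. a i *\<^sub>R ys ! i) \<le> K * norm (\<Sum>i<length ys. a i *\<^sub>R ys ! i))"

text \<open>\<open>l1_norm I a\<close> and \<open>c0_norm I a\<close> are the norms of \<open>\<Sum>i\<in>I. a i e\<^sub>i\<close>
  in \<open>\<ell>\<^sub>1\<close> and in \<open>c\<^sub>0\<close>, for finite \<open>I\<close>.\<close>

definition l1_norm :: "nat set \<Rightarrow> (nat \<Rightarrow> real) \<Rightarrow> real" where
  "l1_norm I a = (\<Sum>i\<in>I. \<bar>a i\<bar>)"

definition c0_norm :: "nat set \<Rightarrow> (nat \<Rightarrow> real) \<Rightarrow> real" where
  "c0_norm I a = Max (insert 0 ((\<lambda>i. \<bar>a i\<bar>) ` I))"

text \<open>\<open>N\<close> is \<open>l1_norm\<close> or \<open>c0_norm\<close>. Sequences are indexed by the positive integers, so \<open>x 0\<close> plays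
  no role. Scalars are indexed by the elements \<open>n\<^sub>i\<close> of the set \<open>F\<close> instead of by \<open>i\<close>; this
  does not change the norm of \<open>\<Sum>i. a\<^sub>i e\<^sub>i\<close>, both bases being isometric to their
  subsequences.\<close>

definition schreier_singular ::
    "(nat set \<Rightarrow> (nat \<Rightarrow> real) \<Rightarrow> real) \<Rightarrow> (omega1 \<Rightarrow> nat \<Rightarrow> omega1) \<Rightarrow> omega1
     \<Rightarrow> ('a::banach, 'b::banach) oper set" where
  "schreier_singular N \<sigma> \<xi> = {(X, Y, A). is_operator (X, Y, A) \<and>
     (\<forall>(x :: nat \<Rightarrow> 'a) \<epsilon> :: real.
        (\<forall>n\<ge>1. x n \<in> X \<and> norm (x n) = 1) \<and> basic_sequence (\<lambda>n. x (Suc n)) \<and> \<epsilon> > 0 \<longrightarrow>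
        (\<exists>F\<in>schreier \<sigma> \<xi>. \<exists>a :: nat \<Rightarrow> real.
           norm (\<Sum>n\<in>F. a n *\<^sub>R A (x n)) < \<epsilon> * N F a \<or>
           N F a < \<epsilon> * norm (\<Sum>n\<in>F. a n *\<^sub>R x n)))}"

abbreviation "S_Sl1 \<equiv> schreier_singular l1_norm"
abbreviation "S_Sc0 \<equiv> schreier_singular c0_norm"

section \<open>Trees\<close>

definition tree_derivative :: "'a list set \<Rightarrow> 'a list set" where
  "tree_derivative T = {t \<in> T. \<exists>s\<in>T. strict_prefix t s}"

function tree_deriv_iter :: "'a list set \<Rightarrow> omega1 \<Rightarrow> 'a list set" where
  "tree_deriv_iter T \<xi> =
     (if \<xi> = 0 then T
      else if is_limit \<xi> then \<Inter> ((\<lambda>\<zeta>. tree_deriv_iter T \<zeta>) ` {..<\<xi>})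
      else tree_derivative (tree_deriv_iter T (opred \<xi>)))"
  by pat_completeness auto
termination
  by (relation "inv_image {(x, y). x < y} snd") (auto intro: wf_inv_image wf opred_less)

declare tree_deriv_iter.simps [simp del]

lemma tree_deriv_iter_zero: "tree_deriv_iter T 0 = T"
  by (simp add: tree_deriv_iter.simps)

lemma tree_deriv_iter_osuc:
  "tree_deriv_iter T (osuc \<xi>) = tree_derivative (tree_deriv_iter T \<xi>)"
  by (subst tree_deriv_iter.simps) simp

lemma tree_deriv_iter_limit:
  "is_limit \<xi> \<Longrightarrow> tree_deriv_iter T \<xi> = (\<Inter>\<zeta><\<xi>. tree_deriv_iter T \<zeta>)"
  by (subst tree_deriv_iter.simps) auto

text \<open>The order of a tree, where \<open>\<infinity>\<close> stands for all values that are not countable ordinals.\<close>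

definition tree_order :: "'a list set \<Rightarrow> omega1 extended" where
  "tree_order T =
     (if \<exists>\<xi>. tree_deriv_iter T \<xi> = {} then Fin (LEAST \<xi>. tree_deriv_iter T \<xi> = {}) else \<infinity>)"

definition tree_Sc0 :: "('a::banach, 'b::banach) oper \<Rightarrow> real \<Rightarrow> 'a list set" where
  "tree_Sc0 = (\<lambda>(X, Y, A) K. {xs.
     set xs \<subseteq> {x \<in> X. norm x = 1} \<and>
     K_basic K (map A xs) \<and>
     (\<forall>a :: nat \<Rightarrow> real.
        c0_norm {..<length xs} a \<le> K * norm (\<Sum>i<length xs. a i *\<^sub>R A (xs ! i))) \<and>
     (\<forall>a :: nat \<Rightarrow> real.
        norm (\<Sum>i<length xs. a i *\<^sub>R xs ! i) \<le> c0_norm {..<length xs} a)})"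

text \<open>The supremum over \<open>K\<close> is at most \<open>\<omega>\<^sup>\<xi>\<close> iff every member is.\<close>

definition Sc0 :: "omega1 \<Rightarrow> ('a::banach, 'b::banach) oper set" where
  "Sc0 \<xi> = {A. is_operator A \<and> (\<forall>K\<ge>1. tree_order (tree_Sc0 A K) \<le> Fin (omega_pow \<xi>))}"

end

theory Submission
  imports Defs "HOL-Library.Diagonal_Subsequence"
begin

text \<open>The codomain of each universal operator \<open>U\<close> is \<open>\<ell>\<^sub>\<infinity>\<close>, which is injective, so that it suffices to
  map the vectors \<open>A x\<^sub>i\<close> to the vectors \<open>U z\<^sub>i\<close> boundedly on their span. The domain has a monotone
  basis \<open>(z\<^sub>i)\<close> whose norm is the largest one for which \<open>\<Sum>i\<in>F. a\<^sub>i z\<^sub>i\<close> has norm at most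
  \<open>max \<bar>a\<^sub>i\<bar>\<close> for all \<open>F\<close> in a family of finite sets, so that \<open>z\<^sub>i \<mapsto> x\<^sub>i\<close> is bounded as soon as
  \<open>(x\<^sub>i)\<close> has upper \<open>c\<^sub>0\<close> estimates on the family.

  (ii) The family is \<open>S\<^sub>\<xi>\<close> and \<open>U z\<^sub>i = e\<^sub>i\<close> in \<open>c\<^sub>0\<close>. The upper estimates force \<open>A x\<^sub>i\<close> to be weakly null,
  and a basic subsequence dominates \<open>c\<^sub>0\<close>.

  (i) The family of singletons gives \<open>\<ell>\<^sub>1\<close>, and \<open>(U z\<^sub>i)\<close> is the basis of the Schreier space. By
  Rosenthal's theorem \<open>(A x\<^sub>i)\<close> has a subsequence that dominates \<open>\<ell>\<^sub>1\<close> or a weakly Cauchy one, whose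
  differences are weakly null and still \<open>\<ell>\<^sub>1\<close> on \<open>S\<^sub>\<xi>\<close>. A Ramsey argument makes functionals that are
  large on a set \<open>F\<close> small off \<open>F\<close>, and then the Schreier basis is dominated.

  (iii) The family consists of the branches of a countable forest of rank \<open>\<omega>\<^sup>\<xi>\<close>, and \<open>U z\<^sub>i = e\<^sub>i\<close>. As
  \<open>\<omega> \<cdot> \<omega>\<^sup>\<xi> = \<omega>\<^sup>\<xi>\<close> for \<open>\<xi> \<ge> \<omega>\<close>, every node of the forest can be given a block of a segment of unbounded
  finite length of a node of the tree of \<open>A\<close>. Such blocks can be chosen in the kernel of any
  finite set of functionals, so that the images under \<open>A\<close> form a basic sequence.\<close>

section \<open>Functionals\<close>

text \<open>The two estimates behind a factorization differ in difficulty. The upper one, for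
  \<open>z i \<mapsto> x i\<close>, has to be known on the sets of the family alone, where it comes
  directly from the class or from \<open>norm (x i) \<le> 1\<close>. The lower one, for the images,
  is the obstacle: the class controls them on special finite sets only, while
  \<open>dominates\<close> asks for all finite combinations. Against \<open>c\<^sub>0\<close> it
  amounts to bounded coordinates, which every basic sequence bounded away from 0 has. Against the
  Schreier basis the coefficients are summed over a Schreier set, and the remaining terms of the
  combination could cancel that sum; hence the functionals that almost vanish off the set. Schreier
  sets have unbounded size, so Ramsey's theorem for sets of a fixed size does not apply, and
  Galvin's lemma, which treats all finite sets at once, takes its place. In (iii) a block uses up
  finitely many levels of the tree of \<open>A\<close>, but their number depends on functionals that
  are known only after the earlier choices. Reserving \<omega> levels for every level of the forest
  removes this dependence.\<close>

lemma span_range_nat: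
  fixes h :: "nat \<Rightarrow> 'a::real_vector"
  assumes "v \<in> span (range h)"
  shows "\<exists>n a. v = (\<Sum>i<n. a i *\<^sub>R h i)"
  using assms
proof (induction rule: span_induct_alt)
  case base
  show ?case by (intro exI[of _ 0]) simp
next
  case (step c x y)
  then obtain k n a where x: "x = h k" and y: "y = (\<Sum>i<n. a i *\<^sub>R h i)" by blast
  define m where "m = max n (Suc k)"
  define b where "b i = (if i < n then a i else 0)" for i
  have "y = (\<Sum>i<m. b i *\<^sub>R h i)"
    unfolding y by (rule sum.mono_neutral_cong_left) (auto simp: b_def m_def)
  moreover have "c *\<^sub>R x = (\<Sum>i<m. (if i = k then c else 0) *\<^sub>R h i)"
    using sum.delta[of "{..<m}" k "\<lambda>i. c *\<^sub>R h i"]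
    by (simp add: x m_def if_distribR if_distrib[of "\<lambda>r. r *\<^sub>R _"] less_max_iff_disj cong: if_cong)
  ultimately have "c *\<^sub>R x + y = (\<Sum>i<m. ((if i = k then c else 0) + b i) *\<^sub>R h i)"
    by (simp add: sum.distrib scaleR_add_left)
  then show ?case by (intro exI)
qed

lemma span_range_nat_iff:
  "v \<in> span (range h) \<longleftrightarrow> (\<exists>n a. v = (\<Sum>i<n::nat. a i *\<^sub>R h i))"
  by (auto dest: span_range_nat intro!: span_sum span_scale intro: span_base)

text \<open>The bound makes the subspace \<open>H\<close> the graph of a functional on its domain.\<close>

lemma hahn_banach_graph:
  fixes H :: "('a::real_normed_vector \<times> real) set"
  assumes K: "K \<ge> 0" and sub: "subspace H" and bound: "\<And>x a. (x, a) \<in> H \<Longrightarrow> \<bar>a\<bar> \<le> K * norm x"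
  shows "\<exists>g. linear g \<and> (\<forall>(x, a)\<in>H. g x = a) \<and> (\<forall>x. \<bar>g x\<bar> \<le> K * norm x)"
proof -
  define A where "A = {G. subspace G \<and> H \<subseteq> G \<and> (\<forall>(x, a)\<in>G. \<bar>a\<bar> \<le> K * norm x)}"
  have "\<exists>M\<in>A. \<forall>X\<in>A. M \<subseteq> X \<longrightarrow> X = M"
  proof (rule subset_Zorn_nonempty)
    show "A \<noteq> {}" using assms by (auto simp: A_def)
    fix C assume "C \<noteq> {}" and "subset.chain A C"
    then have C: "C \<noteq> {}" "C \<subseteq> A" "\<And>X Y. X \<in> C \<Longrightarrow> Y \<in> C \<Longrightarrow> X \<subseteq> Y \<or> Y \<subseteq> X"
      by (auto simp: subset.chain_def)
    have "subspace (\<Union>C)"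
    proof (rule subspaceI)
      show "0 \<in> \<Union>C" using C by (force simp: A_def subspace_0)
      fix x y assume "x \<in> \<Union>C" "y \<in> \<Union>C"
      then obtain X where "X \<in> C" "x \<in> X" "y \<in> X" using C(3) by blast
      then show "x + y \<in> \<Union>C" using C(2) subspace_add unfolding A_def by blast
    next
      fix x c assume "x \<in> \<Union>C"
      then show "c *\<^sub>R x \<in> \<Union>C" using C(2) subspace_scale unfolding A_def by blast
    qed
    then show "\<Union>C \<in> A" using C by (fastforce simp: A_def)
  qed
  then obtain M where M: "M \<in> A" and max: "\<And>X. X \<in> A \<Longrightarrow> M \<subseteq> X \<Longrightarrow> X = M" by blast
  have Ms: "subspace M" and HM: "H \<subseteq> M" and Mb: "\<And>x a. (x, a) \<in> M \<Longrightarrow> \<bar>a\<bar> \<le> K * norm x"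
    using M by (auto simp: A_def)
  have uniq: "a = b" if "(x, a) \<in> M" "(x, b) \<in> M" for x a b
    using Mb[of "x - x" "a - b"] subspace_diff[OF Ms that] by simp
  have dom: "\<exists>a. (x, a) \<in> M" for x
  proof (rule ccontr)
    assume no: "\<nexists>a. (x, a) \<in> M"
    \<comment> \<open>The value \<open>c\<close> of an extension at \<open>x\<close> has to lie
      above all these lower bounds and below all upper bounds \<open>K * norm (w + x) - b\<close>;
      \<open>le\<close> separates the two families.\<close>
    define L where "L = (\<lambda>(z, a). - K * norm (z + x) - a) ` M"
    have le: "- K * norm (z + x) - a \<le> K * norm (w + x) - b" if "(z, a) \<in> M" "(w, b) \<in> M" for z a w b
    proof -
      have "b - a \<le> K * norm (w - z)" using Mb[of "w - z" "b - a"] subspace_diff[OF Ms that(2,1)] by simp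
      moreover have "K * norm (w - z) \<le> K * (norm (w + x) + norm (z + x))"
        using norm_triangle_ineq4[of "w + x" "z + x"] K by (intro mult_left_mono) auto
      ultimately show ?thesis by (simp add: algebra_simps)
    qed
    have M0: "(0, 0) \<in> M" using subspace_0[OF Ms] by (simp add: zero_prod_def)
    define c where "c = Sup L"
    have ne: "L \<noteq> {}" using M0 by (auto simp: L_def)
    have "bdd_above L" using le[OF _ M0] by (auto simp: L_def intro!: bdd_aboveI)
    then have lower: "- K * norm (z + x) - a \<le> c" if "(z, a) \<in> M" for z a
      unfolding c_def using that by (intro cSup_upper) (auto simp: L_def)
    have upper: "c \<le> K * norm (w + x) - b" if "(w, b) \<in> M" for w b
      unfolding c_def using ne le[OF _ that] by (intro cSup_least) (auto simp: L_def)
    \<comment> \<open>Homogeneity reduces \<open>t > 0\<close> to the vector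
      \<open>z /\<^sub>R t + x\<close>, to which \<open>lower\<close> and \<open>upper\<close>
      apply.\<close>
    have pos: "\<bar>a + t * c\<bar> \<le> K * norm (z + t *\<^sub>R x)" if "(z, a) \<in> M" "t > 0" for z a t
    proof -
      have "(z /\<^sub>R t, a / t) \<in> M"
        using subspace_scale[OF Ms that(1), of "inverse t"] by (simp add: divide_inverse mult.commute)
      from lower[OF this] upper[OF this]
      have "\<bar>c + a / t\<bar> \<le> K * norm (z /\<^sub>R t + x)" by linarith
      then have "t * \<bar>c + a / t\<bar> \<le> t * (K * norm (z /\<^sub>R t + x))"
        using that(2) by (intro mult_left_mono) auto
      also have "t * \<bar>c + a / t\<bar> = \<bar>t * (c + a / t)\<bar>" using that(2) by (simp add: abs_mult)
      also have "t * (c + a / t) = a + t * c" using that(2) by (simp add: field_simps)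
      also have "t * (K * norm (z /\<^sub>R t + x)) = K * norm (t *\<^sub>R (z /\<^sub>R t + x))" using that(2) by simp
      also have "t *\<^sub>R (z /\<^sub>R t + x) = z + t *\<^sub>R x" using that(2) by (simp add: scaleR_add_right)
      finally show ?thesis .
    qed
    have all: "\<bar>a + t * c\<bar> \<le> K * norm (z + t *\<^sub>R x)" if "(z, a) \<in> M" for z a t
    proof -
      consider "t > 0" | "t = 0" | "- t > 0" by linarith
      then show ?thesis
      proof cases
        case 3
        have "(- z, - a) \<in> M" using subspace_neg[OF Ms that] by simp
        from pos[OF this 3] show ?thesis
          by (metis abs_minus_cancel minus_add_distrib mult_minus_left norm_minus_cancel scaleR_minus_left)
      qed (use pos[OF that] Mb[OF that] in auto)
    qed
    define X where "X = {u + v |u v. u \<in> M \<and> v \<in> span {(x, c)}}"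
    have "M \<subseteq> X"
      unfolding X_def using span_zero[of "{(x, c)}"]
      by (metis (mono_tags, lifting) add.right_neutral mem_Collect_eq subsetI)
    moreover have "X \<in> A"
    proof -
      have "subspace X" unfolding X_def by (intro subspace_sums Ms subspace_span)
      moreover have "\<bar>r\<bar> \<le> K * norm z" if "(z, r) \<in> X" for z r
        using that all unfolding X_def by (auto simp: span_singleton)
      ultimately show ?thesis using \<open>M \<subseteq> X\<close> HM by (auto simp: A_def)
    qed
    ultimately have "X = M" by (intro max)
    moreover have "0 + (x, c) \<in> X"
      unfolding X_def using subspace_0[OF Ms] span_base[of "(x, c)" "{(x, c)}"] by blast
    ultimately show False using no by simp
  qed
  define g where "g x = (THE a. (x, a) \<in> M)" for x
  have g: "(x, g x) \<in> M" for x
    unfolding g_def using dom[of x] uniq by (metis theI)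
  have "linear g"
  proof (rule linearI)
    show "g (x + y) = g x + g y" for x y
      using uniq[OF g, of "x + y"] subspace_add[OF Ms g[of x] g[of y]] by simp
    show "g (r *\<^sub>R x) = r *\<^sub>R g x" for r x
      using uniq[OF g, of "r *\<^sub>R x"] subspace_scale[OF Ms g[of x], of r] by simp
  qed
  moreover have "\<forall>(x, a)\<in>H. g x = a" using uniq[OF g] HM by auto
  moreover have "\<forall>x. \<bar>g x\<bar> \<le> K * norm x" using Mb g by blast
  ultimately show ?thesis by blast
qed

text \<open>Linear relations among the \<open>y i\<close> are covered too: the bound forces the same
  relations among the \<open>c i\<close>, so the span of the pairs is the graph of a
  functional.\<close>

lemma functional_on_sequence:
  fixes y :: "nat \<Rightarrow> 'a::real_normed_vector" and c :: "nat \<Rightarrow> real"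
  assumes K: "K \<ge> 0" and bound: "\<And>a n. \<bar>\<Sum>i<n. a i * c i\<bar> \<le> K * norm (\<Sum>i<n. a i *\<^sub>R y i)"
  shows "\<exists>g. linear g \<and> (\<forall>i. g (y i) = c i) \<and> (\<forall>x. \<bar>g x\<bar> \<le> K * norm x)"
proof -
  have pair: "(\<Sum>i<n. a i *\<^sub>R (y i, c i)) = (\<Sum>i<n. a i *\<^sub>R y i, \<Sum>i<n. a i * c i)" for n :: nat and a
    by (induction n) (auto simp: zero_prod_def)
  have "\<bar>r\<bar> \<le> K * norm x" if "(x, r) \<in> span (range (\<lambda>i. (y i, c i)))" for x r
    using that bound unfolding span_range_nat_iff pair by auto
  from hahn_banach_graph[OF K subspace_span this]
  obtain g where "linear g" "\<forall>(x, a)\<in>span (range (\<lambda>i. (y i, c i))). g x = a" "\<forall>x. \<bar>g x\<bar> \<le> K * norm x"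
    by blast
  moreover have "(y i, c i) \<in> span (range (\<lambda>i. (y i, c i)))" for i by (intro span_base) auto
  ultimately show ?thesis by (intro exI[of _ g]) fastforce
qed

text \<open>Plain functions instead of bounded linear maps, so that the ball lies in a product of
  real lines, whose topology restricts to the weak* topology.\<close>

definition dual_ball :: "('a::real_normed_vector \<Rightarrow> real) set" where
  "dual_ball = {f. linear f \<and> (\<forall>v. \<bar>f v\<bar> \<le> norm v)}"

lemma functional_on_finite:
  fixes y :: "nat \<Rightarrow> 'a::real_normed_vector" and c :: "nat \<Rightarrow> real"
  assumes "finite F" and bound: "\<And>a. \<bar>\<Sum>i\<in>F. a i * c i\<bar> \<le> norm (\<Sum>i\<in>F. a i *\<^sub>R y i)"
  shows "\<exists>g\<in>dual_ball. \<forall>i\<in>F. g (y i) = c i"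
proof -
  define y' where "y' i = (if i \<in> F then y i else 0)" for i
  define c' where "c' i = (if i \<in> F then c i else 0)" for i
  have 1: "(\<Sum>i<n. a i * c' i) = (\<Sum>i\<in>F. (if i < n then a i else 0) * c i)" for a and n :: nat
    by (rule sum.mono_neutral_cong) (use assms(1) in \<open>auto simp: c'_def\<close>)
  have 2: "(\<Sum>i<n. a i *\<^sub>R y' i) = (\<Sum>i\<in>F. (if i < n then a i else 0) *\<^sub>R y i)" for a and n :: nat
    by (rule sum.mono_neutral_cong) (use assms(1) in \<open>auto simp: y'_def\<close>)
  obtain g where "linear g" "\<forall>i. g (y' i) = c' i" "\<forall>x. \<bar>g x\<bar> \<le> 1 * norm x"
    using functional_on_sequence[of 1 c' y'] bound by (auto simp: 1 2)
  moreover have "g (y i) = c i" if "i \<in> F" for i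
    using \<open>\<forall>i. g (y' i) = c' i\<close>[rule_format, of i] that by (simp add: y'_def c'_def)
  ultimately show ?thesis unfolding dual_ball_def by auto
qed

lemma norming_functional: "\<exists>g\<in>dual_ball. g v = norm v"
  using functional_on_finite[of "{0}" "\<lambda>_. norm v" "\<lambda>_. v"] by (auto simp: abs_mult)

lemma dual_ball_linear: "f \<in> dual_ball \<Longrightarrow> linear f"
  and dual_ball_le: "f \<in> dual_ball \<Longrightarrow> \<bar>f v\<bar> \<le> norm v"
  by (auto simp: dual_ball_def)

lemma dual_ball_sum: "f \<in> dual_ball \<Longrightarrow> f (\<Sum>i\<in>I. a i *\<^sub>R y i) = (\<Sum>i\<in>I. a i * f (y i))"
  using dual_ball_linear[of f] by (simp add: linear_sum linear_cmul)

text \<open>Banach-Alaoglu by Tychonoff: the ball is cut out of a product of compact intervals by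
  the linearity equations, each of which involves finitely many coordinates and is therefore
  closed.\<close>

lemma compact_dual_ball: "compact (dual_ball :: ('a::real_normed_vector \<Rightarrow> real) set)"
proof -
  have "compactin (product_topology (\<lambda>v::'a. euclidean) UNIV) (PiE UNIV (\<lambda>v. {- norm v..norm v}))"
    by (subst compactin_PiE) auto
  then have comp: "compact (PiE UNIV (\<lambda>v::'a. {- norm v..norm v}))"
    by (simp add: euclidean_product_topology)
  have "closed {f :: 'a \<Rightarrow> real. linear f}"
  proof -
    have "{f :: 'a \<Rightarrow> real. linear f} =
      (\<Inter>u v. {f. f (u + v) = f u + f v}) \<inter> (\<Inter>r v. {f. f (r *\<^sub>R v) = r * f v})"
      by (auto simp: linear_iff)
    also have "closed \<dots>"
      by (intro closed_Int closed_INT ballI closed_Collect_eq continuous_intros) auto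
    finally show ?thesis .
  qed
  moreover have "(dual_ball :: ('a \<Rightarrow> real) set) = PiE UNIV (\<lambda>v::'a. {- norm v..norm v}) \<inter> {f. linear f}"
    by (auto simp: dual_ball_def abs_le_iff PiE_def Pi_def minus_le_iff)
  ultimately show ?thesis using compact_Int_closed[OF comp] by metis
qed

text \<open>Weak* compactness merges functionals that are large on longer and longer initial
  segments into a single one. This is how \<open>avoid_bad_extensions\<close> contradicts weak
  nullity.\<close>

lemma dual_ball_limit:
  fixes h :: "('a::real_normed_vector \<Rightarrow> real) \<Rightarrow> nat \<Rightarrow> real"
  assumes cont: "\<And>i. continuous_on UNIV (\<lambda>f. h f i)"
    and ex: "\<And>N. \<exists>f\<in>dual_ball. \<forall>i\<le>N. \<delta> \<le> h f i"
  shows "\<exists>f\<in>dual_ball. \<forall>i. \<delta> \<le> h f i"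
proof -
  have "dual_ball \<inter> (\<Inter>i\<in>UNIV. {f. \<delta> \<le> h f i}) \<noteq> {}"
  proof (rule compact_imp_fip_image[OF compact_dual_ball])
    show "closed {f. \<delta> \<le> h f i}" for i
      by (intro closed_Collect_le cont continuous_on_const)
    fix I :: "nat set" assume "finite I"
    then obtain N where "\<forall>i\<in>I. i \<le> N" using finite_nat_set_iff_bounded_le by auto
    then show "dual_ball \<inter> (\<Inter>i\<in>I. {f. \<delta> \<le> h f i}) \<noteq> {}" using ex[of N] by blast
  qed
  then show ?thesis by blast
qed

section \<open>Bases and operators\<close>

definition dominates :: "real \<Rightarrow> (nat \<Rightarrow> 'a::real_normed_vector) \<Rightarrow> (nat \<Rightarrow> 'b::real_normed_vector) \<Rightarrow> bool" where
  "dominates K x y \<longleftrightarrow> (\<forall>a n. norm (\<Sum>i<n. a i *\<^sub>R y i) \<le> K * norm (\<Sum>i<n. a i *\<^sub>R x i))"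

definition projections_bounded :: "real \<Rightarrow> (nat \<Rightarrow> 'a::real_normed_vector) \<Rightarrow> bool" where
  "projections_bounded C z \<longleftrightarrow>
     (\<forall>a n. \<forall>m\<le>n. norm (\<Sum>i<m. a i *\<^sub>R z i) \<le> C * norm (\<Sum>i<n. a i *\<^sub>R z i))"

lemma subspace_closure:
  fixes S :: "'a::real_normed_vector set"
  assumes S: "subspace S"
  shows "subspace (closure S)"
proof (rule subspaceI)
  show "0 \<in> closure S" using closure_subset subspace_0[OF S] by auto
next
  fix u v assume "u \<in> closure S" "v \<in> closure S"
  then obtain p q where "\<forall>n. p n \<in> S" "p \<longlonglongrightarrow> u" "\<forall>n. q n \<in> S" "q \<longlonglongrightarrow> v"
    unfolding closure_sequential by blast
  then show "u + v \<in> closure S"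
    unfolding closure_sequential by (intro exI[of _ "\<lambda>n. p n + q n"]) (auto intro: subspace_add[OF S] tendsto_add)
next
  fix c u assume "u \<in> closure S"
  then obtain p where "\<forall>n. p n \<in> S" "p \<longlonglongrightarrow> u"
    unfolding closure_sequential by blast
  then show "c *\<^sub>R u \<in> closure S"
    unfolding closure_sequential by (intro exI[of _ "\<lambda>n. c *\<^sub>R p n"]) (auto intro: subspace_scale[OF S] tendsto_scaleR)
qed

lemma projections_bounded_coeff:
  assumes "projections_bounded C z" and "m < n"
  shows "\<bar>a m\<bar> * norm (z m) \<le> 2 * C * norm (\<Sum>i<n. a i *\<^sub>R z i)"
proof -
  have "\<bar>a m\<bar> * norm (z m) = norm ((\<Sum>i<Suc m. a i *\<^sub>R z i) - (\<Sum>i<m. a i *\<^sub>R z i))" by simp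
  also have "\<dots> \<le> norm (\<Sum>i<Suc m. a i *\<^sub>R z i) + norm (\<Sum>i<m. a i *\<^sub>R z i)" by (rule norm_triangle_ineq4)
  also have "\<dots> \<le> C * norm (\<Sum>i<n. a i *\<^sub>R z i) + C * norm (\<Sum>i<n. a i *\<^sub>R z i)"
    using assms unfolding projections_bounded_def by (intro add_mono) (blast intro: Suc_leI less_imp_le)+
  finally show ?thesis by simp
qed

lemma projections_bounded_nonneg:
  assumes "projections_bounded C z" "z 0 \<noteq> 0"
  shows "0 \<le> C"
  using projections_bounded_coeff[OF assms(1), of 0 1 "\<lambda>_. 1"] assms(2)
  by (auto simp: mult_le_cancel_right1)

lemma bounded_linear_functional:
  assumes "linear g" "\<And>x. \<bar>g x\<bar> \<le> K * norm x"
  shows "bounded_linear (g :: 'a::real_normed_vector \<Rightarrow> real)"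
  using assms by (intro bounded_linear_intro[where K = K]) (auto simp: linear_add linear_cmul mult.commute)

text \<open>A coefficient is controlled by the difference of two partial sums. Hahn-Banach extends
  the coefficient functionals to the whole space, so that they can be evaluated at limits of the
  span.\<close>

lemma coordinate_functionals:
  fixes z :: "nat \<Rightarrow> 'a::real_normed_vector"
  assumes pb: "projections_bounded C z" and nz: "\<And>i. z i \<noteq> 0"
  obtains f where "\<And>i. bounded_linear (f i)" "\<And>i j. f i (z j) = (if i = j then 1 else (0 :: real))"
proof -
  have C: "0 \<le> C" by (rule projections_bounded_nonneg[OF pb nz])
  have "\<exists>g. bounded_linear g \<and> (\<forall>j. g (z j) = (if i = j then 1 else (0 :: real)))" for i
  proof -
    have "\<bar>\<Sum>j<n. a j * (if i = j then 1 else 0)\<bar> \<le> 2 * C / norm (z i) * norm (\<Sum>j<n. a j *\<^sub>R z j)" for a and n :: nat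
    proof (cases "i < n")
      case True
      then have "(\<Sum>j<n. a j * (if i = j then 1 else 0)) = a i" by (simp add: if_distrib cong: if_cong)
      moreover have "\<bar>a i\<bar> \<le> 2 * C / norm (z i) * norm (\<Sum>j<n. a j *\<^sub>R z j)"
        using projections_bounded_coeff[OF pb True, of a] nz[of i] by (simp add: field_simps)
      ultimately show ?thesis by simp
    next
      case False
      then have "(\<Sum>j<n. a j * (if i = j then 1 else 0)) = 0" by (intro sum.neutral) auto
      then show ?thesis using C by simp
    qed
    then obtain g where "linear g" "\<forall>j. g (z j) = (if i = j then 1 else 0)"
        "\<forall>x. \<bar>g x\<bar> \<le> 2 * C / norm (z i) * norm x"
      using functional_on_sequence[of "2 * C / norm (z i)" "\<lambda>j. if i = j then 1 else 0" z] C by auto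
    then show ?thesis using bounded_linear_functional by blast
  qed
  then show ?thesis using that by metis
qed

text \<open>The partial sums \<open>P m\<close> are uniformly bounded on the closed span and fix
  every vector of the span from some \<open>m\<close> on, so they converge on the closure.\<close>

lemma basis_expansion:
  fixes z :: "nat \<Rightarrow> 'a::real_normed_vector"
  assumes pb: "projections_bounded C z" and C: "0 \<le> C"
    and f: "\<And>i. bounded_linear (f i)" "\<And>i j. f i (z j) = (if i = j then 1 else (0 :: real))"
    and y: "y \<in> closure (span (range z))"
  shows "(\<lambda>i. f i y *\<^sub>R z i) sums y"
proof -
  define P where "P m v = (\<Sum>i<m. f i v *\<^sub>R z i)" for m v
  have fsum: "f i (\<Sum>j<n. a j *\<^sub>R z j) = (if i < n then a i else 0)" for i n a
  proof -
    have "f i (\<Sum>j<n. a j *\<^sub>R z j) = (\<Sum>j<n. a j * f i (z j))"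
      using f(1)[of i] by (simp add: linear_simps bounded_linear.linear linear_sum linear_cmul)
    also have "\<dots> = (\<Sum>j<n. if i = j then a j else 0)" by (simp add: f(2) if_distrib cong: if_cong)
    finally show ?thesis by simp
  qed
  have P_span: "P m (\<Sum>i<n. a i *\<^sub>R z i) = (\<Sum>i<min m n. a i *\<^sub>R z i)" for m n a
  proof -
    have "P m (\<Sum>i<n. a i *\<^sub>R z i) = (\<Sum>i<m. (if i < n then a i else 0) *\<^sub>R z i)"
      unfolding P_def fsum ..
    also have "\<dots> = (\<Sum>i<min m n. a i *\<^sub>R z i)"
      by (rule sum.mono_neutral_cong_right) auto
    finally show ?thesis .
  qed
  have P_le: "norm (P m s) \<le> C * norm s" if "s \<in> span (range z)" for m s
    using that pb unfolding span_range_nat_iff projections_bounded_def by (auto simp: P_span)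
  have P_diff: "P m (u - v) = P m u - P m v" for m u v
    using f(1) by (simp add: P_def linear_simps scaleR_diff_left sum_subtractf)
  have contP: "continuous_on UNIV (P m)" for m
    unfolding P_def by (intro continuous_intros bounded_linear.continuous_on[OF f(1)])
  have P_le': "norm (P m v) \<le> C * norm v" if v: "v \<in> closure (span (range z))" for m v
  proof -
    have "closed {v. norm (P m v) \<le> C * norm v}"
      by (intro closed_Collect_le continuous_intros contP)
    then show ?thesis using closure_minimal[of "span (range z)" "{v. norm (P m v) \<le> C * norm v}"] P_le v by blast
  qed
  have "(\<lambda>m. P m y) \<longlonglongrightarrow> y"
  proof (rule LIMSEQ_I)
    fix e :: real assume e: "0 < e"
    define d where "d = e / (C + 1)"
    have "d > 0" using e C by (simp add: d_def)
    then obtain s where s: "s \<in> span (range z)" "dist s y < d" using y by (meson closure_approachable)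
    then obtain n a where sn: "s = (\<Sum>i<n. a i *\<^sub>R z i)" using span_range_nat by blast
    have "norm (P m y - y) < e" if "m \<ge> n" for m
    proof -
      have Ps: "P m s = s" using that by (simp add: sn P_span min_absorb2)
      have "y - s \<in> closure (span (range z))"
        using y s(1) by (intro subspace_diff subspace_closure subspace_span) (use closure_subset in auto)
      then have "norm (P m (y - s)) \<le> C * norm (y - s)" by (rule P_le')
      moreover have "norm (P m y - y) \<le> norm (P m (y - s)) + norm (y - s)"
        using norm_triangle_ineq4[of "P m (y - s)" "y - s"] by (simp add: P_diff Ps)
      ultimately have "norm (P m y - y) \<le> (C + 1) * norm (y - s)" by (simp add: algebra_simps)
      also have "\<dots> < (C + 1) * d"
        using s(2) C by (intro mult_strict_left_mono) (auto simp: dist_norm norm_minus_commute)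
      also have "\<dots> = e" using C by (simp add: d_def)
      finally show ?thesis .
    qed
    then show "\<exists>no. \<forall>m\<ge>no. norm (P m y - y) < e" by blast
  qed
  then show ?thesis by (simp add: sums_def P_def)
qed

text \<open>Grunblum's criterion. The coefficients of an expansion are unique because the coordinate
  functionals can be applied to the series term by term.\<close>

lemma basic_sequence_if_projections_bounded:
  fixes z :: "nat \<Rightarrow> 'a::banach"
  assumes pb: "projections_bounded C z" and nz: "\<And>i. z i \<noteq> 0"
  shows "basic_sequence z"
proof -
  obtain f where f: "\<And>i. bounded_linear (f i)" "\<And>i j. f i (z j) = (if i = j then 1 else (0 :: real))"
    using coordinate_functionals[OF pb nz] by blast
  have uniq: "a = (\<lambda>i. f i y)" if "(\<lambda>n. a n *\<^sub>R z n) sums y" for a y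
  proof
    fix i
    have "(\<lambda>n. f i (a n *\<^sub>R z n)) sums f i y" by (rule bounded_linear.sums[OF f(1) that])
    moreover have "f i (a n *\<^sub>R z n) = (if n = i then a n else 0)" for n
      using f(1)[of i] by (simp add: linear_simps f(2))
    ultimately have "(\<lambda>n. if n = i then a n else 0) sums f i y" by simp
    then show "a i = f i y" using sums_single[of i a] sums_unique2 by blast
  qed
  show ?thesis unfolding basic_sequence_def schauder_basis_of_def
  proof (intro conjI allI ballI ex1I)
    show "z n \<in> closure (span (range z))" for n
      by (meson closure_subset in_mono rangeI span_superset)
    show "(\<lambda>n. f n y *\<^sub>R z n) sums y" if "y \<in> closure (span (range z))" for y
      by (rule basis_expansion[OF pb projections_bounded_nonneg[OF pb nz] f that])
    show "a = (\<lambda>i. f i y)" if "(\<lambda>n. a n *\<^sub>R z n) sums y" for a y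
      by (rule uniq[OF that])
  qed
qed

text \<open>The image of \<open>y\<close> is its basis expansion with \<open>z\<close> replaced by
  \<open>x\<close>; domination of finite sums carries the Cauchy condition over and then bounds the
  limit.\<close>

lemma operator_from_basis:
  fixes z :: "nat \<Rightarrow> 'a::banach" and x :: "nat \<Rightarrow> 'b::banach"
  assumes pb: "projections_bounded C z" and nz: "\<And>i. z i \<noteq> 0"
    and X: "subspace X" "closed X" "\<And>i. x i \<in> X" and dom: "dominates K z x"
  shows "\<exists>T. is_operator (closure (span (range z)), X, T) \<and> (\<forall>i. T (z i) = x i)"
proof -
  let ?Z = "closure (span (range z))"
  obtain f where f: "\<And>i. bounded_linear (f i)" "\<And>i j. f i (z j) = (if i = j then 1 else (0 :: real))"
    using coordinate_functionals[OF pb nz] by blast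
  have zy: "(\<lambda>i. f i y *\<^sub>R z i) sums y" if "y \<in> ?Z" for y
    by (rule basis_expansion[OF pb projections_bounded_nonneg[OF pb nz] f that])
  have summ: "summable (\<lambda>i. f i y *\<^sub>R x i)" if y: "y \<in> ?Z" for y
    unfolding summable_Cauchy
  proof (intro allI impI)
    fix e :: real assume e: "0 < e"
    have "e / (\<bar>K\<bar> + 1) > 0" using e by (intro divide_pos_pos) auto
    then obtain N where N: "\<And>m n. m \<ge> N \<Longrightarrow> norm (\<Sum>i=m..<n. f i y *\<^sub>R z i) < e / (\<bar>K\<bar> + 1)"
      using zy[OF y] sums_summable summable_Cauchy[of "\<lambda>i. f i y *\<^sub>R z i"] by blast
    have "norm (\<Sum>i=m..<n. f i y *\<^sub>R x i) < e" if "m \<ge> N" for m n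
    proof -
      \<comment> \<open>\<open>dominates\<close> concerns initial segments, hence the padding by
        zeros below \<open>m\<close>.\<close>
      define a where "a i = (if m \<le> i then f i y else 0)" for i
      have "(\<Sum>i=m..<n. f i y *\<^sub>R x i) = (\<Sum>i<n. a i *\<^sub>R x i)"
        "(\<Sum>i=m..<n. f i y *\<^sub>R z i) = (\<Sum>i<n. a i *\<^sub>R z i)"
        by (rule sum.mono_neutral_cong_left; auto simp: a_def)+
      then have "norm (\<Sum>i=m..<n. f i y *\<^sub>R x i) \<le> K * norm (\<Sum>i=m..<n. f i y *\<^sub>R z i)"
        using dom unfolding dominates_def by simp
      also have "\<dots> \<le> (\<bar>K\<bar> + 1) * norm (\<Sum>i=m..<n. f i y *\<^sub>R z i)" by (intro mult_right_mono) auto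
      also have "\<dots> < (\<bar>K\<bar> + 1) * (e / (\<bar>K\<bar> + 1))" using N[OF that] by (intro mult_strict_left_mono) auto
      also have "\<dots> = e" by simp
      finally show ?thesis .
    qed
    then show "\<exists>N. \<forall>m\<ge>N. \<forall>n. norm (\<Sum>i=m..<n. f i y *\<^sub>R x i) < e" by blast
  qed
  define T where "T y = (\<Sum>i. f i y *\<^sub>R x i)" for y
  have T: "(\<lambda>i. f i y *\<^sub>R x i) sums T y" if "y \<in> ?Z" for y
    using summ[OF that] by (simp add: T_def summable_sums)
  have TX: "T y \<in> X" if "y \<in> ?Z" for y
  proof (rule closed_sequentially[OF X(2)])
    show "(\<lambda>n. \<Sum>i<n. f i y *\<^sub>R x i) \<longlonglongrightarrow> T y" using T[OF that] by (simp add: sums_def)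
    show "(\<Sum>i<n. f i y *\<^sub>R x i) \<in> X" for n using X by (intro subspace_sum subspace_scale) auto
  qed
  have Tadd: "T (u + v) = T u + T v" if "u \<in> ?Z" "v \<in> ?Z" for u v
  proof -
    have "(\<lambda>i. f i u *\<^sub>R x i + f i v *\<^sub>R x i) sums (T u + T v)" by (intro sums_add T that)
    moreover have "f i u *\<^sub>R x i + f i v *\<^sub>R x i = f i (u + v) *\<^sub>R x i" for i
      using f(1)[of i] by (simp add: linear_simps scaleR_add_left)
    ultimately show ?thesis unfolding T_def by (simp add: sums_iff)
  qed
  have Tscale: "T (c *\<^sub>R u) = c *\<^sub>R T u" if "u \<in> ?Z" for c u
  proof -
    have "(\<lambda>i. c *\<^sub>R (f i u *\<^sub>R x i)) sums (c *\<^sub>R T u)" by (intro sums_scaleR_right T that)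
    moreover have "c *\<^sub>R (f i u *\<^sub>R x i) = f i (c *\<^sub>R u) *\<^sub>R x i" for i
      using f(1)[of i] by (simp add: linear_simps)
    ultimately have "(\<lambda>i. f i (c *\<^sub>R u) *\<^sub>R x i) sums (c *\<^sub>R T u)" by (simp only:)
    then show ?thesis unfolding T_def by (simp only: sums_iff)
  qed
  have Tbound: "norm (T y) \<le> K * norm y" if "y \<in> ?Z" for y
  proof (rule LIMSEQ_le)
    show "(\<lambda>n. norm (\<Sum>i<n. f i y *\<^sub>R x i)) \<longlonglongrightarrow> norm (T y)"
      using T[OF that] by (intro tendsto_norm) (simp add: sums_def)
    show "(\<lambda>n. K * norm (\<Sum>i<n. f i y *\<^sub>R z i)) \<longlonglongrightarrow> K * norm y"
      using zy[OF that] by (intro tendsto_mult tendsto_const tendsto_norm) (simp add: sums_def)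
    show "\<exists>N. \<forall>n\<ge>N. norm (\<Sum>i<n. f i y *\<^sub>R x i) \<le> K * norm (\<Sum>i<n. f i y *\<^sub>R z i)"
      using dom by (simp add: dominates_def)
  qed
  have "T (z j) = x j" for j
  proof -
    have "(\<lambda>i. f i (z j) *\<^sub>R x i) = (\<lambda>i. if i = j then x i else 0)" by (auto simp: f(2))
    then show ?thesis unfolding T_def using sums_single[of j x] by (simp add: sums_iff)
  qed
  moreover have "is_operator (?Z, X, T)"
    unfolding is_operator_def using X TX Tadd Tscale Tbound
    by (auto simp: subspace_span subspace_closure intro!: exI[of _ K])
  ultimately show ?thesis by blast
qed

lemma operators_agree:
  assumes P: "is_operator (closure (span (range z)), W, P)" and Q: "is_operator (closure (span (range z)), V, Q)"
    and eq: "\<And>i. P (z i) = Q (z i)" and x: "x \<in> closure (span (range z))"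
  shows "P x = Q x"
proof -
  let ?Z = "closure (span (range z))"
  have subZ: "subspace ?Z" by (intro subspace_closure subspace_span)
  obtain M where M: "\<forall>x\<in>?Z. norm (P x) \<le> M * norm x" using P by (auto simp: is_operator_def)
  obtain N where N: "\<forall>x\<in>?Z. norm (Q x) \<le> N * norm x" using Q by (auto simp: is_operator_def)
  have add: "P (u + v) - Q (u + v) = (P u - Q u) + (P v - Q v)" if "u \<in> ?Z" "v \<in> ?Z" for u v
    using P Q that by (simp add: is_operator_def)
  have scale: "P (c *\<^sub>R u) - Q (c *\<^sub>R u) = c *\<^sub>R (P u - Q u)" if "u \<in> ?Z" for c u
    using P Q that by (simp add: is_operator_def scaleR_diff_right)
  have subs: "span (range z) \<subseteq> ?Z" by (rule closure_subset)
  have span0: "P s - Q s = 0" if s: "s \<in> span (range z)" for s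
  proof -
    have "s \<in> ?Z \<and> P s - Q s = 0"
      using s
    proof (induction rule: span_induct_alt)
      case base
      show ?case using scale[of 0 0] subspace_0[OF subZ] by simp
    next
      case (step c u v)
      then have "u \<in> ?Z" using subs span_superset[of "range z"] by auto
      then show ?case
        using step eq by (auto simp: add scale subspace_scale[OF subZ] subspace_add[OF subZ])
    qed
    then show ?thesis ..
  qed
  have "norm (P x - Q x) < e" if "e > 0" for e
  proof -
    define d where "d = e / (\<bar>M\<bar> + \<bar>N\<bar> + 1)"
    have "d > 0" using that by (simp add: d_def add_nonneg_pos)
    then obtain s where s: "s \<in> span (range z)" "dist s x < d" using x by (meson closure_approachable)
    have sZ: "s \<in> ?Z" "x - s \<in> ?Z" using s(1) subs x subspace_diff[OF subZ] by auto
    have "P x - Q x = P (x - s) - Q (x - s)" using add[OF sZ] span0[OF s(1)] by simp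
    then have "norm (P x - Q x) \<le> norm (P (x - s)) + norm (Q (x - s))" by (simp add: norm_triangle_ineq4)
    also have "\<dots> \<le> M * norm (x - s) + N * norm (x - s)" using M N sZ by (intro add_mono) auto
    also have "\<dots> = (M + N) * norm (x - s)" by (simp add: algebra_simps)
    also have "\<dots> \<le> (\<bar>M\<bar> + \<bar>N\<bar> + 1) * norm (x - s)" by (intro mult_right_mono) auto
    also have "\<dots> < (\<bar>M\<bar> + \<bar>N\<bar> + 1) * d"
      using s(2) by (intro mult_strict_left_mono) (auto simp: dist_norm norm_minus_commute)
    also have "\<dots> = e" using add_nonneg_pos[of "\<bar>M\<bar> + \<bar>N\<bar>" 1] by (simp add: d_def)
    finally show ?thesis .
  qed
  then show ?thesis by (metis less_irrefl norm_not_less_zero not_gr_zero right_minus_eq zero_less_norm_iff)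
qed

section \<open>Coordinates in \<open>linf\<close> and extension of operators into it\<close>

definition linf_of :: "(nat \<Rightarrow> real) \<Rightarrow> linf" where
  "linf_of f = Bcontfun (\<lambda>k. f (of_discrete k))"

definition coord :: "linf \<Rightarrow> nat \<Rightarrow> real" where
  "coord v k = apply_bcontfun v (discrete k)"

lemma coord_linf_of: "(\<And>k. \<bar>f k\<bar> \<le> B) \<Longrightarrow> coord (linf_of f) k = f k"
proof -
  assume "\<And>k. \<bar>f k\<bar> \<le> B"
  then have "(\<lambda>k. f (of_discrete k)) \<in> bcontfun"
    by (intro bcontfun_normI[where b = B]) (auto simp: continuous_on_open_invariant intro!: exI open_discrete)
  then show ?thesis by (simp add: coord_def linf_of_def Bcontfun_inverse discrete_inverse)
qed

lemma coord_add: "coord (u + v) k = coord u k + coord v k"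
  and coord_scale: "coord (c *\<^sub>R u) k = c * coord u k"
  and coord_zero: "coord 0 k = 0"
  by (simp_all add: coord_def)

lemma coord_sum: "coord (\<Sum>i\<in>I. a i *\<^sub>R v i) k = (\<Sum>i\<in>I. a i * coord (v i) k)"
  by (induction I rule: infinite_finite_induct) (auto simp: coord_add coord_scale coord_zero)

lemma abs_coord_le: "\<bar>coord v k\<bar> \<le> norm v"
  unfolding coord_def using norm_bounded[of v] by simp

lemma linf_norm_le: "(\<And>k. \<bar>coord v k\<bar> \<le> b) \<Longrightarrow> norm v \<le> b"
  unfolding coord_def by (rule norm_bound) (metis of_discrete_inverse real_norm_def)

lemma linf_eqI: "(\<And>k. coord u k = coord v k) \<Longrightarrow> u = v"
  unfolding coord_def by (rule bcontfun_eqI) (metis of_discrete_inverse)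

text \<open>Injectivity of the space of bounded sequences: every coordinate is extended by
  Hahn-Banach with the same bound \<open>K\<close>, so that the coordinates of \<open>D v\<close>
  stay bounded. The extensions live on the whole type, hence one \<open>D\<close> serves all
  subspaces \<open>V\<close>.\<close>

lemma operator_into_linf:
  fixes y :: "nat \<Rightarrow> 'b::banach" and w :: "nat \<Rightarrow> linf"
  assumes K: "0 \<le> K" and dom: "dominates K y w"
  shows "\<exists>D. (\<forall>V. subspace V \<longrightarrow> closed V \<longrightarrow> is_operator (V, UNIV, D)) \<and> (\<forall>i. D (y i) = w i)"
proof -
  have "\<exists>g. linear g \<and> (\<forall>i. g (y i) = coord (w i) k) \<and> (\<forall>x. \<bar>g x\<bar> \<le> K * norm x)" for k
  proof (rule functional_on_sequence[OF K])
    fix a and n :: nat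
    have "\<bar>\<Sum>i<n. a i * coord (w i) k\<bar> \<le> norm (\<Sum>i<n. a i *\<^sub>R w i)"
      using abs_coord_le by (simp flip: coord_sum)
    also have "\<dots> \<le> K * norm (\<Sum>i<n. a i *\<^sub>R y i)" using dom by (simp add: dominates_def)
    finally show "\<bar>\<Sum>i<n. a i * coord (w i) k\<bar> \<le> K * norm (\<Sum>i<n. a i *\<^sub>R y i)" .
  qed
  then obtain g where g: "\<And>k. linear (g k)" "\<And>k i. g k (y i) = coord (w i) k" "\<And>k x. \<bar>g k x\<bar> \<le> K * norm x"
    by metis
  define D where "D v = linf_of (\<lambda>k. g k v)" for v
  have D: "coord (D v) k = g k v" for v k
    unfolding D_def using g(3) by (rule coord_linf_of)
  have "D (u + v) = D u + D v" "D (c *\<^sub>R u) = c *\<^sub>R D u" for u v c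
    by (auto intro!: linf_eqI simp: D coord_add coord_scale linear_add[OF g(1)] linear_cmul[OF g(1)])
  moreover have "norm (D v) \<le> K * norm v" for v
    by (rule linf_norm_le) (simp add: D g(3))
  moreover have "D (y i) = w i" for i by (rule linf_eqI) (simp add: D g(2))
  ultimately show ?thesis by (auto simp: is_operator_def intro!: exI[of _ D] exI[of _ K])
qed

text \<open>\<open>U\<close> and the composition through \<open>A\<close> agree at the
  \<open>z i\<close>, hence on their closed span, which is the whole domain.\<close>

lemma factors_through_basis_operator:
  fixes A :: "'a::banach \<Rightarrow> 'b::banach"
  assumes pb: "projections_bounded C z" and nz: "\<And>i. z i \<noteq> 0"
    and U: "is_operator (closure (span (range z)), UNIV, U)" "\<And>i. U (z i) = w i"
    and A: "is_operator (X, Y, A)" and x: "\<And>i. x i \<in> X"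
    and zx: "dominates K z x" and K': "0 \<le> K'" and yw: "dominates K' (\<lambda>i. A (x i)) w"
  shows "factors_through (closure (span (range z)), UNIV :: linf set, U) (X, Y, A)"
proof -
  have XY: "subspace X" "closed X" "subspace Y" "closed Y" using A by (auto simp: is_operator_def)
  obtain T where T: "is_operator (closure (span (range z)), X, T)" "\<And>i. T (z i) = x i"
    using operator_from_basis[OF pb nz XY(1,2) x zx] by blast
  obtain D where D: "is_operator (Y, UNIV, D)" "\<And>i. D (A (x i)) = w i"
    using operator_into_linf[OF K' yw] XY by blast
  have "is_operator (closure (span (range z)), UNIV, \<lambda>v. D (A (T v)))"
    by (rule is_operator_compose[OF is_operator_compose[OF T(1) A] D(1)])
  from operators_agree[OF U(1) this] have "U v = D (A (T v))" if "v \<in> closure (span (range z))" for v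
    using that by (simp add: U(2) T(2) D(2))
  then show ?thesis unfolding factors_through_def using T(1) D(1) by blast
qed

section \<open>The largest norm with upper \<open>c\<^sub>0\<close> estimates on a family of sets\<close>

lemma c0_norm_le_iff: "finite F \<Longrightarrow> c0_norm F a \<le> b \<longleftrightarrow> 0 \<le> b \<and> (\<forall>i\<in>F. \<bar>a i\<bar> \<le> b)"
  unfolding c0_norm_def by (subst Max_le_iff) auto

lemma abs_le_c0_norm: "finite F \<Longrightarrow> i \<in> F \<Longrightarrow> \<bar>a i\<bar> \<le> c0_norm F a"
  and c0_norm_nonneg: "finite F \<Longrightarrow> 0 \<le> c0_norm F a"
  using c0_norm_le_iff[of F a "c0_norm F a"] by auto

text \<open>The type \<open>linf\<close> has countably many coordinates, so the functionals that
  define the norm must come from a countable set; the finitely supported rational sequences are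
  listed here by coding lists.\<close>

definition rat_seq :: "nat \<Rightarrow> nat \<Rightarrow> real" where
  "rat_seq k i = (let l = from_nat k :: rat list in if i < length l then of_rat (l ! i) else 0)"

lemma ex_rat_seq: "\<exists>k. \<forall>i. rat_seq k i = (if i < n then of_rat (r i) else 0)"
  by (rule exI[of _ "to_nat (map r [0..<n])"]) (simp add: rat_seq_def)

definition admissible :: "nat set set \<Rightarrow> (nat \<Rightarrow> real) \<Rightarrow> bool" where
  "admissible \<F> f \<longleftrightarrow> (\<forall>F\<in>\<F>. (\<Sum>i\<in>F. \<bar>f i\<bar>) \<le> 1)"

text \<open>The coordinates run through the rational finitely supported elements of the polar of
  the set of all \<open>\<Sum>i\<in>F. a\<^sub>i e\<^sub>i\<close> with \<open>F \<in> \<F>\<close> and \<open>\<bar>a\<^sub>i\<bar> \<le> 1\<close>.\<close>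

definition ubasis :: "nat set set \<Rightarrow> nat \<Rightarrow> linf" where
  "ubasis \<F> n = linf_of (\<lambda>k. if admissible \<F> (rat_seq k) then rat_seq k n else 0)"

text \<open>An admissible sequence is bounded by 1 at \<open>n\<close> because some set contains
  \<open>n\<close>. This makes the values of \<open>ubasis\<close> bounded sequences, as
  \<open>coord_linf_of\<close> requires.\<close>

definition covering :: "nat set set \<Rightarrow> bool" where
  "covering \<F> \<longleftrightarrow> (\<forall>F\<in>\<F>. finite F) \<and> \<Union>\<F> = UNIV"

lemma coord_ubasis:
  assumes "covering \<F>"
  shows "coord (ubasis \<F> n) k = (if admissible \<F> (rat_seq k) then rat_seq k n else 0)"
  unfolding ubasis_def
proof (rule coord_linf_of[where B = 1])
  fix k
  obtain F where F: "F \<in> \<F>" "n \<in> F" "finite F" using assms unfolding covering_def by blast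
  have "\<bar>rat_seq k n\<bar> \<le> 1" if "admissible \<F> (rat_seq k)"
    using member_le_sum[OF F(2), of "\<lambda>i. \<bar>rat_seq k i\<bar>"] F that unfolding admissible_def by fastforce
  then show "\<bar>if admissible \<F> (rat_seq k) then rat_seq k n else 0\<bar> \<le> 1" by simp
qed

lemma norm_ubasis_ge:
  assumes "covering \<F>" and "admissible \<F> (\<lambda>i. if i < m then of_rat (r i) else 0)"
  shows "\<bar>\<Sum>i<n. a i * (if i < m then of_rat (r i) else 0)\<bar> \<le> norm (\<Sum>i<n. a i *\<^sub>R ubasis \<F> i)"
proof -
  obtain k where k: "\<And>i. rat_seq k i = (if i < m then of_rat (r i) else 0)" using ex_rat_seq by blast
  then have "rat_seq k = (\<lambda>i. if i < m then of_rat (r i) else 0)" by auto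
  then have "coord (\<Sum>i<n. a i *\<^sub>R ubasis \<F> i) k = (\<Sum>i<n. a i * (if i < m then of_rat (r i) else 0))"
    using assms by (simp add: coord_sum coord_ubasis)
  then show ?thesis using abs_coord_le by metis
qed

lemma abs_le_norm_ubasis:
  assumes F: "covering \<F>" and "j < n"
  shows "\<bar>a j\<bar> \<le> norm (\<Sum>i<n. a i *\<^sub>R ubasis \<F> i)"
proof -
  let ?r = "\<lambda>i. if i = j then 1 else 0 :: rat"
  have "(\<Sum>i\<in>G. \<bar>if i < n then of_rat (?r i) else 0\<bar>) \<le> (1::real)" if "G \<in> \<F>" for G
  proof -
    have "finite G" using F that by (auto simp: covering_def)
    then have "(\<Sum>i\<in>G. if i = j then 1 else 0) \<le> (1::real)" by (simp add: sum.delta)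
    moreover have "(\<Sum>i\<in>G. \<bar>if i < n then of_rat (?r i) else 0\<bar>) = (\<Sum>i\<in>G. if i = j then 1 else (0::real))"
      using assms(2) by (intro sum.cong) auto
    ultimately show ?thesis by simp
  qed
  then have "admissible \<F> (\<lambda>i. if i < n then of_rat (?r i) else 0)" unfolding admissible_def by blast
  from norm_ubasis_ge[OF F this, of a n]
  have "\<bar>\<Sum>i<n. a i * (if i < n then of_rat (?r i) else 0)\<bar> \<le> norm (\<Sum>i<n. a i *\<^sub>R ubasis \<F> i)" .
  moreover have "(\<Sum>i<n. a i * (if i < n then of_rat (?r i) else 0)) = (\<Sum>i<n. if i = j then a j else 0)"
    by (intro sum.cong) auto
  ultimately show ?thesis using assms(2) by simp
qed

text \<open>The polar is closed under truncation: a coordinate of a partial sum is the coordinate of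
  the whole sum that belongs to the rational sequence cut off at \<open>m\<close>.\<close>

lemma projections_bounded_ubasis:
  assumes F: "covering \<F>"
  shows "projections_bounded 1 (ubasis \<F>)"
  unfolding projections_bounded_def
proof (intro allI impI)
  fix a and m n :: nat assume "m \<le> n"
  show "norm (\<Sum>i<m. a i *\<^sub>R ubasis \<F> i) \<le> 1 * norm (\<Sum>i<n. a i *\<^sub>R ubasis \<F> i)"
    unfolding mult_1
  proof (rule linf_norm_le)
    fix k
    define f where "f = rat_seq k"
    define l where "l = (from_nat k :: rat list)"
    define r where "r i = (if i < length l then l ! i else 0)" for i
    have f: "f i = of_rat (r i)" for i by (simp add: f_def rat_seq_def l_def r_def Let_def)
    show "\<bar>coord (\<Sum>i<m. a i *\<^sub>R ubasis \<F> i) k\<bar> \<le> norm (\<Sum>i<n. a i *\<^sub>R ubasis \<F> i)"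
    proof (cases "admissible \<F> f")
      case True
      have "(\<Sum>i\<in>G. \<bar>if i < m then of_rat (r i) else 0\<bar>) \<le> (1::real)" if "G \<in> \<F>" for G
      proof -
        have "(\<Sum>i\<in>G. \<bar>if i < m then of_rat (r i) else 0\<bar>) \<le> (\<Sum>i\<in>G. \<bar>f i\<bar>)"
          by (intro sum_mono) (simp add: f)
        then show ?thesis using True that unfolding admissible_def by force
      qed
      then have "admissible \<F> (\<lambda>i. if i < m then of_rat (r i) else 0)" unfolding admissible_def by blast
      from norm_ubasis_ge[OF F this, of a n]
      have "\<bar>\<Sum>i<n. a i * (if i < m then of_rat (r i) else 0)\<bar> \<le> norm (\<Sum>i<n. a i *\<^sub>R ubasis \<F> i)" .
      moreover have "(\<Sum>i<n. a i * (if i < m then of_rat (r i) else 0)) = (\<Sum>i<m. a i * f i)"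
        using \<open>m \<le> n\<close> by (intro sum.mono_neutral_cong_right) (auto simp: f)
      ultimately show ?thesis using True by (simp add: coord_sum coord_ubasis[OF F] f_def)
    next
      case False
      then show ?thesis by (simp add: coord_sum coord_ubasis[OF F] f_def)
    qed
  qed
qed

lemma norm_ubasis_sum_le:
  assumes F: "covering \<F>" and G: "G \<in> \<F>"
  shows "norm (\<Sum>i\<in>G. a i *\<^sub>R ubasis \<F> i) \<le> c0_norm G a"
proof (rule linf_norm_le)
  fix k
  have fin: "finite G" using F G by (auto simp: covering_def)
  show "\<bar>coord (\<Sum>i\<in>G. a i *\<^sub>R ubasis \<F> i) k\<bar> \<le> c0_norm G a"
  proof (cases "admissible \<F> (rat_seq k)")
    case True
    have "\<bar>\<Sum>i\<in>G. a i * rat_seq k i\<bar> \<le> (\<Sum>i\<in>G. c0_norm G a * \<bar>rat_seq k i\<bar>)"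
      by (rule order_trans[OF sum_abs]) (auto simp: abs_mult intro!: sum_mono mult_right_mono abs_le_c0_norm fin)
    also have "\<dots> = c0_norm G a * (\<Sum>i\<in>G. \<bar>rat_seq k i\<bar>)" by (simp add: sum_distrib_left)
    also have "\<dots> \<le> c0_norm G a * 1"
      using True G c0_norm_nonneg[OF fin] unfolding admissible_def by (intro mult_left_mono) auto
    finally show ?thesis using True by (simp add: coord_sum coord_ubasis[OF F])
  qed (simp add: coord_sum coord_ubasis[OF F] c0_norm_nonneg[OF fin])
qed

lemma norm_ubasis:
  assumes F: "covering \<F>"
  shows "norm (ubasis \<F> n) = 1"
proof (rule antisym)
  show "norm (ubasis \<F> n) \<le> 1"
  proof (rule linf_norm_le)
    fix k
    obtain G where G: "G \<in> \<F>" "n \<in> G" "finite G" using F unfolding covering_def by blast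
    have "\<bar>rat_seq k n\<bar> \<le> 1" if "admissible \<F> (rat_seq k)"
      using member_le_sum[OF G(2), of "\<lambda>i. \<bar>rat_seq k i\<bar>"] G that unfolding admissible_def by fastforce
    then show "\<bar>coord (ubasis \<F> n) k\<bar> \<le> 1" by (simp add: coord_ubasis[OF F])
  qed
  have "(\<Sum>i<Suc n. (if i = n then 1 else 0) *\<^sub>R ubasis \<F> i) = ubasis \<F> n" by simp
  then show "1 \<le> norm (ubasis \<F> n)"
    using abs_le_norm_ubasis[OF F, of n "Suc n" "\<lambda>i. if i = n then 1 else 0"] by simp
qed

text \<open>Rounding towards 0 keeps an admissible sequence admissible.\<close>

lemma rat_approx_below:
  fixes h e :: real
  assumes "e > 0"
  shows "\<exists>r. \<bar>of_rat r\<bar> \<le> \<bar>h\<bar> \<and> \<bar>h - of_rat r\<bar> \<le> e"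
proof -
  consider "h = 0" | "h > 0" | "h < 0" by linarith
  then show ?thesis
  proof cases
    case 1
    then show ?thesis using assms by (intro exI[of _ 0]) auto
  next
    case 2
    then obtain r where "max 0 (h - e) < of_rat r" "of_rat r < h" using of_rat_dense[of "max 0 (h - e)" h] assms by auto
    then show ?thesis by (intro exI[of _ r]) auto
  next
    case 3
    then obtain r where "h < of_rat r" "of_rat r < min 0 (h + e)" using of_rat_dense[of h "min 0 (h + e)"] assms 3 by auto
    then have "(of_rat r :: real) < 0" "of_rat r < h + e" by linarith+
    with \<open>h < of_rat r\<close> have "\<bar>of_rat r\<bar> \<le> \<bar>h\<bar>" "\<bar>h - of_rat r\<bar> \<le> e" by linarith+
    then show ?thesis by blast
  qed
qed

text \<open>Duality makes the norm maximal. Testing signed sums over the sets of the family shows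
  that the values at the \<open>x i\<close> of a functional norming the combination, divided by
  \<open>K\<close>, form an admissible sequence, and this sequence is approximated by rational
  ones.\<close>

lemma ubasis_dominates:
  fixes x :: "nat \<Rightarrow> 'a::real_normed_vector"
  assumes F: "covering \<F>" and K: "0 < K"
    and x: "\<And>G a. G \<in> \<F> \<Longrightarrow> norm (\<Sum>i\<in>G. a i *\<^sub>R x i) \<le> K * c0_norm G a"
  shows "dominates K (ubasis \<F>) x"
  unfolding dominates_def
proof (intro allI)
  fix a and n :: nat
  obtain g where g: "g \<in> dual_ball" "g (\<Sum>i<n. a i *\<^sub>R x i) = norm (\<Sum>i<n. a i *\<^sub>R x i)"
    using norming_functional by blast
  define h where "h i = g (x i) / K" for i
  have hG: "(\<Sum>i\<in>G. \<bar>h i\<bar>) \<le> 1" if G: "G \<in> \<F>" for G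
  proof -
    have fin: "finite G" using F G by (auto simp: covering_def)
    have "(\<Sum>i\<in>G. \<bar>g (x i)\<bar>) = g (\<Sum>i\<in>G. sgn (g (x i)) *\<^sub>R x i)"
      by (simp add: dual_ball_sum[OF g(1)] linordered_idom_class.abs_sgn mult.commute)
    also have "\<dots> \<le> norm (\<Sum>i\<in>G. sgn (g (x i)) *\<^sub>R x i)" using dual_ball_le[OF g(1)] by (meson abs_le_D1)
    also have "\<dots> \<le> K * c0_norm G (\<lambda>i. sgn (g (x i)))" by (rule x[OF G])
    also have "\<dots> \<le> K * 1" using K fin by (intro mult_left_mono) (auto simp: c0_norm_le_iff abs_sgn_eq)
    finally show ?thesis using K by (simp add: h_def sum_divide_distrib[symmetric] abs_mult)
  qed
  have "norm (\<Sum>i<n. a i *\<^sub>R x i) \<le> K * norm (\<Sum>i<n. a i *\<^sub>R ubasis \<F> i) + e" if e: "e > 0" for e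
  proof -
    \<comment> \<open>Keeps the total rounding error at most \<open>e\<close>; the added 1 excludes
      division by 0.\<close>
    define d where "d = e / (K * ((\<Sum>i<n. \<bar>a i\<bar>) + 1))"
    have pos: "(\<Sum>i<n. \<bar>a i\<bar>) + 1 > 0" by (intro add_nonneg_pos sum_nonneg) auto
    then have d: "d > 0" using e K by (simp add: d_def)
    obtain r where r: "\<And>i. \<bar>of_rat (r i)\<bar> \<le> \<bar>h i\<bar>" "\<And>i. \<bar>h i - of_rat (r i)\<bar> \<le> d"
      using rat_approx_below[OF d, of "h _"] by metis
    have "(\<Sum>i\<in>G. \<bar>if i < n then of_rat (r i) else 0\<bar>) \<le> (1::real)" if "G \<in> \<F>" for G
    proof -
      have "(\<Sum>i\<in>G. \<bar>if i < n then of_rat (r i) else 0\<bar>) \<le> (\<Sum>i\<in>G. \<bar>h i\<bar>)"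
        by (intro sum_mono) (use r(1) in simp)
      then show ?thesis using hG[OF that] by simp
    qed
    then have "admissible \<F> (\<lambda>i. if i < n then of_rat (r i) else 0)" unfolding admissible_def by blast
    from norm_ubasis_ge[OF F this, of a n]
    have 1: "\<bar>\<Sum>i<n. a i * of_rat (r i)\<bar> \<le> norm (\<Sum>i<n. a i *\<^sub>R ubasis \<F> i)" by simp
    have "norm (\<Sum>i<n. a i *\<^sub>R x i) = (\<Sum>i<n. a i * g (x i))" using g by (simp add: dual_ball_sum)
    also have "\<dots> = K * (\<Sum>i<n. a i * h i)" using K by (simp add: h_def sum_distrib_left)
    also have "(\<Sum>i<n. a i * h i) = (\<Sum>i<n. a i * of_rat (r i)) + (\<Sum>i<n. a i * (h i - of_rat (r i)))"
      by (simp add: sum.distrib[symmetric] algebra_simps)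
    also have "\<dots> \<le> norm (\<Sum>i<n. a i *\<^sub>R ubasis \<F> i) + (\<Sum>i<n. \<bar>a i\<bar>) * d"
    proof (rule add_mono)
      show "(\<Sum>i<n. a i * of_rat (r i)) \<le> norm (\<Sum>i<n. a i *\<^sub>R ubasis \<F> i)" using 1 by simp
      have "a i * (h i - of_rat (r i)) \<le> \<bar>a i\<bar> * d" for i
        using mult_left_mono[OF r(2)[of i], of "\<bar>a i\<bar>"] by (simp add: abs_mult[symmetric])
      then show "(\<Sum>i<n. a i * (h i - of_rat (r i))) \<le> (\<Sum>i<n. \<bar>a i\<bar>) * d"
        unfolding sum_distrib_right by (intro sum_mono)
    qed
    finally have "norm (\<Sum>i<n. a i *\<^sub>R x i) \<le> K * norm (\<Sum>i<n. a i *\<^sub>R ubasis \<F> i) + K * ((\<Sum>i<n. \<bar>a i\<bar>) * d)"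
      using K by (simp add: distrib_left)
    also have "K * ((\<Sum>i<n. \<bar>a i\<bar>) * d) \<le> K * (((\<Sum>i<n. \<bar>a i\<bar>) + 1) * d)"
      using K d by (intro mult_left_mono mult_right_mono) auto
    also have "\<dots> = e" using K pos by (simp add: d_def)
    finally show ?thesis by simp
  qed
  then show "norm (\<Sum>i<n. a i *\<^sub>R x i) \<le> K * norm (\<Sum>i<n. a i *\<^sub>R ubasis \<F> i)" by (rule field_le_epsilon)
qed

definition unit_seq :: "nat \<Rightarrow> linf" where
  "unit_seq n = linf_of (\<lambda>k. if k = n then 1 else 0)"

lemma coord_unit_seq: "coord (unit_seq n) k = (if k = n then 1 else 0)"
  unfolding unit_seq_def by (rule coord_linf_of[where B = 1]) simp

lemma coord_sum_unit_seq: "finite I \<Longrightarrow> coord (\<Sum>i\<in>I. a i *\<^sub>R unit_seq i) k = (if k \<in> I then a k else 0)"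
proof -
  assume "finite I"
  have "coord (\<Sum>i\<in>I. a i *\<^sub>R unit_seq i) k = (\<Sum>i\<in>I. if k = i then a i else 0)"
    unfolding coord_sum coord_unit_seq by (intro sum.cong) auto
  then show ?thesis using \<open>finite I\<close> by simp
qed

lemma dominates_unit_seq:
  assumes K: "0 \<le> K" and y: "\<And>a n j. j < n \<Longrightarrow> \<bar>a j\<bar> \<le> K * norm (\<Sum>i<n. a i *\<^sub>R y i)"
  shows "dominates K y unit_seq"
  unfolding dominates_def using y K by (intro allI linf_norm_le) (simp add: coord_sum_unit_seq)

lemma c0_norm_le_norm_unit_seq:
  "finite I \<Longrightarrow> c0_norm I a \<le> norm (\<Sum>i\<in>I. a i *\<^sub>R unit_seq i)"
proof -
  assume fin: "finite I"
  have "\<bar>a i\<bar> \<le> norm (\<Sum>i\<in>I. a i *\<^sub>R unit_seq i)" if "i \<in> I" for i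
    using abs_coord_le[of "\<Sum>i\<in>I. a i *\<^sub>R unit_seq i" i] fin that by (simp add: coord_sum_unit_seq)
  then show ?thesis using fin by (simp add: c0_norm_le_iff)
qed

section \<open>Galvin's lemma\<close>

definition initial_segment :: "nat set \<Rightarrow> nat set \<Rightarrow> bool" where
  "initial_segment G L \<longleftrightarrow> finite G \<and> G \<subseteq> L \<and> (\<forall>x\<in>G. \<forall>y\<in>L - G. x < y)"

text \<open>Acceptance in the sense of combinatorial forcing; \<open>avoids\<close> is the
  corresponding rejection. Both pass to subsets of \<open>M\<close>, so decisions made earlier
  survive further thinning.\<close>

definition captures :: "nat set set \<Rightarrow> nat set \<Rightarrow> nat set \<Rightarrow> bool" where
  "captures \<B> s M \<longleftrightarrow>
     (\<forall>L. L \<subseteq> M \<and> infinite L \<and> (\<forall>x\<in>s. \<forall>y\<in>L. x < y) \<longrightarrow> (\<exists>G\<in>\<B>. initial_segment G (s \<union> L)))"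

definition avoids :: "nat set set \<Rightarrow> nat set \<Rightarrow> nat set \<Rightarrow> bool" where
  "avoids \<B> s M \<longleftrightarrow> (\<forall>M'. M' \<subseteq> M \<and> infinite M' \<longrightarrow> \<not> captures \<B> s M')"

lemma captures_mono: "captures \<B> s M \<Longrightarrow> M' \<subseteq> M \<Longrightarrow> captures \<B> s M'"
  unfolding captures_def by blast

lemma avoids_mono: "avoids \<B> s M \<Longrightarrow> M' \<subseteq> M \<Longrightarrow> avoids \<B> s M'"
  unfolding avoids_def by blast

lemma decide: "infinite M \<Longrightarrow> \<exists>M'\<subseteq>M. infinite M' \<and> (captures \<B> s M' \<or> avoids \<B> s M')"
  unfolding avoids_def by blast

lemma decide_finitely_many:
  assumes "finite S" "infinite M"
  shows "\<exists>M'\<subseteq>M. infinite M' \<and> (\<forall>s\<in>S. captures \<B> s M' \<or> avoids \<B> s M')"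
  using assms
proof (induction S arbitrary: M rule: finite_induct)
  case empty
  then show ?case by blast
next
  case (insert s S)
  obtain M1 where M1: "M1 \<subseteq> M" "infinite M1" "captures \<B> s M1 \<or> avoids \<B> s M1"
    using decide[OF insert.prems] by blast
  then obtain M2 where "M2 \<subseteq> M1" "infinite M2" "\<forall>s\<in>S. captures \<B> s M2 \<or> avoids \<B> s M2"
    using insert.IH[of M1] by blast
  then show ?case using M1 captures_mono avoids_mono by (intro exI[of _ M2]) blast
qed

text \<open>If infinitely many such \<open>n\<close> existed, together they would capture
  \<open>s\<close>: any infinite set \<open>L\<close> of them starts with one of them, and the rest
  of \<open>L\<close> lies beyond it.\<close>

lemma avoids_insert:
  assumes av: "avoids \<B> s M" and M: "infinite M" and dec: "\<And>n. n \<in> M \<Longrightarrow> P n \<Longrightarrow> captures \<B> (insert n s) {x\<in>M. n < x}"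
    and sM: "\<And>x y. x \<in> s \<Longrightarrow> y \<in> M \<Longrightarrow> x < y"
  shows "finite {n\<in>M. P n}"
proof (rule ccontr)
  assume inf: "infinite {n\<in>M. P n}"
  have "captures \<B> s {n\<in>M. P n}"
    unfolding captures_def
  proof (intro allI impI, elim conjE)
    fix L assume L: "L \<subseteq> {n\<in>M. P n}" "infinite L"
    define n where "n = (LEAST n. n \<in> L)"
    have n: "n \<in> L" "\<And>y. y \<in> L \<Longrightarrow> n \<le> y"
      using L(2) unfolding n_def by (metis LeastI finite.emptyI ex_in_conv, metis Least_le)
    have "captures \<B> (insert n s) {x\<in>M. n < x}" using n L by (intro dec) auto
    moreover have "L - {n} \<subseteq> {x\<in>M. n < x}" using L n(2) le_neq_implies_less by fastforce
    moreover have "infinite (L - {n})" using L(2) by simp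
    moreover have "\<forall>x\<in>insert n s. \<forall>y\<in>L - {n}. x < y"
      using sM L n(2) le_neq_implies_less by fastforce
    ultimately obtain G where "G \<in> \<B>" "initial_segment G (insert n s \<union> (L - {n}))"
      unfolding captures_def by blast
    moreover have "insert n s \<union> (L - {n}) = s \<union> L" using n(1) by auto
    ultimately show "\<exists>G\<in>\<B>. initial_segment G (s \<union> L)" by auto
  qed
  moreover have "{n\<in>M. P n} \<subseteq> M" by auto
  ultimately show False using av inf unfolding avoids_def by metis
qed

text \<open>One fusion step. \<open>M\<close> is first thinned to a sequence such that each point
  \<open>p\<close>, added to any \<open>s \<subseteq> P\<close>, is decided by the later points. For
  each of the finitely many \<open>s\<close> only finitely many points are captured, so some point
  is avoided with all of them.\<close>

lemma avoids_step:
  assumes P: "finite P" and M: "infinite M" and PM: "\<And>x y. x \<in> P \<Longrightarrow> y \<in> M \<Longrightarrow> x < y"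
    and av: "\<And>s. s \<subseteq> P \<Longrightarrow> avoids \<B> s M"
  shows "\<exists>p\<in>M. \<exists>M'\<subseteq>M. infinite M' \<and> (\<forall>y\<in>M'. p < y) \<and> (\<forall>s\<subseteq>insert p P. avoids \<B> s M')"
proof -
  define Q where "Q p N \<longleftrightarrow> p \<in> M \<and> N \<subseteq> M \<and> infinite N \<and> (\<forall>y\<in>N. p < y) \<and>
      (\<forall>s\<subseteq>P. captures \<B> (insert p s) N \<or> avoids \<B> (insert p s) N)" for p N
  have ext: "\<exists>p N'. Q p N' \<and> p \<in> N \<and> N' \<subseteq> N" if N: "N \<subseteq> M" "infinite N" for N
  proof -
    obtain p where p: "p \<in> N" using N(2) by (metis finite.emptyI ex_in_conv)
    have inf: "infinite {x\<in>N. p < x}"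
    proof -
      have "N = {x\<in>N. p < x} \<union> {x\<in>N. x \<le> p}" by auto
      moreover have "finite {x\<in>N. x \<le> p}" by (rule finite_subset[of _ "{..p}"]) auto
      ultimately show ?thesis using N(2) by (metis finite_Un)
    qed
    have fin: "finite (insert p ` Pow P)" using P by simp
    from decide_finitely_many[OF fin inf, of \<B>] obtain N' where N': "N' \<subseteq> {x\<in>N. p < x}" "infinite N'"
        "\<forall>s\<in>insert p ` Pow P. captures \<B> s N' \<or> avoids \<B> s N'"
      by metis
    have "Q p N'"
      unfolding Q_def
    proof (intro conjI allI impI)
      show "p \<in> M" "N' \<subseteq> M" "infinite N'" "\<forall>y\<in>N'. p < y" using p N(1) N'(1,2) by auto
      show "captures \<B> (insert p s) N' \<or> avoids \<B> (insert p s) N'" if "s \<subseteq> P" for s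
        using N'(3) that by simp
    qed
    then show ?thesis using p N'(1) by (intro exI[of _ p] exI[of _ N']) auto
  qed
  have "\<exists>f. \<forall>k. (case f k of (p, N) \<Rightarrow> Q p N) \<and> (fst (f (Suc k)) \<in> snd (f k) \<and> snd (f (Suc k)) \<subseteq> snd (f k))"
  proof (rule dependent_nat_choice)
    show "\<exists>a. case a of (p, N) \<Rightarrow> Q p N" using ext[OF subset_refl M] by auto
    fix a :: "nat \<times> nat set" and k :: nat
    assume "case a of (p, N) \<Rightarrow> Q p N"
    then have "snd a \<subseteq> M" "infinite (snd a)" by (auto simp: Q_def split_beta)
    then show "\<exists>b. (case b of (p, N) \<Rightarrow> Q p N) \<and> (fst b \<in> snd a \<and> snd b \<subseteq> snd a)"
      using ext[of "snd a"] by auto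
  qed
  then obtain f where Qf: "\<And>k. Q (fst (f k)) (snd (f k))"
    and f67: "\<And>k. fst (f (Suc k)) \<in> snd (f k) \<and> snd (f (Suc k)) \<subseteq> snd (f k)"
    by (auto simp: split_beta)
  have f: "fst (f k) \<in> M" "snd (f k) \<subseteq> M" "infinite (snd (f k))"
      "y \<in> snd (f k) \<Longrightarrow> fst (f k) < y"
      "s \<subseteq> P \<Longrightarrow> captures \<B> (insert (fst (f k)) s) (snd (f k)) \<or> avoids \<B> (insert (fst (f k)) s) (snd (f k))"
      "fst (f (Suc k)) \<in> snd (f k)" "snd (f (Suc k)) \<subseteq> snd (f k)" for k y s
    using Qf[of k] f67[of k] unfolding Q_def by simp_all
  have anti: "snd (f j) \<subseteq> snd (f i)" if "i \<le> j" for i j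
    using that by (induction rule: dec_induct) (use f(7) in auto)
  have later: "fst (f j) \<in> snd (f i)" if "i < j" for i j
    using f(6)[of "j - 1"] anti[of i "j - 1"] that by (cases j) auto
  have less: "fst (f i) < fst (f j)" if "i < j" for i j using f(4) later[OF that] by blast
  define p where "p k = fst (f k)" for k
  have mono: "strict_mono p" unfolding p_def by (auto intro!: strict_monoI less)
  define N where "N = range p"
  have N: "N \<subseteq> M" "infinite N"
    unfolding N_def using f(1) range_inj_infinite[OF strict_mono_imp_inj_on[OF mono]] by (auto simp: p_def)
  have tail: "{x\<in>N. p k < x} \<subseteq> snd (f k)" for k
  proof
    fix x assume "x \<in> {x\<in>N. p k < x}"
    then obtain j where "x = p j" "p k < p j" by (auto simp: N_def)
    then have "k < j" using strict_mono_less[OF mono, of k j] by simp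
    then show "x \<in> snd (f k)" using later \<open>x = p j\<close> by (simp add: p_def)
  qed
  have fin: "finite {n\<in>N. captures \<B> (insert n s) {x\<in>N. n < x}}" if s: "s \<subseteq> P" for s
  proof (rule avoids_insert[where \<B> = \<B> and s = s])
    show "avoids \<B> s N" using av[OF s] N(1) by (rule avoids_mono)
    show "x < y" if "x \<in> s" "y \<in> N" for x y using PM that s N(1) by blast
  qed (use N in auto)
  have "finite (\<Union>s\<in>Pow P. {n\<in>N. captures \<B> (insert n s) {x\<in>N. n < x}})" using P fin by auto
  then obtain q where "q \<in> N" and q: "q \<notin> (\<Union>s\<in>Pow P. {n\<in>N. captures \<B> (insert n s) {x\<in>N. n < x}})"
    using N(2) by (meson finite_subset subsetI)
  then obtain k where k: "q = p k" by (auto simp: N_def)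
  define M' where "M' = {x\<in>N. q < x}"
  have M'k: "M' \<subseteq> snd (f k)" using tail[of k] by (simp add: M'_def k)
  have "infinite M'"
  proof -
    have "p ` {k<..} \<subseteq> M'" using strict_monoD[OF mono] by (auto simp: M'_def N_def k)
    moreover have "infinite (p ` {k<..})"
      using finite_imageD[OF _ inj_on_subset[OF strict_mono_imp_inj_on[OF mono] subset_UNIV]] infinite_Ioi by blast
    ultimately show ?thesis using finite_subset by blast
  qed
  have "avoids \<B> s M'" if s: "s \<subseteq> insert q P" for s
  proof (cases "q \<in> s")
    case True
    define t where "t = s - {q}"
    have t: "t \<subseteq> P" "s = insert q t" using s True by (auto simp: t_def)
    have "\<not> captures \<B> s M'" using q t \<open>q \<in> N\<close> by (auto simp: M'_def)
    then have "avoids \<B> s (snd (f k))"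
      using f(5)[OF t(1), of k] captures_mono[OF _ M'k] t(2) k by (auto simp: p_def)
    then show ?thesis using M'k by (rule avoids_mono)
  next
    case False
    then show ?thesis using s av[of s] N by (intro avoids_mono[of \<B> s M M']) (auto simp: M'_def)
  qed
  moreover have "M' \<subseteq> M" "\<forall>y\<in>M'. q < y" "q \<in> M" using N \<open>q \<in> N\<close> by (auto simp: M'_def)
  ultimately show ?thesis using \<open>infinite M'\<close> by blast
qed

text \<open>If \<open>{}\<close> is captured, the second alternative holds. If it is avoided, fusion
  builds an infinite set all of whose finite subsets are avoided, which rules out members of
  \<open>\<B>\<close> among them.\<close>

theorem galvin:
  assumes \<B>: "\<And>G. G \<in> \<B> \<Longrightarrow> finite G" and M: "infinite M"
  shows "\<exists>M'\<subseteq>M. infinite M' \<and>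
    ((\<forall>G\<in>\<B>. \<not> G \<subseteq> M') \<or> (\<forall>L\<subseteq>M'. infinite L \<longrightarrow> (\<exists>G\<in>\<B>. initial_segment G L)))"
proof -
  obtain M0 where M0: "M0 \<subseteq> M" "infinite M0" "captures \<B> {} M0 \<or> avoids \<B> {} M0"
    using decide[OF M] by blast
  show ?thesis
  proof (cases "captures \<B> {} M0")
    case True
    then show ?thesis using M0 unfolding captures_def by (intro exI[of _ M0]) auto
  next
    case False
    then have av: "avoids \<B> {} M0" using M0 by blast
    define Q where "Q P N \<longleftrightarrow> finite P \<and> infinite N \<and> P \<subseteq> M0 \<and> N \<subseteq> M0 \<and> (\<forall>x\<in>P. \<forall>y\<in>N. x < y) \<and>
      (\<forall>s\<subseteq>P. avoids \<B> s N)" for P N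
    have "\<exists>f. \<forall>k. (case f k of (P, N) \<Rightarrow> Q P N) \<and> (\<exists>p\<in>snd (f k). fst (f (Suc k)) = insert p (fst (f k)))"
    proof (rule dependent_nat_choice)
      show "\<exists>a. case a of (P, N) \<Rightarrow> Q P N" using M0 av by (intro exI[of _ "({}, M0)"]) (simp add: Q_def)
      fix a :: "nat set \<times> nat set" and k :: nat
      assume "case a of (P, N) \<Rightarrow> Q P N"
      then obtain P N where a: "a = (P, N)" "Q P N" by (cases a) auto
      then have PN: "finite P" "infinite N" "P \<subseteq> M0" "N \<subseteq> M0" "\<And>x y. x \<in> P \<Longrightarrow> y \<in> N \<Longrightarrow> x < y"
          "\<And>s. s \<subseteq> P \<Longrightarrow> avoids \<B> s N" unfolding Q_def by blast+
      from avoids_step[OF PN(1,2,5,6)] obtain p N' where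
        N': "p \<in> N" "N' \<subseteq> N" "infinite N'" "\<forall>y\<in>N'. p < y" "\<forall>s\<subseteq>insert p P. avoids \<B> s N'" by blast
      have "Q (insert p P) N'" unfolding Q_def using PN(1-5) N' by blast
      then show "\<exists>b. (case b of (P, N) \<Rightarrow> Q P N) \<and> (\<exists>p\<in>snd a. fst b = insert p (fst a))"
        using N'(1) a by (intro exI[of _ "(insert p P, N')"]) auto
    qed
    then obtain f where f: "\<And>k. Q (fst (f k)) (snd (f k))"
      and step: "\<And>k. \<exists>p\<in>snd (f k). fst (f (Suc k)) = insert p (fst (f k))"
      by (auto simp: split_beta)
    define P where "P k = fst (f k)" for k
    define N where "N k = snd (f k)" for k
    have Q: "finite (P k)" "infinite (N k)" "P k \<subseteq> M0" "N k \<subseteq> M0" "\<forall>x\<in>P k. \<forall>y\<in>N k. x < y"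
        "\<forall>s\<subseteq>P k. avoids \<B> s (N k)" for k
      using f[of k] by (simp_all add: P_def N_def Q_def)
    have mono: "P i \<subseteq> P j" if "i \<le> j" for i j
      using that
    proof (induction rule: dec_induct)
      case (step n)
      then show ?case using \<open>\<And>k. \<exists>p\<in>snd (f k). fst (f (Suc k)) = insert p (fst (f k))\<close>[of n] by (auto simp: P_def)
    qed simp
    have card: "k \<le> card (P k)" for k
    proof (induction k)
      case (Suc k)
      obtain p where "p \<in> N k" "P (Suc k) = insert p (P k)" using step[of k] by (auto simp: P_def N_def)
      moreover have "p \<notin> P k" using Q(5)[of k] \<open>p \<in> N k\<close> by auto
      ultimately show ?case using Suc Q(1)[of k] by simp
    qed simp
    define M' where "M' = (\<Union>k. P k)"
    have "infinite M'"
    proof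
      assume "finite M'"
      then have "card (P (Suc (card M'))) \<le> card M'" by (intro card_mono) (auto simp: M'_def)
      then show False using card[of "Suc (card M')"] by simp
    qed
    moreover have "\<not> G \<subseteq> M'" if G: "G \<in> \<B>" for G
    proof
      assume GM: "G \<subseteq> M'"
      have "\<exists>k. G \<subseteq> P k"
        using \<B>[OF G] GM
      proof (induction G rule: finite_induct)
        case (insert x G)
        then obtain i j where "G \<subseteq> P i" "x \<in> P j" by (auto simp: M'_def)
        then show ?case using mono[of i "max i j"] mono[of j "max i j"] by (intro exI[of _ "max i j"]) auto
      qed simp
      then obtain k where k: "G \<subseteq> P k" by blast
      \<comment> \<open>A member of \<open>\<B>\<close> captures itself: it is an initial segment of
        its union with any set beyond it.\<close>
      have "captures \<B> G (N k)"
        unfolding captures_def initial_segment_def using G \<B>[OF G] by (auto intro!: bexI[of _ G])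
      then show False using Q(2,6)[of k] k unfolding avoids_def by blast
    qed
    moreover have "M' \<subseteq> M" using Q(3) M0(1) by (auto simp: M'_def)
    ultimately show ?thesis by blast
  qed
qed

section \<open>Suppression of positive functionals\<close>

lemma continuous_on_abs_eval: "continuous_on UNIV (\<lambda>f :: 'a \<Rightarrow> real. \<bar>f v\<bar>)"
  by (intro continuous_on_rabs continuous_on_product_coordinates)

lemma infinite_nat_enum:
  assumes "infinite (M :: nat set)"
  obtains q :: "nat \<Rightarrow> nat" where "strict_mono q" "range q = M"
  using strict_mono_enumerate[OF assms] range_enumerate[OF assms] by (rule that)

lemma initial_segment_comparable:
  assumes "initial_segment G L" "initial_segment H L"
  shows "G \<subseteq> H \<or> H \<subseteq> G"
proof (rule ccontr)
  assume "\<not> ?thesis"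
  then obtain x z where "x \<in> G - H" "z \<in> H - G" by auto
  then have "z < x" "x < z" using assms by (auto simp: initial_segment_def)
  then show False by simp
qed

lemma finite_chain_has_max:
  assumes "finite \<A>" "\<A> \<noteq> {}" "\<And>A B. A \<in> \<A> \<Longrightarrow> B \<in> \<A> \<Longrightarrow> A \<subseteq> B \<or> B \<subseteq> A"
  shows "\<exists>A\<in>\<A>. \<forall>B\<in>\<A>. B \<subseteq> A"
  using assms
proof (induction \<A> rule: finite_ne_induct)
  case (insert X \<A>)
  then obtain A where A: "A \<in> \<A>" "\<forall>B\<in>\<A>. B \<subseteq> A" by (meson insertCI)
  show ?case
  proof (cases "X \<subseteq> A")
    case True
    then show ?thesis using A by blast
  next
    case False
    then have "A \<subseteq> X" using insert.prems[of A X] A(1) by blast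
    then show ?thesis using A by blast
  qed
qed simp

context
  fixes y :: "nat \<Rightarrow> 'b::real_normed_vector" and \<epsilon> :: real and \<delta> :: "nat \<Rightarrow> real"
begin

definition large_on :: "nat set \<Rightarrow> bool" where
  "large_on G \<longleftrightarrow> (\<exists>f\<in>dual_ball. \<forall>i\<in>G. \<epsilon> \<le> f (y i))"

text \<open>The bound \<open>\<delta> i\<close> belongs to the position \<open>i\<close> in
  \<open>l\<close> rather than to the point \<open>l ! i\<close>, because the chosen points are
  finally renumbered by position.\<close>

definition suppressed_on :: "nat list \<Rightarrow> nat set \<Rightarrow> bool" where
  "suppressed_on l G \<longleftrightarrow> (\<exists>f\<in>dual_ball. (\<forall>i\<in>G. \<epsilon> \<le> f (y i)) \<and>
     (\<forall>i<length l. l ! i \<notin> G \<longrightarrow> \<bar>f (y (l ! i))\<bar> \<le> \<delta> i))"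

text \<open>\<open>q\<close> is a candidate for the next point and \<open>H\<close> a set beyond
  \<open>q\<close> that rules it out. The pair is coded as \<open>insert q H\<close>, from which
  \<open>q\<close> is recovered as the least element, so that Galvin's lemma applies.\<close>

definition bad_extensions :: "nat list \<Rightarrow> nat set \<Rightarrow> nat set set" where
  "bad_extensions l E = {insert q H |q H. finite H \<and> (\<forall>h\<in>H. q < h) \<and>
     suppressed_on l (E \<union> H) \<and> \<not> suppressed_on (l @ [q]) (E \<union> H)}"

text \<open>If Galvin's lemma produced sets all of whose infinite subsets start with a bad extension,
  then for every \<open>N\<close> a single functional would be large at the first \<open>N\<close> points: it is taken for
  the longest of the \<open>N\<close> nested initial segments. The nesting helps only because lower bounds
  \<open>\<epsilon> \<le> f (y i)\<close> without signs are required.\<close>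

lemma avoid_bad_extensions:
  assumes wn: "\<And>f. f \<in> dual_ball \<Longrightarrow> (\<lambda>n. f (y n)) \<longlonglongrightarrow> 0" and \<delta>: "\<And>i. 0 < \<delta> i"
    and M: "infinite M" and lM: "\<And>x z. x \<in> set l \<Longrightarrow> z \<in> M \<Longrightarrow> x < z"
    and E: "E \<subseteq> set l"
  shows "\<exists>M'\<subseteq>M. infinite M' \<and> (\<forall>G\<in>bad_extensions l E. \<not> G \<subseteq> M')"
proof -
  have fin: "finite G" if "G \<in> bad_extensions l E" for G
    using that by (auto simp: bad_extensions_def)
  obtain M' where M': "M' \<subseteq> M" "infinite M'"
    "(\<forall>G\<in>bad_extensions l E. \<not> G \<subseteq> M') \<or>
     (\<forall>L\<subseteq>M'. infinite L \<longrightarrow> (\<exists>G\<in>bad_extensions l E. initial_segment G L))"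
    using galvin[of "bad_extensions l E", OF fin M] by auto
  have "\<not> (\<forall>L\<subseteq>M'. infinite L \<longrightarrow> (\<exists>G\<in>bad_extensions l E. initial_segment G L))"
  proof
    assume all: "\<forall>L\<subseteq>M'. infinite L \<longrightarrow> (\<exists>G\<in>bad_extensions l E. initial_segment G L)"
    obtain q :: "nat \<Rightarrow> nat" where q: "strict_mono q" "range q = M'"
      using infinite_nat_enum[OF M'(2)] by metis
    have ex: "\<exists>f\<in>dual_ball. \<forall>i\<le>N. \<delta> (length l) \<le> \<bar>f (y (q i))\<bar>" for N
    proof -
      define T where "T = q ` {N<..}"
      have T: "infinite T" "T \<subseteq> M'"
        unfolding T_def using finite_imageD[OF _ inj_on_subset[OF strict_mono_imp_inj_on[OF q(1)] subset_UNIV]]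
          infinite_Ioi q(2) by blast+
      have qT: "q i < t" if "i \<le> N" "t \<in> T" for i t
        using that strict_monoD[OF q(1)] by (auto simp: T_def)
      have "\<exists>H. initial_segment H T \<and> suppressed_on l (E \<union> H) \<and> \<not> suppressed_on (l @ [q i]) (E \<union> H)"
        if i: "i \<le> N" for i
      proof -
        have "infinite (insert (q i) T)" "insert (q i) T \<subseteq> M'" using T q(2) by auto
        then obtain G where G: "G \<in> bad_extensions l E" "initial_segment G (insert (q i) T)"
          using all[rule_format, of "insert (q i) T"] by metis
        then obtain p H where pH: "G = insert p H" "finite H" "\<forall>h\<in>H. p < h"
          "suppressed_on l (E \<union> H)" "\<not> suppressed_on (l @ [p]) (E \<union> H)"
          by (auto simp: bad_extensions_def)
        \<comment> \<open>\<open>q i\<close> lies below all of \<open>T\<close>, so it is the first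
          point of the initial segment \<open>G\<close> and hence the candidate
          \<open>p\<close>.\<close>
        have "q i \<in> G"
        proof (rule ccontr)
          assume "q i \<notin> G"
          then have "p < q i" "p \<in> T" using G(2) pH(1) by (auto simp: initial_segment_def)
          then show False using qT[OF i, of p] by simp
        qed
        have "p = q i"
        proof (rule ccontr)
          assume "p \<noteq> q i"
          then have "p < q i" "p \<in> T" using \<open>q i \<in> G\<close> pH(1,3) G(2) by (auto simp: initial_segment_def)
          then show False using qT[OF i, of p] by simp
        qed
        have "q i \<notin> T" using qT[OF i] by blast
        then have "initial_segment H T"
          using G(2) pH(1-3) \<open>p = q i\<close> by (auto simp: initial_segment_def)
        then show ?thesis using pH(4,5) \<open>p = q i\<close> by (intro exI[of _ H]) simp
      qed
      then obtain H where H: "\<And>i. i \<le> N \<Longrightarrow> initial_segment (H i) T"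
          "\<And>i. i \<le> N \<Longrightarrow> suppressed_on l (E \<union> H i)" "\<And>i. i \<le> N \<Longrightarrow> \<not> suppressed_on (l @ [q i]) (E \<union> H i)"
        by metis
      have "\<exists>A\<in>H ` {..N}. \<forall>B\<in>H ` {..N}. B \<subseteq> A"
      proof (rule finite_chain_has_max)
        fix A B assume "A \<in> H ` {..N}" "B \<in> H ` {..N}"
        then show "A \<subseteq> B \<or> B \<subseteq> A" using H(1) initial_segment_comparable[of A T B] by blast
      qed auto
      then obtain j where j: "j \<le> N" "\<And>i. i \<le> N \<Longrightarrow> H i \<subseteq> H j" by auto
      obtain f where f: "f \<in> dual_ball" "\<forall>i\<in>E \<union> H j. \<epsilon> \<le> f (y i)"
          "\<forall>i<length l. l ! i \<notin> E \<union> H j \<longrightarrow> \<bar>f (y (l ! i))\<bar> \<le> \<delta> i"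
        using H(2)[OF j(1)] by (auto simp: suppressed_on_def)
      have "\<delta> (length l) \<le> \<bar>f (y (q i))\<bar>" if i: "i \<le> N" for i
      proof (rule ccontr)
        assume "\<not> \<delta> (length l) \<le> \<bar>f (y (q i))\<bar>"
        then have small: "\<bar>f (y (q i))\<bar> \<le> \<delta> (length l)" by simp
        \<comment> \<open>The points of \<open>l\<close> lie below \<open>M\<close>, so replacing
          \<open>H i\<close> by the larger \<open>H j\<close> does not change which of them have to
          be suppressed.\<close>
        have "l ! k \<notin> H j" if "k < length l" for k
          using lM[of "l ! k" "l ! k"] that H(1)[OF j(1)] T(2) M'(1) by (auto simp: initial_segment_def)
        then have "\<forall>k<length (l @ [q i]). (l @ [q i]) ! k \<notin> E \<union> H i \<longrightarrow> \<bar>f (y ((l @ [q i]) ! k))\<bar> \<le> \<delta> k"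
          using f(3) small by (auto simp: nth_append less_Suc_eq)
        moreover have "\<forall>k\<in>E \<union> H i. \<epsilon> \<le> f (y k)" using f(2) j(2)[OF i] by auto
        ultimately have "suppressed_on (l @ [q i]) (E \<union> H i)" unfolding suppressed_on_def using f(1) by blast
        then show False using H(3)[OF i] by simp
      qed
      then show ?thesis using f(1) by blast
    qed
    obtain f where f: "f \<in> dual_ball" "\<And>i. \<delta> (length l) \<le> \<bar>f (y (q i))\<bar>"
      using dual_ball_limit[of "\<lambda>f i. \<bar>f (y (q i))\<bar>", OF continuous_on_abs_eval ex] by blast
    have "(\<lambda>i. f (y (q i))) \<longlonglongrightarrow> 0"
      using LIMSEQ_subseq_LIMSEQ[OF wn[OF f(1)] q(1)] by (simp add: o_def)
    then have "\<forall>\<^sub>F i in sequentially. \<bar>f (y (q i))\<bar> < \<delta> (length l)"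
      using tendstoD[OF _ \<delta>[of "length l"]] by (fastforce simp: dist_real_def)
    then show False using f(2) by (auto simp: eventually_sequentially not_less[symmetric])
  qed
  then show ?thesis using M' by blast
qed

text \<open>Bad extensions are avoided for each of the finitely many possible traces
  \<open>E\<close> of \<open>G\<close> on the chosen points; afterwards any point of the thinned set
  can be the next one.\<close>

lemma suppression_step:
  assumes wn: "\<And>f. f \<in> dual_ball \<Longrightarrow> (\<lambda>n. f (y n)) \<longlonglongrightarrow> 0" and \<delta>: "\<And>i. 0 < \<delta> i"
    and M: "infinite M" and lM: "\<And>x z. x \<in> set l \<Longrightarrow> z \<in> M \<Longrightarrow> x < z"
    and Q: "\<And>G. finite G \<Longrightarrow> G \<subseteq> set l \<union> M \<Longrightarrow> large_on G \<Longrightarrow> suppressed_on l G"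
  shows "\<exists>q\<in>M. \<exists>M'\<subseteq>M. infinite M' \<and> (\<forall>z\<in>M'. q < z) \<and>
    (\<forall>G. finite G \<and> G \<subseteq> insert q (set l) \<union> M' \<and> large_on G \<longrightarrow> suppressed_on (l @ [q]) G)"
proof -
  have "\<exists>N\<subseteq>M. infinite N \<and> (\<forall>E\<in>\<E>. \<forall>G\<in>bad_extensions l E. \<not> G \<subseteq> N)"
    if "finite \<E>" "\<E> \<subseteq> Pow (set l)" for \<E>
    using that
  proof (induction \<E> rule: finite_induct)
    case empty
    then show ?case using M by blast
  next
    case (insert E \<E>)
    then obtain N where N: "N \<subseteq> M" "infinite N" "\<forall>E\<in>\<E>. \<forall>G\<in>bad_extensions l E. \<not> G \<subseteq> N" by auto
    have "\<And>x z. x \<in> set l \<Longrightarrow> z \<in> N \<Longrightarrow> x < z" using lM N(1) by blast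
    moreover have "E \<subseteq> set l" using insert.prems by simp
    ultimately obtain N' where "N' \<subseteq> N" "infinite N'" "\<forall>G\<in>bad_extensions l E. \<not> G \<subseteq> N'"
      using avoid_bad_extensions[OF wn \<delta> N(2)] by metis
    then show ?case using N(1,3) by (intro exI[of _ N']) (auto, meson order_trans)
  qed
  from this[of "Pow (set l)"] obtain N where N: "N \<subseteq> M" "infinite N"
      "\<And>E G. E \<subseteq> set l \<Longrightarrow> G \<in> bad_extensions l E \<Longrightarrow> \<not> G \<subseteq> N"
    by auto
  obtain q where q: "q \<in> N" using N(2) by (metis finite.emptyI ex_in_conv)
  define M' where "M' = {z\<in>N. q < z}"
  have "infinite M'"
  proof -
    have "N \<subseteq> M' \<union> {..q}" by (auto simp: M'_def)
    then show ?thesis using N(2) by (metis finite_Un finite_atMost finite_subset)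
  qed
  moreover have "suppressed_on (l @ [q]) G"
    if G: "finite G" "G \<subseteq> insert q (set l) \<union> M'" "large_on G" for G
  proof -
    have "G \<subseteq> set l \<union> M" using G(2) q N(1) by (auto simp: M'_def)
    then have sup: "suppressed_on l G" using Q G by blast
    show ?thesis
    proof (cases "q \<in> G")
      case True
      then show ?thesis using sup by (auto simp: suppressed_on_def nth_append less_Suc_eq)
    next
      case False
      define E H where "E = G \<inter> set l" and "H = G \<inter> M'"
      have GEH: "G = E \<union> H" using False G(2) by (auto simp: E_def H_def)
      show ?thesis
      proof (rule ccontr)
        assume no: "\<not> suppressed_on (l @ [q]) G"
        have "finite H" "\<forall>h\<in>H. q < h" using G(1) by (auto simp: H_def M'_def)
        then have "insert q H \<in> bad_extensions l E"
          unfolding bad_extensions_def using sup no GEH by blast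
        moreover have "insert q H \<subseteq> N" using q by (auto simp: H_def M'_def)
        ultimately show False using N(3)[of E "insert q H"] by (auto simp: E_def)
      qed
    qed
  qed
  moreover have "q \<in> M" "M' \<subseteq> M" "\<forall>z\<in>M'. q < z" using q N(1) by (auto simp: M'_def)
  ultimately show ?thesis by (intro bexI[of _ q] exI[of _ M']) auto
qed

text \<open>Iteration of \<open>suppression_step\<close>, started by the empty list, for which
  \<open>suppressed_on\<close> amounts to \<open>large_on\<close>. For given \<open>I\<close> and
  \<open>n\<close> the functional is taken at one stage that is late enough for \<open>I\<close> and
  for all indices below \<open>n\<close>.\<close>

lemma positive_suppression:
  assumes wn: "\<And>f. f \<in> dual_ball \<Longrightarrow> (\<lambda>n. f (y n)) \<longlonglongrightarrow> 0" and \<delta>: "\<And>i. 0 < \<delta> i"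
  shows "\<exists>p. strict_mono p \<and> (\<forall>I n. finite I \<and> (\<exists>f\<in>dual_ball. \<forall>i\<in>I. \<epsilon> \<le> f (y (p i))) \<longrightarrow>
    (\<exists>f\<in>dual_ball. (\<forall>i\<in>I. \<epsilon> \<le> f (y (p i))) \<and> (\<forall>i<n. i \<notin> I \<longrightarrow> \<bar>f (y (p i))\<bar> \<le> \<delta> i)))"
proof -
  define Q where "Q l M \<longleftrightarrow> infinite M \<and> (\<forall>x\<in>set l. \<forall>z\<in>M. x < z) \<and>
    (\<forall>G. finite G \<and> G \<subseteq> set l \<union> M \<and> large_on G \<longrightarrow> suppressed_on l G)" for l M
  have "\<exists>f. \<forall>k. (case f k of (l, M) \<Rightarrow> length l = k \<and> Q l M) \<and>
     (\<exists>q\<in>snd (f k). fst (f (Suc k)) = fst (f k) @ [q] \<and> snd (f (Suc k)) \<subseteq> snd (f k))"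
  proof (rule dependent_nat_choice)
    show "\<exists>a. case a of (l, M) \<Rightarrow> length l = 0 \<and> Q l M"
      by (intro exI[of _ "([], UNIV)"]) (auto simp: Q_def suppressed_on_def large_on_def)
    fix a :: "nat list \<times> nat set" and k :: nat
    assume "case a of (l, M) \<Rightarrow> length l = k \<and> Q l M"
    then obtain l M where a: "a = (l, M)" "Q l M" "length l = k" by (cases a) auto
    then obtain q M' where qM: "q \<in> M" "M' \<subseteq> M" "infinite M'" "\<forall>z\<in>M'. q < z"
      "\<forall>G. finite G \<and> G \<subseteq> insert q (set l) \<union> M' \<and> large_on G \<longrightarrow> suppressed_on (l @ [q]) G"
      using suppression_step[OF wn \<delta>, of M l] unfolding Q_def by metis
    have "\<forall>x\<in>set (l @ [q]). \<forall>z\<in>M'. x < z" using a(2) qM(2,4) unfolding Q_def by auto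
    then have "Q (l @ [q]) M'" unfolding Q_def using qM(3,5) by simp
    then show "\<exists>b. (case b of (l, M) \<Rightarrow> length l = Suc k \<and> Q l M) \<and>
        (\<exists>q\<in>snd a. fst b = fst a @ [q] \<and> snd b \<subseteq> snd a)"
      using a(1,3) qM(1,2) by (intro exI[of _ "(l @ [q], M')"]) simp
  qed
  then obtain f where f: "\<And>k. Q (fst (f k)) (snd (f k))" and len: "\<And>k. length (fst (f k)) = k"
    and step: "\<And>k. \<exists>q\<in>snd (f k). fst (f (Suc k)) = fst (f k) @ [q] \<and> snd (f (Suc k)) \<subseteq> snd (f k)"
    by (auto simp: split_beta)
  obtain q where q: "\<And>k. q k \<in> snd (f k)" "\<And>k. fst (f (Suc k)) = fst (f k) @ [q k]"
    using step by metis
  have l: "fst (f k) = map q [0..<k]" for k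
    by (induction k) (use len[of 0] in \<open>auto simp: q(2)\<close>)
  have mono: "strict_mono q"
  proof (rule strict_monoI)
    fix i j :: nat assume "i < j"
    then have "q i \<in> set (fst (f j))" by (simp add: l)
    then show "q i < q j" using f[of j] q(1)[of j] by (simp add: Q_def)
  qed
  have "\<exists>h\<in>dual_ball. (\<forall>i\<in>I. \<epsilon> \<le> h (y (q i))) \<and> (\<forall>i<n. i \<notin> I \<longrightarrow> \<bar>h (y (q i))\<bar> \<le> \<delta> i)"
    if I: "finite I" "\<exists>h\<in>dual_ball. \<forall>i\<in>I. \<epsilon> \<le> h (y (q i))" for I n
  proof -
    obtain m where m: "\<forall>i\<in>I. i < m" using I(1) finite_nat_set_iff_bounded by auto
    define k where "k = max m n"
    have "q ` I \<subseteq> set (fst (f k)) \<union> snd (f k)" using m by (auto simp: l k_def)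
    moreover have "large_on (q ` I)" using I(2) by (simp add: large_on_def)
    ultimately have "suppressed_on (fst (f k)) (q ` I)" using f[of k] I(1) by (simp add: Q_def)
    then obtain h where h: "h \<in> dual_ball" "\<forall>i\<in>I. \<epsilon> \<le> h (y (q i))"
        "\<forall>i<k. q i \<notin> q ` I \<longrightarrow> \<bar>h (y (q i))\<bar> \<le> \<delta> i"
      by (auto simp: suppressed_on_def l)
    have "q i \<notin> q ` I" if "i \<notin> I" for i using that strict_mono_eq[OF mono] by auto
    then show ?thesis using h by (intro bexI[of _ h]) (auto simp: k_def)
  qed
  then show ?thesis using mono by (intro exI[of _ q]) auto
qed

end

section \<open>Rosenthal's dichotomy\<close>

definition alternates :: "(nat \<Rightarrow> 'b) \<Rightarrow> real \<Rightarrow> real \<Rightarrow> nat set \<Rightarrow> ('b \<Rightarrow> real) \<Rightarrow> bool" where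
  "alternates y r s G f \<longleftrightarrow> (\<forall>i\<in>G. if even (card {x\<in>G. x < i}) then f (y i) \<le> r else s \<le> f (y i))"

text \<open>Alternating functionals allow low and high values to be prescribed freely at every third
  point. \<open>f\<close> is high where \<open>a i\<close> is nonnegative, \<open>g\<close> where it
  is negative; their difference has norm at most 2, which gives the constant
  \<open>(s - r) / 2\<close>.\<close>

lemma l1_if_alternating:
  fixes y :: "nat \<Rightarrow> 'b::real_normed_vector"
  assumes m: "strict_mono (m :: nat \<Rightarrow> nat)" and rs: "r < s"
    and alt: "\<And>G. finite G \<Longrightarrow> G \<subseteq> range m \<Longrightarrow> \<exists>f\<in>dual_ball. alternates y r s G f"
  shows "(s - r) / 2 * (\<Sum>i<n. \<bar>a i\<bar>) \<le> norm (\<Sum>i<n. a i *\<^sub>R y (m (3 * i + 1)))"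
proof -
  have ex: "\<exists>f\<in>dual_ball. \<forall>i<n. if S i then s \<le> f (y (m (3 * i + 1))) else f (y (m (3 * i + 1))) \<le> r"
    for S :: "nat \<Rightarrow> bool"
  proof -
    \<comment> \<open>two of three consecutive points, chosen to give the middle one the required parity\<close>
    define B where "B i = (if S i then {3 * i, 3 * i + 1} else {3 * i + 1, 3 * i + 2})" for i
    define H where "H = (\<Union>i<n. B i)"
    have card: "card (\<Union>j<i. B j) = 2 * i" for i
    proof (induction i)
      case (Suc i)
      have "(\<Union>j<i. B j) \<inter> B i = {}" by (auto simp: B_def split: if_splits)
      moreover have "card (B i) = 2" "\<And>i. finite (B i)" by (auto simp: B_def)
      ultimately show ?case using Suc by (simp add: lessThan_Suc card_Un_disjoint Un_commute Int_commute)
    qed simp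
    \<comment> \<open>Every earlier pair contributes 2 points, so the parity is decided by
      \<open>3 * i\<close> alone.\<close>
    have "{x\<in>H. x < 3 * i + 1} = (\<Union>j<i. B j) \<union> (if S i then {3 * i} else {})" if "i < n" for i
    proof (rule set_eqI)
      fix x
      have eq: "x \<in> B j \<and> x < 3 * i + 1 \<longleftrightarrow> (x \<in> B j \<and> j < i) \<or> (j = i \<and> S i \<and> x = 3 * i)" for j
        by (cases "j = i") (auto simp: B_def)
      have "x \<in> {x\<in>H. x < 3 * i + 1} \<longleftrightarrow> (\<exists>j<n. x \<in> B j \<and> x < 3 * i + 1)" by (auto simp: H_def)
      also have "\<dots> \<longleftrightarrow> (\<exists>j<i. x \<in> B j) \<or> (S i \<and> x = 3 * i)"
        unfolding eq using that by (blast intro: less_trans)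
      finally show "x \<in> {x\<in>H. x < 3 * i + 1} \<longleftrightarrow> x \<in> (\<Union>j<i. B j) \<union> (if S i then {3 * i} else {})"
        by (simp add: Bex_def)
    qed
    moreover have "3 * i \<notin> (\<Union>j<i. B j)" "finite (\<Union>j<i. B j)" for i by (auto simp: B_def split: if_splits)
    ultimately have cardH: "card {x\<in>H. x < 3 * i + 1} = 2 * i + (if S i then 1 else 0)" if "i < n" for i
      using that card[of i] by simp
    have "finite H" by (auto simp: H_def B_def)
    then obtain f where f: "f \<in> dual_ball" "alternates y r s (m ` H) f"
      using alt[of "m ` H"] by blast
    have "if S i then s \<le> f (y (m (3 * i + 1))) else f (y (m (3 * i + 1))) \<le> r" if i: "i < n" for i
    proof -
      have "3 * i + 1 \<in> H" using i by (auto simp: H_def B_def)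
      moreover have "{x\<in>m ` H. x < m (3 * i + 1)} = m ` {x\<in>H. x < 3 * i + 1}"
        using strict_mono_less[OF m] by auto
      then have "card {x\<in>m ` H. x < m (3 * i + 1)} = 2 * i + (if S i then 1 else 0)"
        using cardH[OF i] card_image[OF strict_mono_imp_inj_on[OF m]]
        by (metis (no_types, lifting) card_image inj_on_subset m strict_mono_imp_inj_on top_greatest)
      ultimately show ?thesis
        using f(2)[unfolded alternates_def, rule_format, of "m (3 * i + 1)"] by (simp split: if_splits)
    qed
    then show ?thesis using f(1) by blast
  qed
  obtain f where f: "f \<in> dual_ball" "\<forall>i<n. if 0 \<le> a i then s \<le> f (y (m (3 * i + 1))) else f (y (m (3 * i + 1))) \<le> r"
    using ex[of "\<lambda>i. 0 \<le> a i"] by metis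
  obtain g where g: "g \<in> dual_ball" "\<forall>i<n. if \<not> 0 \<le> a i then s \<le> g (y (m (3 * i + 1))) else g (y (m (3 * i + 1))) \<le> r"
    using ex[of "\<lambda>i. \<not> 0 \<le> a i"] by metis
  let ?v = "\<Sum>i<n. a i *\<^sub>R y (m (3 * i + 1))"
  have "(s - r) * \<bar>a i\<bar> \<le> a i * (f (y (m (3 * i + 1))) - g (y (m (3 * i + 1))))" if "i < n" for i
  proof (cases "0 \<le> a i")
    case True
    then have "s - r \<le> f (y (m (3 * i + 1))) - g (y (m (3 * i + 1)))" using f(2) g(2) that by fastforce
    then show ?thesis using True by (simp add: mult_left_mono mult.commute)
  next
    case False
    then have "s - r \<le> - (f (y (m (3 * i + 1))) - g (y (m (3 * i + 1))))" using f(2) g(2) that by fastforce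
    then have "(- a i) * (s - r) \<le> (- a i) * (- (f (y (m (3 * i + 1))) - g (y (m (3 * i + 1)))))"
      using False by (intro mult_left_mono) auto
    moreover have "(s - r) * \<bar>a i\<bar> = (- a i) * (s - r)" using False by simp
    ultimately show ?thesis by (simp only: minus_mult_minus)
  qed
  then have "(s - r) * (\<Sum>i<n. \<bar>a i\<bar>) \<le> f ?v - g ?v"
    unfolding dual_ball_sum[OF f(1)] dual_ball_sum[OF g(1)] sum_distrib_left sum_subtractf[symmetric]
      right_diff_distrib[symmetric]
    by (intro sum_mono) auto
  also have "\<dots> \<le> 2 * norm ?v" using dual_ball_le[OF f(1), of ?v] dual_ball_le[OF g(1), of ?v] by linarith
  finally show ?thesis by (simp add: field_simps)
qed

text \<open>Low and high points are picked in turn, so the number of elements before a point is its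
  index, and every initial segment inherits the pattern.\<close>

lemma alternating_subset:
  assumes "\<exists>\<^sub>\<infinity>i. i \<in> M \<and> f (y i) \<le> r" "\<exists>\<^sub>\<infinity>i. i \<in> M \<and> s \<le> f (y i)"
  shows "\<exists>L\<subseteq>M. infinite L \<and> (\<forall>G. initial_segment G L \<longrightarrow> alternates y r s G f)"
proof -
  have "\<exists>g. \<forall>k. (g k \<in> M \<and> (if even k then f (y (g k)) \<le> r else s \<le> f (y (g k)))) \<and> g k < g (Suc k)"
  proof (rule dependent_nat_choice)
    show "\<exists>x. x \<in> M \<and> (if even 0 then f (y x) \<le> r else s \<le> f (y x))"
      using assms(1) by (auto simp: INFM_nat)
    show "\<exists>z. (z \<in> M \<and> (if even (Suc k) then f (y z) \<le> r else s \<le> f (y z))) \<and> x < z" for x k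
      using assms unfolding INFM_nat by (cases "even k") auto
  qed
  then obtain g where g: "\<And>k. g k \<in> M" "\<And>k. if even k then f (y (g k)) \<le> r else s \<le> f (y (g k))"
      "\<And>k. g k < g (Suc k)" by blast
  have mono: "strict_mono g" using g(3) by (simp add: strict_mono_Suc_iff)
  have "alternates y r s G f" if G: "initial_segment G (range g)" for G
    unfolding alternates_def
  proof
    fix i assume i: "i \<in> G"
    then obtain j where j: "i = g j" using G by (auto simp: initial_segment_def)
    have "{x\<in>G. x < i} = g ` {..<j}"
    proof (intro equalityI subsetI)
      fix x assume "x \<in> {x\<in>G. x < i}"
      then obtain k where "x = g k" "g k < g j" using G j by (auto simp: initial_segment_def)
      then show "x \<in> g ` {..<j}" using strict_mono_less[OF mono] by auto
    next
      fix x assume "x \<in> g ` {..<j}"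
      then obtain k where k: "x = g k" "k < j" by auto
      then have "g k < g j" using strict_monoD[OF mono] by blast
      then have "g k \<in> G" using G i j unfolding initial_segment_def by (metis DiffI order_less_asym rangeI)
      then show "x \<in> {x\<in>G. x < i}" using k \<open>g k < g j\<close> j by simp
    qed
    then have "card {x\<in>G. x < i} = j"
      using card_image[OF inj_on_subset[OF strict_mono_imp_inj_on[OF mono] subset_UNIV], of "{..<j}"] by simp
    then show "if even (card {x\<in>G. x < i}) then f (y i) \<le> r else s \<le> f (y i)" using g(2)[of j] j by simp
  qed
  moreover have "infinite (range g)" using range_inj_infinite[OF strict_mono_imp_inj_on[OF mono]] .
  ultimately show ?thesis using g(1) by (intro exI[of _ "range g"]) auto
qed

text \<open>Rational thresholds reduce convergence to countably many conditions, which one diagonal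
  subsequence can meet. A bounded divergent sequence has a limit point \<open>l\<close> and
  infinitely many terms at distance at least \<open>e\<close> from it on one side; two thresholds
  fit in between.\<close>

lemma convergent_if_no_oscillation:
  fixes u :: "nat \<Rightarrow> real"
  assumes "bounded (range u)"
    and osc: "\<And>r s :: rat. r < s \<Longrightarrow> \<not> ((\<exists>\<^sub>\<infinity>i. u i \<le> of_rat r) \<and> (\<exists>\<^sub>\<infinity>i. of_rat s \<le> u i))"
  shows "convergent u"
proof -
  obtain l p where p: "strict_mono p" "(u \<circ> p) \<longlonglongrightarrow> l"
    using bounded_imp_convergent_subsequence[OF assms(1)] by blast
  have near: "\<exists>\<^sub>\<infinity>i. \<bar>u i - l\<bar> < e" if "e > 0" for e
    unfolding INFM_nat
  proof
    fix n
    have "\<forall>\<^sub>F i in sequentially. \<bar>u (p i) - l\<bar> < e" using tendstoD[OF p(2) that] by (simp add: dist_real_def)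
    then obtain N where "\<forall>i\<ge>N. \<bar>u (p i) - l\<bar> < e" by (auto simp: eventually_sequentially)
    then have "\<bar>u (p (max N (Suc n))) - l\<bar> < e" by simp
    moreover have "n < p (max N (Suc n))" using seq_suble[OF p(1), of "max N (Suc n)"] by simp
    ultimately show "\<exists>i>n. \<bar>u i - l\<bar> < e" by blast
  qed
  have "u \<longlonglongrightarrow> l"
  proof (rule ccontr)
    assume "\<not> u \<longlonglongrightarrow> l"
    then obtain e where e: "e > 0" "\<exists>\<^sub>\<infinity>i. e \<le> \<bar>u i - l\<bar>"
      unfolding tendsto_iff dist_real_def INFM_nat eventually_sequentially by (meson Suc_le_eq not_le)
    have near2: "\<exists>\<^sub>\<infinity>i. \<bar>u i - l\<bar> < e / 2" by (rule near) (use e(1) in simp)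
    have "(\<exists>\<^sub>\<infinity>i. u i \<le> l - e) \<or> (\<exists>\<^sub>\<infinity>i. l + e \<le> u i)"
    proof -
      have "\<exists>\<^sub>\<infinity>i. u i \<le> l - e \<or> l + e \<le> u i" using e(2) by (rule INFM_mono) linarith
      then show ?thesis by (simp add: INFM_disj_distrib)
    qed
    then show False
    proof
      assume low: "\<exists>\<^sub>\<infinity>i. u i \<le> l - e"
      obtain r where r: "l - e < of_rat r" "of_rat r < l - e / 2" using of_rat_dense[of "l - e" "l - e / 2"] e(1) by auto
      obtain s where s: "of_rat r < (of_rat s :: real)" "of_rat s < l - e / 2"
        using of_rat_dense[OF r(2)] by auto
      have "\<exists>\<^sub>\<infinity>i. u i \<le> of_rat r" using low by (rule INFM_mono) (use r in linarith)
      moreover have "\<exists>\<^sub>\<infinity>i. of_rat s \<le> u i"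
        using near2 by (rule INFM_mono) (use s in linarith)
      ultimately show False using osc[of r s] s(1) by (simp add: of_rat_less)
    next
      assume high: "\<exists>\<^sub>\<infinity>i. l + e \<le> u i"
      obtain r where r: "l + e / 2 < of_rat r" "of_rat r < l + e" using of_rat_dense[of "l + e / 2" "l + e"] e(1) by auto
      obtain s where s: "of_rat r < (of_rat s :: real)" "of_rat s < l + e"
        using of_rat_dense[OF r(2)] by auto
      have "\<exists>\<^sub>\<infinity>i. of_rat s \<le> u i" using high by (rule INFM_mono) (use s in linarith)
      moreover have "\<exists>\<^sub>\<infinity>i. u i \<le> of_rat r"
        using near2 by (rule INFM_mono) (use r in linarith)
      ultimately show False using osc[of r s] s(1) by (simp add: of_rat_less)
    qed
  qed
  then show ?thesis by (rule convergentI)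
qed

lemma INFM_subseq:
  fixes R :: "'a \<Rightarrow> bool" and q :: "nat \<Rightarrow> 'a" and t :: "nat \<Rightarrow> nat"
  assumes inf: "\<exists>\<^sub>\<infinity>i. R (q (t i))" and t: "strict_mono t"
  shows "\<exists>\<^sub>\<infinity>i. R (q i)"
  unfolding INFM_nat
proof
  fix n
  obtain i where "n < i" "R (q (t i))" using inf[unfolded INFM_nat, rule_format, of n] by blast
  then show "\<exists>m>n. R (q m)" using seq_suble[OF t, of i] by (intro exI[of _ "t i"]) auto
qed

text \<open>For one pair of thresholds Galvin's lemma is applied to the finite sets on which no
  functional alternates. An infinite set without such subsets would yield the first case. Otherwise
  no functional oscillates between the thresholds along \<open>M\<close>, because it would alternate
  on every initial segment of some infinite subset. Diagonalization runs through all pairs.\<close>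

theorem rosenthal:
  fixes y :: "nat \<Rightarrow> 'b::real_normed_vector"
  assumes B: "\<And>n. norm (y n) \<le> B"
  shows "\<exists>p :: nat \<Rightarrow> nat. strict_mono p \<and>
    ((\<exists>c>0. \<forall>a n. c * (\<Sum>i<n. \<bar>a i\<bar>) \<le> norm (\<Sum>i<n. a i *\<^sub>R y (p i))) \<or>
     (\<forall>f\<in>dual_ball. convergent (\<lambda>i. f (y (p i)))))"
proof (rule ccontr)
  assume no: "\<not> ?thesis"
  define r s where "r k = fst (from_nat k :: rat \<times> rat)" and "s k = snd (from_nat k :: rat \<times> rat)" for k
  define P where "P k q \<longleftrightarrow> (r k < s k \<longrightarrow> (\<forall>f\<in>dual_ball.
    \<not> ((\<exists>\<^sub>\<infinity>i. f (y (q i)) \<le> of_rat (r k)) \<and> (\<exists>\<^sub>\<infinity>i. of_rat (s k) \<le> f (y (q i))))))"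
    for k and q :: "nat \<Rightarrow> nat"
  interpret subseqs P
  proof
    fix k and q :: "nat \<Rightarrow> nat" assume q: "strict_mono q"
    show "\<exists>t. strict_mono t \<and> P k (q \<circ> t)"
    proof (cases "r k < s k")
      case True
      define \<B> where "\<B> = {G. finite G \<and> \<not> (\<exists>f\<in>dual_ball. alternates y (of_rat (r k)) (of_rat (s k)) G f)}"
      have "infinite (range q)" using range_inj_infinite[OF strict_mono_imp_inj_on[OF q]] .
      moreover have "finite G" if "G \<in> \<B>" for G using that by (simp add: \<B>_def)
      ultimately obtain M where M: "M \<subseteq> range q" "infinite M"
        "(\<forall>G\<in>\<B>. \<not> G \<subseteq> M) \<or> (\<forall>L\<subseteq>M. infinite L \<longrightarrow> (\<exists>G\<in>\<B>. initial_segment G L))"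
        using galvin[of \<B> "range q"] by auto
      obtain m :: "nat \<Rightarrow> nat" where m: "strict_mono m" "range m = M"
        using infinite_nat_enum[OF M(2)] by metis
      have "\<not> (\<forall>G\<in>\<B>. \<not> G \<subseteq> M)"
      proof
        assume all: "\<forall>G\<in>\<B>. \<not> G \<subseteq> M"
        have alt: "\<exists>f\<in>dual_ball. alternates y (of_rat (r k)) (of_rat (s k)) G f" if "finite G" "G \<subseteq> range m" for G
          using all that m(2) by (auto simp: \<B>_def)
        have rs: "real_of_rat (r k) < real_of_rat (s k)" using True by (simp add: of_rat_less)
        have "strict_mono (\<lambda>i. m (3 * i + 1))" by (auto intro!: strict_monoI strict_monoD[OF m(1)])
        moreover have "(real_of_rat (s k) - of_rat (r k)) / 2 > 0" using rs by simp
        ultimately show False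
          using no l1_if_alternating[OF m(1) rs alt] by blast
      qed
      then have L: "\<forall>L\<subseteq>M. infinite L \<longrightarrow> (\<exists>G\<in>\<B>. initial_segment G L)" using M(3) by blast
      have noalt: "\<not> ((\<exists>\<^sub>\<infinity>i. i \<in> M \<and> f (y i) \<le> of_rat (r k)) \<and> (\<exists>\<^sub>\<infinity>i. i \<in> M \<and> of_rat (s k) \<le> f (y i)))"
        if f: "f \<in> dual_ball" for f
      proof
        assume "(\<exists>\<^sub>\<infinity>i. i \<in> M \<and> f (y i) \<le> of_rat (r k)) \<and> (\<exists>\<^sub>\<infinity>i. i \<in> M \<and> of_rat (s k) \<le> f (y i))"
        then obtain L0 where "L0 \<subseteq> M" "infinite L0"
            "\<forall>G. initial_segment G L0 \<longrightarrow> alternates y (of_rat (r k)) (of_rat (s k)) G f"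
          using alternating_subset[of M f y] by metis
        moreover then obtain G where "G \<in> \<B>" "initial_segment G L0" using L by metis
        ultimately show False using f by (auto simp: \<B>_def)
      qed
      have "m i \<in> range q" for i using m(2) M(1) by auto
      then have "\<forall>i. \<exists>j. m i = q j" by auto
      then obtain t where t: "\<And>i. m i = q (t i)" by metis
      have "strict_mono t"
      proof (rule strict_monoI)
        fix i j :: nat assume "i < j"
        then have "q (t i) < q (t j)" using strict_monoD[OF m(1)] t by metis
        then show "t i < t j" using strict_mono_less[OF q] by blast
      qed
      moreover have "P k (q \<circ> t)"
        unfolding P_def
      proof (intro impI ballI)
        fix f :: "'b \<Rightarrow> real" assume f: "f \<in> dual_ball"
        have "m i \<in> M" for i using m(2) by auto
        then have mM: "\<exists>\<^sub>\<infinity>i. i \<in> M \<and> R i" if "\<exists>\<^sub>\<infinity>i. R (m i)" for R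
          using INFM_subseq[of "\<lambda>i. i \<in> M \<and> R i" "\<lambda>i. i" m] that m(1) by simp
        then show "\<not> ((\<exists>\<^sub>\<infinity>i. f (y ((q \<circ> t) i)) \<le> of_rat (r k)) \<and> (\<exists>\<^sub>\<infinity>i. of_rat (s k) \<le> f (y ((q \<circ> t) i))))"
          using noalt[OF f] mM[of "\<lambda>i. f (y i) \<le> of_rat (r k)"] mM[of "\<lambda>i. of_rat (s k) \<le> f (y i)"]
          unfolding o_def t[symmetric] by blast
      qed
      ultimately show ?thesis by blast
    qed (auto simp: P_def intro!: exI[of _ id] strict_monoI)
  qed
  have P: "P k (diagseq \<circ> (+) (Suc k))" for k
  proof (rule diagseq_holds)
    fix t q :: "nat \<Rightarrow> nat" and k assume "strict_mono t" "P k q"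
    then show "P k (q \<circ> t)"
      unfolding P_def o_def using INFM_subseq[of "\<lambda>i. f (y i) \<le> of_rat (r k)" q t for f]
        INFM_subseq[of "\<lambda>i. of_rat (s k) \<le> f (y i)" q t for f] by blast
  qed
  have "convergent (\<lambda>i. f (y (diagseq i)))" if f: "f \<in> dual_ball" for f
  proof (rule convergent_if_no_oscillation)
    have "\<bar>f (y (diagseq i))\<bar> \<le> B" for i using dual_ball_le[OF f] B order_trans by blast
    then show "bounded (range (\<lambda>i. f (y (diagseq i))))" by (auto intro!: boundedI)
    fix r' s' :: rat assume less: "r' < s'"
    define k where "k = to_nat (r', s')"
    have k: "r k = r'" "s k = s'" by (simp_all add: r_def s_def k_def)
    \<comment> \<open>The diagonal sequence satisfies condition \<open>k\<close> only from index
      \<open>Suc k\<close> on; oscillation survives the removal of finitely many terms.\<close>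
    have shift: "\<exists>\<^sub>\<infinity>i. R (diagseq (Suc k + i))" if inf: "\<exists>\<^sub>\<infinity>i. R (diagseq i)" for R
      unfolding INFM_nat
    proof
      fix n
      obtain i where "n + Suc k < i" "R (diagseq i)" using inf[unfolded INFM_nat, rule_format, of "n + Suc k"] by blast
      then show "\<exists>m>n. R (diagseq (Suc k + m))" by (intro exI[of _ "i - Suc k"]) simp
    qed
    show "\<not> ((\<exists>\<^sub>\<infinity>i. f (y (diagseq i)) \<le> of_rat r') \<and> (\<exists>\<^sub>\<infinity>i. of_rat s' \<le> f (y (diagseq i))))"
      using P[of k] less f shift[of "\<lambda>i. f (y i) \<le> of_rat r'"] shift[of "\<lambda>i. of_rat s' \<le> f (y i)"]
      unfolding P_def k o_def by blast
  qed
  then show False using no subseq_diagseq by blast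
qed

section \<open>Selecting basic sequences\<close>

lemma compact_finite_combinations:
  fixes y :: "nat \<Rightarrow> 'b::real_normed_vector"
  shows "compact {\<Sum>i<n. a i *\<^sub>R y i |a. \<forall>i<n. \<bar>a i\<bar> \<le> R}" (is "compact (?S n)")
proof (induction n)
  case 0
  have "?S 0 = {0}" by auto
  then show ?case by simp
next
  case (Suc n)
  let ?T = "(\<lambda>t. t *\<^sub>R y n) ` {- R..R}"
  have "compact ?T" by (intro compact_continuous_image continuous_intros compact_Icc)
  moreover have "?S (Suc n) = {u + v |u v. u \<in> ?S n \<and> v \<in> ?T}"
  proof (intro equalityI subsetI)
    fix s assume "s \<in> ?S (Suc n)"
    then obtain a where a: "s = (\<Sum>i<n. a i *\<^sub>R y i) + a n *\<^sub>R y n" "\<forall>i<Suc n. \<bar>a i\<bar> \<le> R" by auto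
    then have "(\<Sum>i<n. a i *\<^sub>R y i) \<in> ?S n" by auto
    moreover have "a n *\<^sub>R y n \<in> ?T" using a(2) by (auto simp: abs_le_iff minus_le_iff)
    ultimately show "s \<in> {u + v |u v. u \<in> ?S n \<and> v \<in> ?T}" using a(1) by blast
  next
    fix s assume "s \<in> {u + v |u v. u \<in> ?S n \<and> v \<in> ?T}"
    then obtain a t where a: "s = (\<Sum>i<n. a i *\<^sub>R y i) + t *\<^sub>R y n" "\<forall>i<n. \<bar>a i\<bar> \<le> R" "t \<in> {- R..R}" by auto
    have "s = (\<Sum>i<Suc n. (a(n := t)) i *\<^sub>R y i)" using a(1) by simp
    moreover have "\<forall>i<Suc n. \<bar>(a(n := t)) i\<bar> \<le> R" using a(2,3) by (auto simp: less_Suc_eq abs_le_iff)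
    ultimately show "s \<in> ?S (Suc n)" by blast
  qed
  ultimately show ?case using compact_sums[OF Suc.IH] by simp
qed

text \<open>The coefficient bound puts the unit sphere of the span into a compact set, which has a
  finite \<open>\<tau>\<close>-net. A functional norming the net point \<open>v\<close> near
  \<open>u\<close> loses \<open>\<tau>\<close> in \<open>norm v\<close> and another
  \<open>\<tau>\<close> in passing from \<open>v\<close> to \<open>u\<close>.\<close>

lemma almost_norming_functionals:
  fixes y :: "nat \<Rightarrow> 'b::real_normed_vector"
  assumes R: "\<And>a i. i < n \<Longrightarrow> \<bar>a i\<bar> \<le> R * norm (\<Sum>i<n. a i *\<^sub>R y i)" and \<tau>: "0 < \<tau>"
  shows "\<exists>G\<subseteq>dual_ball. finite G \<and>
    (\<forall>a. \<exists>g\<in>G. (1 - 2 * \<tau>) * norm (\<Sum>i<n. a i *\<^sub>R y i) \<le> \<bar>g (\<Sum>i<n. a i *\<^sub>R y i)\<bar>)"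
proof -
  define S where "S = {\<Sum>i<n. a i *\<^sub>R y i |a. \<forall>i<n. \<bar>a i\<bar> \<le> R}"
  have "compact S" unfolding S_def by (rule compact_finite_combinations)
  then obtain N where N: "finite N" "S \<subseteq> (\<Union>v\<in>N. ball v \<tau>)"
  proof (rule compactE_image)
    show "S \<subseteq> (\<Union>v\<in>S. ball v \<tau>)" using \<tau> by auto
  qed auto
  obtain G where G: "\<And>v. G v \<in> dual_ball" "\<And>v :: 'b. G v v = norm v" using norming_functional by metis
  \<comment> \<open>The point 0 keeps the set of functionals nonempty, which the case
    \<open>s = 0\<close> needs.\<close>
  have "\<exists>g\<in>G ` insert 0 N. (1 - 2 * \<tau>) * norm s \<le> \<bar>g s\<bar>" if s: "s = (\<Sum>i<n. a i *\<^sub>R y i)" for a s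
  proof (cases "s = 0")
    case True
    then show ?thesis by (intro bexI[of _ "G 0"]) auto
  next
    case False
    define u where "u = s /\<^sub>R norm s"
    have u: "u = (\<Sum>i<n. (a i / norm s) *\<^sub>R y i)"
      unfolding u_def s by (simp add: scaleR_sum_right divide_inverse mult.commute)
    have nu: "norm u = 1" using False by (simp add: u_def)
    have "u \<in> S"
      unfolding S_def using R[of _ "\<lambda>i. a i / norm s"] nu unfolding u by (auto simp flip: abs_divide)
    then obtain v where v: "v \<in> N" "dist v u < \<tau>" using N(2) by auto
    have "\<bar>G v (v - u)\<bar> \<le> norm (v - u)" by (rule dual_ball_le[OF G(1)])
    moreover have "G v (v - u) = norm v - G v u" using linear_diff[OF dual_ball_linear[OF G(1)]] G(2) by metis
    moreover have "norm v \<ge> 1 - norm (v - u)" using norm_triangle_ineq2[of u v] nu by (simp add: norm_minus_commute)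
    ultimately have "1 - 2 * \<tau> \<le> \<bar>G v u\<bar>" using v(2) by (simp add: dist_norm)
    moreover have "G v u = G v s / norm s"
      using linear_cmul[OF dual_ball_linear[OF G(1)]] by (simp add: u_def divide_inverse mult.commute)
    ultimately have "(1 - 2 * \<tau>) * norm s \<le> \<bar>G v s\<bar>" using False by (simp add: pos_le_divide_eq)
    then show ?thesis using v(1) by blast
  qed
  moreover have "G ` insert 0 N \<subseteq> dual_ball" using G(1) by auto
  ultimately show ?thesis using N(1) by (intro exI[of _ "G ` insert 0 N"]) auto
qed

text \<open>Mazur's argument with a tolerance \<open>\<theta>\<close> instead of exact annihilation.
  The error \<open>\<bar>t\<bar> * \<theta>\<close> can be absorbed because
  \<open>\<bar>t\<bar> * c\<close> is at most
  \<open>norm (s + t *\<^sub>R v) + norm s\<close>.\<close>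

lemma mazur_step:
  fixes y :: "nat \<Rightarrow> 'b::real_normed_vector"
  assumes R: "\<And>a i. i < n \<Longrightarrow> \<bar>a i\<bar> \<le> R * norm (\<Sum>i<n. a i *\<^sub>R y i)" and \<eta>: "0 < \<eta>" and c: "0 < c"
  shows "\<exists>G \<theta>. G \<subseteq> dual_ball \<and> finite G \<and> 0 < \<theta> \<and> (\<forall>v. c \<le> norm v \<and> (\<forall>g\<in>G. \<bar>g v\<bar> \<le> \<theta>) \<longrightarrow>
    (\<forall>a t. norm (\<Sum>i<n. a i *\<^sub>R y i) \<le> (1 + \<eta>) * norm ((\<Sum>i<n. a i *\<^sub>R y i) + t *\<^sub>R v)))"
proof -
  \<comment> \<open>Chosen so that \<open>(1 + \<tau>) / (1 - 3 * \<tau>)\<close> equals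
    \<open>1 + \<eta>\<close>.\<close>
  define \<tau> where "\<tau> = \<eta> / (4 + 3 * \<eta>)"
  have \<tau>: "0 < \<tau>" "1 - 3 * \<tau> > 0" "1 + \<tau> = (1 + \<eta>) * (1 - 3 * \<tau>)"
    using \<eta> by (auto simp: \<tau>_def field_simps)
  obtain G where G: "G \<subseteq> dual_ball" "finite G"
      "\<And>a. \<exists>g\<in>G. (1 - 2 * \<tau>) * norm (\<Sum>i<n. a i *\<^sub>R y i) \<le> \<bar>g (\<Sum>i<n. a i *\<^sub>R y i)\<bar>"
    using almost_norming_functionals[OF R \<tau>(1)] by metis
  have "norm s \<le> (1 + \<eta>) * norm (s + t *\<^sub>R v)"
    if v: "c \<le> norm v" "\<forall>g\<in>G. \<bar>g v\<bar> \<le> c * \<tau>" and s: "s = (\<Sum>i<n. a i *\<^sub>R y i)" for v s a t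
  proof -
    obtain g where g: "g \<in> G" "(1 - 2 * \<tau>) * norm s \<le> \<bar>g s\<bar>" using G(3) s by blast
    then have gb: "g \<in> dual_ball" using G(1) by blast
    have "g (s + t *\<^sub>R v) = g s + t * g v"
      using dual_ball_linear[OF gb] by (simp add: linear_add linear_cmul)
    moreover have "\<bar>g (s + t *\<^sub>R v)\<bar> \<le> norm (s + t *\<^sub>R v)" by (rule dual_ball_le[OF gb])
    moreover have "\<bar>t * g v\<bar> \<le> \<bar>t\<bar> * (c * \<tau>)" using v(2) g(1) by (simp add: abs_mult mult_left_mono)
    ultimately have 1: "(1 - 2 * \<tau>) * norm s \<le> norm (s + t *\<^sub>R v) + \<bar>t\<bar> * (c * \<tau>)" using g(2) by linarith
    have "\<bar>t\<bar> * c \<le> norm (t *\<^sub>R v)" using v(1) by (simp add: mult_left_mono)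
    also have "\<dots> \<le> norm (s + t *\<^sub>R v) + norm s" using norm_triangle_ineq4[of "s + t *\<^sub>R v" s] by simp
    finally have "\<bar>t\<bar> * c * \<tau> \<le> (norm (s + t *\<^sub>R v) + norm s) * \<tau>" using \<tau>(1) by (simp add: mult_right_mono)
    then have "(1 - 3 * \<tau>) * norm s \<le> (1 + \<tau>) * norm (s + t *\<^sub>R v)" using 1 by (simp add: algebra_simps)
    then have "(1 - 3 * \<tau>) * norm s \<le> (1 - 3 * \<tau>) * ((1 + \<eta>) * norm (s + t *\<^sub>R v))"
      using \<tau>(3) by (simp add: mult.commute mult.left_commute)
    then show ?thesis using \<tau>(2) by simp
  qed
  then show ?thesis using G(1,2) \<tau>(1) c by (intro exI[of _ G] exI[of _ "c * \<tau>"]) auto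
qed

text \<open>The chosen objects are abstract because the uses differ: indices of a subsequence in
  (ii), pairs of a tree node and a block in (iii). \<open>P\<close> expresses how a choice is
  constrained by the earlier ones, and \<open>loc\<close> confines it to them, as dependent choice
  requires.\<close>

lemma mazur_selection:
  fixes val :: "'x \<Rightarrow> 'b::real_normed_vector" and P :: "(nat \<Rightarrow> 'x) \<Rightarrow> nat \<Rightarrow> 'x \<Rightarrow> bool"
  assumes loc: "\<And>r f g n. (\<And>m. m < n \<Longrightarrow> f m = g m) \<Longrightarrow> P f n r = P g n r" and c: "0 < c"
    and ex: "\<And>f n G \<theta>. (\<And>m. m < n \<Longrightarrow> P f m (f m)) \<Longrightarrow> finite G \<Longrightarrow> G \<subseteq> dual_ball \<Longrightarrow> 0 < \<theta> \<Longrightarrow>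
      \<exists>r. P f n r \<and> c \<le> norm (val r) \<and> (\<forall>g\<in>G. \<bar>g (val r)\<bar> \<le> \<theta>)"
  shows "\<exists>f. (\<forall>n. P f n (f n)) \<and> (\<forall>n. c \<le> norm (val (f n))) \<and> projections_bounded 2 (\<lambda>n. val (f n))"
proof -
  \<comment> \<open>The constants telescope: the first \<open>n\<close> factors
    \<open>1 + \<eta> k\<close> multiply to \<open>L n\<close>, which starts at 1 and stays below
    2.\<close>
  define L :: "nat \<Rightarrow> real" where "L n = 2 - (1 / 2) ^ n" for n
  have L: "1 \<le> L n" "L n \<le> 2" "L n < L (Suc n)" for n
    by (auto simp: L_def power_le_one)
  define \<eta> where "\<eta> n = L (Suc n) / L n - 1" for n
  have \<eta>: "0 < \<eta> n" "L n * (1 + \<eta> n) = L (Suc n)" for n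
    using L[of n] by (auto simp: \<eta>_def field_simps)
  define Q where "Q f n r \<longleftrightarrow> P f n r \<and> c \<le> norm (val r) \<and>
    (\<forall>a t. norm (\<Sum>i<n. a i *\<^sub>R val (f i)) \<le> (1 + \<eta> n) * norm ((\<Sum>i<n. a i *\<^sub>R val (f i)) + t *\<^sub>R val r))" for f n r
  have pb: "norm (\<Sum>i<m. a i *\<^sub>R val (f i)) \<le> L n * norm (\<Sum>i<n. a i *\<^sub>R val (f i))"
    if "\<And>k. k < n \<Longrightarrow> Q f k (f k)" "m \<le> n" for f n m and a :: "nat \<Rightarrow> real"
    using that
  proof (induction n)
    case 0
    then show ?case by simp
  next
    case (Suc n)
    show ?case
    proof (cases "m = Suc n")
      case True
      then show ?thesis using L(1)[of "Suc n"] by (simp add: mult_le_cancel_right1)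
    next
      case False
      then have "norm (\<Sum>i<m. a i *\<^sub>R val (f i)) \<le> L n * norm (\<Sum>i<n. a i *\<^sub>R val (f i))"
        using Suc by simp
      also have "\<dots> \<le> L n * ((1 + \<eta> n) * norm ((\<Sum>i<n. a i *\<^sub>R val (f i)) + a n *\<^sub>R val (f n)))"
        using Suc.prems(1)[of n] L(1)[of n] unfolding Q_def by (intro mult_left_mono) auto
      also have "\<dots> = L (Suc n) * norm (\<Sum>i<Suc n. a i *\<^sub>R val (f i))" by (simp flip: \<eta>(2))
      finally show ?thesis .
    qed
  qed
  have "\<exists>f. \<forall>n. Q f n (f n)"
  proof (rule dependent_wellorder_choice)
    fix r f g and n :: nat assume eq: "\<And>m. m < n \<Longrightarrow> f m = (g m :: 'x)"
    have "(\<Sum>i<n. a i *\<^sub>R val (f i)) = (\<Sum>i<n. a i *\<^sub>R val (g i))" for a by (intro sum.cong) (auto simp: eq)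
    then show "Q f n r = Q g n r" unfolding Q_def using loc[of n f g r, OF eq] by simp
  next
    fix n f assume Q: "\<And>m. m < n \<Longrightarrow> Q f m (f m)"
    \<comment> \<open>The 4 comes from a difference of two partial sums, each at most twice the norm
      of the whole.\<close>
    have R: "\<bar>a i\<bar> \<le> 4 / c * norm (\<Sum>i<n. a i *\<^sub>R val (f i))" if "i < n" for a i
    proof -
      have pb2: "norm (\<Sum>i<m. a i *\<^sub>R val (f i)) \<le> 2 * norm (\<Sum>i<n. a i *\<^sub>R val (f i))" if "m \<le> n" for m
        by (rule order_trans[OF pb[OF Q that] mult_right_mono[OF L(2)]]) auto
      have "\<bar>a i\<bar> * c \<le> \<bar>a i\<bar> * norm (val (f i))" using Q[OF that] by (intro mult_left_mono) (auto simp: Q_def)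
      also have "\<dots> = norm ((\<Sum>k<Suc i. a k *\<^sub>R val (f k)) - (\<Sum>k<i. a k *\<^sub>R val (f k)))" by simp
      also have "\<dots> \<le> norm (\<Sum>k<Suc i. a k *\<^sub>R val (f k)) + norm (\<Sum>k<i. a k *\<^sub>R val (f k))" by (rule norm_triangle_ineq4)
      also have "\<dots> \<le> 2 * norm (\<Sum>i<n. a i *\<^sub>R val (f i)) + 2 * norm (\<Sum>i<n. a i *\<^sub>R val (f i))"
        using that by (intro add_mono pb2) auto
      finally show ?thesis using c by (simp add: field_simps)
    qed
    obtain G \<theta> where G: "G \<subseteq> dual_ball" "finite G" "0 < \<theta>"
        "\<forall>v. c \<le> norm v \<and> (\<forall>g\<in>G. \<bar>g v\<bar> \<le> \<theta>) \<longrightarrow> (\<forall>a t.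
          norm (\<Sum>i<n. a i *\<^sub>R val (f i)) \<le> (1 + \<eta> n) * norm ((\<Sum>i<n. a i *\<^sub>R val (f i)) + t *\<^sub>R v))"
      using mazur_step[of n "4 / c" "\<lambda>i. val (f i)", OF R \<eta>(1)[of n] c] by blast
    have "P f m (f m)" if "m < n" for m using Q[OF that] by (simp add: Q_def)
    from ex[OF this G(2,1,3)] obtain r where r: "P f n r" "c \<le> norm (val r)" "\<forall>g\<in>G. \<bar>g (val r)\<bar> \<le> \<theta>"
      by blast
    then have "Q f n r" unfolding Q_def using G(4)[rule_format, of "val r"] by simp
    then show "\<exists>r. Q f n r" ..
  qed
  then obtain f where f: "\<And>n. Q f n (f n)" by blast
  have "projections_bounded 2 (\<lambda>n. val (f n))"
    unfolding projections_bounded_def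
    by (intro allI impI order_trans[OF pb[OF f] mult_right_mono[OF L(2)]]) auto
  moreover have "P f n (f n)" "c \<le> norm (val (f n))" for n using f[of n] by (simp_all add: Q_def)
  ultimately show ?thesis by blast
qed

lemma dominates_unit_seq_if_projections_bounded:
  fixes y :: "nat \<Rightarrow> 'b::real_normed_vector"
  assumes pb: "projections_bounded 2 y" and c: "0 < c" "\<And>i. c \<le> norm (y i)"
  shows "dominates (4 / c) y unit_seq"
proof (rule dominates_unit_seq)
  show "0 \<le> 4 / c" using c(1) by simp
  fix a and n j :: nat assume "j < n"
  have "\<bar>a j\<bar> * c \<le> \<bar>a j\<bar> * norm (y j)" using c(2) by (intro mult_left_mono) auto
  also have "\<dots> \<le> 4 * norm (\<Sum>i<n. a i *\<^sub>R y i)" using projections_bounded_coeff[OF pb \<open>j < n\<close>, of a] by simp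
  finally show "\<bar>a j\<bar> \<le> 4 / c * norm (\<Sum>i<n. a i *\<^sub>R y i)" using c(1) by (simp add: field_simps)
qed

section \<open>Schreier families\<close>

lemma schreier_empty: "{} \<in> schreier \<sigma> \<xi>"
  by (subst schreier.simps) simp

lemma omega1_cases:
  obtains "\<xi> = 0" | \<zeta> where "\<xi> = osuc \<zeta>" "\<zeta> < \<xi>" | "is_limit \<xi>"
proof (cases "\<xi> = 0 \<or> is_limit \<xi>")
  case False
  then have "\<xi> = osuc (opred \<xi>)" "opred \<xi> < \<xi>" by (simp_all add: osuc_opred opred_less)
  then show ?thesis by (rule that(2))
qed (use that in blast)

text \<open>Pieces are numbered from 0, may be empty, and the bound \<open>n\<close> is imposed on
  all of \<open>E\<close>. In this form a splitting survives the intersection with a subset, which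
  may empty the first pieces.\<close>

definition schreier_split :: "nat set set \<Rightarrow> nat set \<Rightarrow> (nat \<Rightarrow> nat set) \<Rightarrow> nat \<Rightarrow> bool" where
  "schreier_split \<S> E F n \<longleftrightarrow> E = (\<Union>i<n. F i) \<and> (\<forall>i<n. F i \<in> \<S>) \<and> (\<forall>k\<in>E. n \<le> k) \<and>
    (\<forall>i j. i < j \<longrightarrow> j < n \<longrightarrow> (\<forall>a\<in>F i. \<forall>b\<in>F j. a < b))"

lemma schreier_splitD:
  assumes "schreier_split \<S> E F n"
  shows "E = (\<Union>i<n. F i)" "i < n \<Longrightarrow> F i \<in> \<S>" "k \<in> E \<Longrightarrow> n \<le> k"
    "i < j \<Longrightarrow> j < n \<Longrightarrow> a \<in> F i \<Longrightarrow> b \<in> F j \<Longrightarrow> a < b"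
proof -
  note s = assms[unfolded schreier_split_def]
  show "E = (\<Union>i<n. F i)" by (rule conjunct1[OF s])
  show "i < n \<Longrightarrow> F i \<in> \<S>" using s by blast
  show "k \<in> E \<Longrightarrow> n \<le> k" using conjunct1[OF conjunct2[OF conjunct2[OF s]]] by blast
  show "i < j \<Longrightarrow> j < n \<Longrightarrow> a \<in> F i \<Longrightarrow> b \<in> F j \<Longrightarrow> a < b"
    using conjunct2[OF conjunct2[OF conjunct2[OF s]]] by blast
qed

lemma schreier_osucD:
  assumes "E \<in> schreier \<sigma> (osuc \<zeta>)"
  shows "\<exists>F n. schreier_split (schreier \<sigma> \<zeta>) E F n"
proof (cases "E = {}")
  case True
  then show ?thesis by (intro exI[of _ "\<lambda>_. {}"] exI[of _ 0]) (simp add: schreier_split_def)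
next
  case False
  then obtain F n where F: "E = \<Union> (F ` {1..n})" "n \<ge> 1"
      "\<forall>i\<in>{1..n}. F i \<noteq> {} \<and> F i \<in> schreier \<sigma> \<zeta>" "\<forall>k\<in>F 1. n \<le> k"
      "\<forall>i j. 1 \<le> i \<and> i < j \<and> j \<le> n \<longrightarrow> (\<forall>a\<in>F i. \<forall>b\<in>F j. a < b)"
    using assms unfolding schreier_osuc by (simp only: insert_iff mem_Collect_eq) blast
  have E: "E = (\<Union>i<n. F (Suc i))"
    unfolding F(1) using image_Suc_lessThan[of n] by (metis image_image)
  have "n \<le> k" if k: "k \<in> E" for k
  proof -
    obtain i where i: "i \<in> {1..n}" "k \<in> F i" using k F(1) by auto
    obtain a where a: "a \<in> F 1" using F(2,3) by fastforce
    show ?thesis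
    proof (cases "i = 1")
      case True
      then show ?thesis using i F(4) by auto
    next
      case False
      then have "1 < i" "i \<le> n" using i(1) by auto
      then have "a < k" using F(5)[rule_format, of 1 i a k] i a by simp
      moreover have "n \<le> a" using F(4) a by blast
      ultimately show ?thesis by simp
    qed
  qed
  moreover have "F (Suc i) \<in> schreier \<sigma> \<zeta>" if "i < n" for i using F(3) that by simp
  moreover have "a < b" if "i < j" "j < n" "a \<in> F (Suc i)" "b \<in> F (Suc j)" for i j a b
    using F(5)[rule_format, of "Suc i" "Suc j" a b] that by simp
  ultimately have "schreier_split (schreier \<sigma> \<zeta>) E (\<lambda>i. F (Suc i)) n"
    unfolding schreier_split_def using E by blast
  then show ?thesis by blast
qed

text \<open>Empty pieces are dropped and the others renumbered increasingly. Having fewer pieces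
  only relaxes the condition that their number is at most the least element.\<close>

lemma schreier_osucI:
  assumes F: "E = (\<Union>i<n. F i)" "\<And>i. i < n \<Longrightarrow> F i \<in> schreier \<sigma> \<zeta>" "\<And>k. k \<in> E \<Longrightarrow> n \<le> k"
    "\<And>i j a b. i < j \<Longrightarrow> j < n \<Longrightarrow> a \<in> F i \<Longrightarrow> b \<in> F j \<Longrightarrow> a < b"
  shows "E \<in> schreier \<sigma> (osuc \<zeta>)"
proof (cases "E = {}")
  case False
  define J where "J = {i. i < n \<and> F i \<noteq> {}}"
  have fin: "finite J" by (simp add: J_def)
  define m where "m = card J"
  obtain h where h: "bij_betw h {..<m} J" "strict_mono_on {..<m} h"
    using ex_bij_betw_strict_mono_card[OF fin] unfolding m_def by metis
  have hJ: "h i < n" "F (h i) \<noteq> {}" if "i < m" for i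
    using h(1) that by (auto simp: bij_betw_def J_def)
  have "J \<noteq> {}" using False F(1) by (auto simp: J_def)
  then have m: "1 \<le> m" using fin by (simp add: m_def Suc_le_eq card_gt_0_iff)
  have mn: "m \<le> n" using card_mono[of "{..<n}" J] by (auto simp: m_def J_def)
  define F' where "F' i = F (h (i - 1))" for i
  have "E = (\<Union>i\<in>J. F i)" unfolding F(1) J_def by auto
  also have "\<dots> = (\<Union>i\<in>h ` {..<m}. F i)" using h(1) by (simp add: bij_betw_def)
  also have "\<dots> = (\<Union>i\<in>{..<m}. F' (Suc i))" by (simp add: F'_def)
  also have "\<dots> = (\<Union>i\<in>Suc ` {..<m}. F' i)" by simp
  finally have E: "E = \<Union> (F' ` {1..m})" unfolding image_Suc_lessThan .
  have sub: "F' i \<subseteq> E" if "1 \<le> i" "i \<le> m" for i using that unfolding E by auto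
  have "\<forall>k\<in>F' 1. m \<le> k" using F(3) mn sub[of 1] m by (meson order_trans order_refl subsetD)
  moreover have "\<forall>a\<in>F' i. \<forall>b\<in>F' j. a < b" if "1 \<le> i \<and> i < j \<and> j \<le> m" for i j
  proof -
    have "h (i - 1) < h (j - 1)" using that by (intro strict_mono_onD[OF h(2)]) auto
    moreover have "h (j - 1) < n" using hJ(1)[of "j - 1"] that by auto
    ultimately show ?thesis using F(4) unfolding F'_def by metis
  qed
  moreover have "F' i \<noteq> {} \<and> F' i \<in> schreier \<sigma> \<zeta>" if "i \<in> {1..m}" for i
  proof -
    have "i - 1 < m" using that by auto
    then show ?thesis using hJ F(2) unfolding F'_def by metis
  qed
  ultimately have "\<exists>F n. E = \<Union> (F ` {1..n}) \<and> n \<ge> 1 \<and>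
       (\<forall>i\<in>{1..n}. F i \<noteq> {} \<and> F i \<in> schreier \<sigma> \<zeta>) \<and> (\<forall>k\<in>F 1. n \<le> k) \<and>
       (\<forall>i j. 1 \<le> i \<and> i < j \<and> j \<le> n \<longrightarrow> (\<forall>a\<in>F i. \<forall>b\<in>F j. a < b))"
    using E m by (intro exI[of _ F'] exI[of _ m]) simp
  then show ?thesis unfolding schreier_osuc by simp
qed (simp add: schreier_empty)

text \<open>Sequences are indexed from 0 in the constructions, while Schreier sets consist of
  positive integers.\<close>

definition schreier0 :: "(omega1 \<Rightarrow> nat \<Rightarrow> omega1) \<Rightarrow> omega1 \<Rightarrow> nat set set" where
  "schreier0 \<sigma> \<xi> = {F. Suc ` F \<in> schreier \<sigma> \<xi>}"

context
  fixes \<sigma> :: "omega1 \<Rightarrow> nat \<Rightarrow> omega1"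
  assumes \<sigma>: "fundamental_sequences \<sigma>"
begin

lemma schreier_limit_iff:
  "is_limit \<xi> \<Longrightarrow> E \<in> schreier \<sigma> \<xi> \<longleftrightarrow> E = {} \<or> (\<exists>n\<ge>1. (\<forall>k\<in>E. n \<le> k) \<and> E \<in> schreier \<sigma> (\<sigma> \<xi> n))"
  using schreier_limit[OF \<sigma>, of \<xi>] by (simp only: insert_iff mem_Collect_eq)

lemma fundamental_less: "is_limit \<xi> \<Longrightarrow> 1 \<le> n \<Longrightarrow> \<sigma> \<xi> n < \<xi>"
  using \<sigma> unfolding fundamental_sequences_def by blast

lemma fundamental_two_pos: "is_limit \<xi> \<Longrightarrow> 0 < \<sigma> \<xi> 2"
proof -
  assume "is_limit \<xi>"
  then have "strict_mono_on {1..} (\<sigma> \<xi>)" using \<sigma> by (simp add: fundamental_sequences_def)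
  from strict_mono_onD[OF this, of 1 2] have "\<sigma> \<xi> 1 < \<sigma> \<xi> 2" by simp
  then show ?thesis using zero_le_omega1 order_le_less_trans by blast
qed

lemma schreier_finite:
  "E \<in> schreier \<sigma> \<xi> \<Longrightarrow> finite E \<and> (\<forall>k\<in>E. 1 \<le> k)"
proof (induction \<xi> arbitrary: E rule: less_induct)
  case (less \<xi>)
  show ?case
  proof (cases \<xi> rule: omega1_cases)
    case 1
    then show ?thesis using less.prems by (auto simp: schreier_zero)
  next
    case (2 \<zeta>)
    have "E \<in> schreier \<sigma> (osuc \<zeta>)" using less.prems 2(1) by simp
    from schreier_osucD[OF this] obtain F n where "schreier_split (schreier \<sigma> \<zeta>) E F n" by blast
    note F = schreier_splitD[OF this]
    have "finite (F i) \<and> (\<forall>k\<in>F i. 1 \<le> k)" if "i < n" for i by (rule less.IH[OF 2(2) F(2)[OF that]])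
    then show ?thesis using F(1) by auto
  next
    case 3
    then consider "E = {}" | n where "1 \<le> n" "E \<in> schreier \<sigma> (\<sigma> \<xi> n)"
      using less.prems schreier_limit_iff by blast
    then show ?thesis using less.IH[OF fundamental_less[OF 3]] by cases auto
  qed
qed

lemma schreier_hereditary:
  "E \<in> schreier \<sigma> \<xi> \<Longrightarrow> G \<subseteq> E \<Longrightarrow> G \<in> schreier \<sigma> \<xi>"
proof (induction \<xi> arbitrary: E G rule: less_induct)
  case (less \<xi>)
  show ?case
  proof (cases \<xi> rule: omega1_cases)
    case 1
    then show ?thesis using less.prems by (auto simp: schreier_zero subset_singleton_iff)
  next
    case (2 \<zeta>)
    have "E \<in> schreier \<sigma> (osuc \<zeta>)" using less.prems 2(1) by simp
    from schreier_osucD[OF this] obtain F n where "schreier_split (schreier \<sigma> \<zeta>) E F n" by blast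
    note F = schreier_splitD[OF this]
    show ?thesis
      unfolding 2(1)
    proof (rule schreier_osucI)
      show "F i \<inter> G \<in> schreier \<sigma> \<zeta>" if "i < n" for i by (rule less.IH[OF 2(2) F(2)[OF that]]) simp
      show "G = (\<Union>i<n. F i \<inter> G)" using F(1) less.prems(2) by auto
      show "n \<le> k" if "k \<in> G" for k using F(3) less.prems(2) that by blast
      show "a < b" if "i < j" "j < n" "a \<in> F i \<inter> G" "b \<in> F j \<inter> G" for i j a b using F(4) that by blast
    qed
  next
    case 3
    show ?thesis
    proof (cases "E = {}")
      case False
      then obtain n where n: "1 \<le> n" "\<forall>k\<in>E. n \<le> k" "E \<in> schreier \<sigma> (\<sigma> \<xi> n)"
        using less.prems(1) unfolding schreier_limit_iff[OF 3] by blast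
      have "G \<in> schreier \<sigma> (\<sigma> \<xi> n)" by (rule less.IH[OF fundamental_less[OF 3 n(1)] n(3) less.prems(2)])
      moreover have "\<forall>k\<in>G. n \<le> k" using n(2) less.prems(2) by blast
      ultimately show ?thesis unfolding schreier_limit_iff[OF 3] using n(1) by blast
    qed (use less.prems(2) in \<open>simp add: schreier_empty\<close>)
  qed
qed

lemma schreier_spreading:
  "E \<in> schreier \<sigma> \<xi> \<Longrightarrow> strict_mono_on E f \<Longrightarrow> (\<And>k. k \<in> E \<Longrightarrow> k \<le> f k) \<Longrightarrow> f ` E \<in> schreier \<sigma> \<xi>"
proof (induction \<xi> arbitrary: E rule: less_induct)
  case (less \<xi>)
  show ?case
  proof (cases \<xi> rule: omega1_cases)
    case 1
    then show ?thesis using less.prems(1) less.prems(3) by (auto simp: schreier_zero)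
  next
    case (2 \<zeta>)
    have "E \<in> schreier \<sigma> (osuc \<zeta>)" using less.prems 2(1) by simp
    from schreier_osucD[OF this] obtain F n where "schreier_split (schreier \<sigma> \<zeta>) E F n" by blast
    note F = schreier_splitD[OF this]
    have FE: "F i \<subseteq> E" if "i < n" for i using F(1) that by auto
    show ?thesis
      unfolding 2(1)
    proof (rule schreier_osucI)
      show "f ` E = (\<Union>i<n. f ` F i)" using F(1) by auto
      show "f ` F i \<in> schreier \<sigma> \<zeta>" if "i < n" for i
      proof (rule less.IH[OF 2(2) F(2)[OF that]])
        show "strict_mono_on (F i) f" "\<And>k. k \<in> F i \<Longrightarrow> k \<le> f k"
          using less.prems(2,3) FE[OF that] by (auto simp: strict_mono_on_def)
      qed
      show "n \<le> k" if "k \<in> f ` E" for k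
      proof -
        obtain l where "l \<in> E" "k = f l" using \<open>k \<in> f ` E\<close> by blast
        then show ?thesis using F(3)[of l] less.prems(3)[of l] by simp
      qed
      show "c < d" if ij: "i < j" "j < n" and "c \<in> f ` F i" "d \<in> f ` F j" for i j c d
      proof -
        obtain a b where ab: "a \<in> F i" "c = f a" "b \<in> F j" "d = f b" using \<open>c \<in> _\<close> \<open>d \<in> _\<close> by blast
        then show ?thesis
          using F(4)[OF ij] FE ij by (auto intro!: strict_mono_onD[OF less.prems(2)] dest: order.strict_trans)
      qed
    qed
  next
    case 3
    show ?thesis
    proof (cases "E = {}")
      case False
      then obtain n where n: "1 \<le> n" "\<forall>k\<in>E. n \<le> k" "E \<in> schreier \<sigma> (\<sigma> \<xi> n)"
        using less.prems(1) unfolding schreier_limit_iff[OF 3] by blast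
      then have "f ` E \<in> schreier \<sigma> (\<sigma> \<xi> n)"
        using less.IH[OF fundamental_less[OF 3 n(1)] n(3)] less.prems(2,3) by blast
      moreover have "\<forall>k\<in>f ` E. n \<le> k" using n(2) less.prems(3) by (auto intro: order_trans)
      ultimately show ?thesis unfolding schreier_limit_iff[OF 3] using n(1) by blast
    qed (simp add: schreier_empty)
  qed
qed

lemma schreier_one:
  assumes "finite E" "\<forall>k\<in>E. 1 \<le> k \<and> card E \<le> k"
  shows "E \<in> schreier \<sigma> (osuc 0)"
proof -
  obtain h where h: "bij_betw h {..<card E} E" "strict_mono_on {..<card E} h"
    using ex_bij_betw_strict_mono_card[OF assms(1)] by metis
  have "E = (\<Union>i<card E. {h i})" using h(1) by (auto simp: bij_betw_def)
  moreover have "h i \<in> E" if "i < card E" for i using h(1) that by (auto simp: bij_betw_def)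
  moreover have "h i < h j" if "i < j" "j < card E" for i j using that by (intro strict_mono_onD[OF h(2)]) auto
  ultimately show ?thesis
    using assms(2) by (intro schreier_osucI[of _ "\<lambda>i. {h i}" "card E"]) (auto simp: schreier_zero)
qed

lemma card_schreier_one:
  assumes "E \<in> schreier \<sigma> (osuc 0)" "k \<in> E"
  shows "card E \<le> k"
proof -
  from schreier_osucD[OF assms(1)] obtain F n where "schreier_split (schreier \<sigma> 0) E F n" by blast
  note F = schreier_splitD[OF this]
  have "card E \<le> (\<Sum>i<n. card (F i))" using card_UN_le[of "{..<n}" F] F(1) by simp
  also have "\<dots> \<le> (\<Sum>i<n. 1)" using F(2) by (intro sum_mono) (fastforce simp: schreier_zero)
  also have "\<dots> \<le> k" using F(3) assms(2) by simp
  finally show ?thesis .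
qed

text \<open>\<open>S\<^sub>1\<close> need not be contained in \<open>S\<^sub>\<xi>\<close>, because the first term of a fundamental
  sequence may be \<open>0\<close>; the sets that do not contain \<open>1\<close> cause no problem.\<close>

lemma schreier_if_small:
  "0 < \<xi> \<Longrightarrow> finite E \<Longrightarrow> \<forall>k\<in>E. 2 \<le> k \<and> card E \<le> k \<Longrightarrow> E \<in> schreier \<sigma> \<xi>"
proof (induction \<xi> rule: less_induct)
  case (less \<xi>)
  show ?case
  proof (cases \<xi> rule: omega1_cases)
    case 1
    then show ?thesis using less.prems by simp
  next
    case (2 \<zeta>)
    show ?thesis
    proof (cases "\<zeta> = 0")
      case True
      then show ?thesis unfolding 2(1) using less.prems by (auto intro!: schreier_one)
    next
      case False
      then have "E \<in> schreier \<sigma> \<zeta>" using less.IH[OF 2(2)] less.prems by (simp add: order.not_eq_order_implies_strict)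
      then show ?thesis
        unfolding 2(1) using less.prems(3) by (intro schreier_osucI[of _ "\<lambda>_. E" 1]) auto
    qed
  next
    case 3
    have "E \<in> schreier \<sigma> (\<sigma> \<xi> 2)"
      using less.IH[OF fundamental_less[OF 3] fundamental_two_pos[OF 3]] less.prems by simp
    then show ?thesis unfolding schreier_limit_iff[OF 3] using less.prems(3) by (intro disjI2 exI[of _ 2]) auto
  qed
qed

lemma schreier_singleton: "1 \<le> k \<Longrightarrow> {k} \<in> schreier \<sigma> \<xi>"
proof (induction \<xi> rule: less_induct)
  case (less \<xi>)
  show ?case
  proof (cases \<xi> rule: omega1_cases)
    case 1
    then show ?thesis using less.prems by (simp add: schreier_zero)
  next
    case (2 \<zeta>)
    have "{k} \<in> schreier \<sigma> \<zeta>" using less.IH[OF 2(2)] less.prems by simp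
    then show ?thesis
      unfolding 2(1) using less.prems by (intro schreier_osucI[of _ "\<lambda>_. {k}" 1]) auto
  next
    case 3
    have "{k} \<in> schreier \<sigma> (\<sigma> \<xi> 1)" using less.IH[OF fundamental_less[OF 3, of 1]] less.prems by simp
    then have "\<exists>n\<ge>1. (\<forall>l\<in>{k}. n \<le> l) \<and> {k} \<in> schreier \<sigma> (\<sigma> \<xi> n)"
      using less.prems by (intro exI[of _ 1]) simp
    then show ?thesis unfolding schreier_limit_iff[OF 3] ..
  qed
qed

text \<open>Serves to replace a sequence by differences of two of its terms. In
  \<open>S\<^sub>1\<close> the cardinality at most doubles, and so does the bound on it because
  \<open>2 * k \<le> f k\<close>; at higher successors the number of pieces stays the same. Level 0
  is excluded, as a pair is not a singleton.\<close>

lemma schreier_doubling: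
  "0 < \<xi> \<Longrightarrow> E \<in> schreier \<sigma> \<xi> \<Longrightarrow> (\<And>k. k \<in> E \<Longrightarrow> 2 * k \<le> f k \<and> f k < g k) \<Longrightarrow>
   (\<And>k l. k \<in> E \<Longrightarrow> l \<in> E \<Longrightarrow> k < l \<Longrightarrow> g k < f l) \<Longrightarrow> f ` E \<union> g ` E \<in> schreier \<sigma> \<xi>"
proof (induction \<xi> arbitrary: E rule: less_induct)
  case (less \<xi>)
  \<comment> \<open>Sets whose cardinality is at most their least element are handled by counting.
    Besides \<open>S\<^sub>1\<close> this covers the singletons that occur when the relevant term of
    a fundamental sequence is 0.\<close>
  have small: "f ` E \<union> g ` E \<in> schreier \<sigma> \<zeta>"
    if \<zeta>: "0 < \<zeta>" and fin: "finite E" and E: "\<And>k. k \<in> E \<Longrightarrow> 1 \<le> k \<and> card E \<le> k" for \<zeta>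
  proof (rule schreier_if_small[OF \<zeta>])
    show "finite (f ` E \<union> g ` E)" using fin by simp
    have "card (f ` E \<union> g ` E) \<le> card E + card E"
      by (rule order_trans[OF card_Un_le add_mono]) (auto intro: card_image_le fin)
    moreover have "2 \<le> f k \<and> 2 \<le> g k \<and> 2 * card E \<le> f k \<and> 2 * card E \<le> g k" if "k \<in> E" for k
      using less.prems(3)[OF that] E[OF that] by linarith
    ultimately show "\<forall>k\<in>f ` E \<union> g ` E. 2 \<le> k \<and> card (f ` E \<union> g ` E) \<le> k" by fastforce
  qed
  have fin: "finite E" and pos: "\<And>k. k \<in> E \<Longrightarrow> 1 \<le> k" using schreier_finite[OF less.prems(2)] by auto
  show ?case
  proof (cases \<xi> rule: omega1_cases)
    case 1
    then show ?thesis using less.prems(1) by simp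
  next
    case (2 \<zeta>)
    show ?thesis
    proof (cases "\<zeta> = 0")
      case True
      have "E \<in> schreier \<sigma> (osuc 0)" using less.prems(2) 2(1) True by simp
      then show ?thesis using small[OF less.prems(1) fin] card_schreier_one pos by blast
    next
      case False
      then have \<zeta>: "0 < \<zeta>" by (simp add: order.not_eq_order_implies_strict)
      have "E \<in> schreier \<sigma> (osuc \<zeta>)" using less.prems 2(1) by simp
    from schreier_osucD[OF this] obtain F n where "schreier_split (schreier \<sigma> \<zeta>) E F n" by blast
    note F = schreier_splitD[OF this]
      have FE: "a \<in> E" if "a \<in> F i" "i < n" for a i using F(1) that by auto
      show ?thesis
        unfolding 2(1)
      proof (rule schreier_osucI)
        show "f ` E \<union> g ` E = (\<Union>i<n. f ` F i \<union> g ` F i)" using F(1) by auto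
        show "f ` F i \<union> g ` F i \<in> schreier \<sigma> \<zeta>" if "i < n" for i
          by (rule less.IH[OF 2(2) \<zeta> F(2)[OF that]]) (use less.prems(3,4) FE that in metis)+
        show "n \<le> k" if "k \<in> f ` E \<union> g ` E" for k
        proof -
          obtain l where "l \<in> E" "k = f l \<or> k = g l" using \<open>k \<in> _\<close> by blast
          then show ?thesis using F(3)[of l] less.prems(3)[of l] by auto
        qed
        show "a < b" if ij: "i < j" "j < n" and "a \<in> f ` F i \<union> g ` F i" "b \<in> f ` F j \<union> g ` F j" for i j a b
        proof -
          obtain a' b' where ab: "a' \<in> F i" "a = f a' \<or> a = g a'" "b' \<in> F j" "b = f b' \<or> b = g b'"
            using \<open>a \<in> _\<close> \<open>b \<in> _\<close> by blast
          have E: "a' \<in> E" "b' \<in> E" using ab(1,3) FE ij by (auto dest: order.strict_trans)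
          have "g a' < f b'" by (rule less.prems(4)[OF E F(4)[OF ij ab(1,3)]])
          then show ?thesis using less.prems(3)[OF E(1)] less.prems(3)[OF E(2)] ab(2,4) by auto
        qed
      qed
    qed
  next
    case 3
    show ?thesis
    proof (cases "E = {}")
      case False
      then obtain n where n: "1 \<le> n" "\<forall>k\<in>E. n \<le> k" "E \<in> schreier \<sigma> (\<sigma> \<xi> n)"
        using less.prems(2) unfolding schreier_limit_iff[OF 3] by blast
      show ?thesis
      proof (cases "\<sigma> \<xi> n = 0")
        case True
        then obtain k where "E = {k}" using n(3) False by (auto simp: schreier_zero)
        then show ?thesis using small[OF less.prems(1)] pos by simp
      next
        case nz: False
        then have "f ` E \<union> g ` E \<in> schreier \<sigma> (\<sigma> \<xi> n)"
          by (intro less.IH[OF fundamental_less[OF 3 n(1)] _ n(3)] less.prems(3,4))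
            (simp_all add: order.not_eq_order_implies_strict)
        moreover have "\<forall>k\<in>f ` E \<union> g ` E. n \<le> k" using n(2) less.prems(3) by fastforce
        ultimately show ?thesis unfolding schreier_limit_iff[OF 3] using n(1) by blast
      qed
    qed (simp add: schreier_empty)
  qed
qed

lemma schreier0_finite: "F \<in> schreier0 \<sigma> \<xi> \<Longrightarrow> finite F"
proof -
  assume "F \<in> schreier0 \<sigma> \<xi>"
  then have "finite (Suc ` F)" using schreier_finite unfolding schreier0_def mem_Collect_eq by blast
  then show ?thesis by (rule finite_imageD) simp
qed

lemma schreier0_hereditary: "F \<in> schreier0 \<sigma> \<xi> \<Longrightarrow> G \<subseteq> F \<Longrightarrow> G \<in> schreier0 \<sigma> \<xi>"
  unfolding schreier0_def mem_Collect_eq by (rule schreier_hereditary[OF _ image_mono])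

lemma schreier0_singleton: "{k} \<in> schreier0 \<sigma> \<xi>"
  by (simp add: schreier0_def schreier_singleton)

lemma covering_schreier0: "covering (schreier0 \<sigma> \<xi>)"
  unfolding covering_def
proof (intro conjI ballI)
  have "k \<in> \<Union> (schreier0 \<sigma> \<xi>)" for k by (rule UnionI[OF schreier0_singleton]) simp
  then show "\<Union> (schreier0 \<sigma> \<xi>) = UNIV" by auto
qed (rule schreier0_finite)

lemma schreier0_subsequence:
  assumes "F \<in> schreier0 \<sigma> \<xi>" "strict_mono p"
  shows "p ` F \<in> schreier0 \<sigma> \<xi>"
proof -
  have "(\<lambda>k. Suc (p (k - 1))) ` Suc ` F \<in> schreier \<sigma> \<xi>"
  proof (rule schreier_spreading)
    show "Suc ` F \<in> schreier \<sigma> \<xi>" using assms(1) by (simp add: schreier0_def)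
    show "strict_mono_on (Suc ` F) (\<lambda>k. Suc (p (k - 1)))"
      using strict_monoD[OF assms(2)] by (auto simp: strict_mono_on_def)
    show "k \<le> Suc (p (k - 1))" for k using seq_suble[OF assms(2), of "k - 1"] by simp
  qed
  then show ?thesis by (simp add: schreier0_def image_image)
qed

lemma schreier0_doubling:
  assumes "0 < \<xi>" "F \<in> schreier0 \<sigma> \<xi>" "strict_mono p"
  shows "(\<lambda>i. p (2 * i + 1)) ` F \<union> (\<lambda>i. p (2 * i + 2)) ` F \<in> schreier0 \<sigma> \<xi>"
proof -
  \<comment> \<open>With \<open>k = i + 1\<close>, the indices \<open>2 * i + 1\<close> and
    \<open>2 * i + 2\<close> become the positive integers \<open>2 * k\<close> and
    \<open>2 * k + 1\<close>.\<close>
  have "(\<lambda>k. 2 * k) ` Suc ` F \<union> (\<lambda>k. 2 * k + 1) ` Suc ` F \<in> schreier \<sigma> \<xi>"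
    using assms by (intro schreier_doubling) (auto simp: schreier0_def)
  also have "(\<lambda>k. 2 * k) ` Suc ` F \<union> (\<lambda>k. 2 * k + 1) ` Suc ` F =
      Suc ` ((\<lambda>i. 2 * i + 1) ` F \<union> (\<lambda>i. 2 * i + 2) ` F)"
    by (simp add: image_Un image_image)
  finally have "(\<lambda>i. 2 * i + 1) ` F \<union> (\<lambda>i. 2 * i + 2) ` F \<in> schreier0 \<sigma> \<xi>"
    by (simp add: schreier0_def)
  from schreier0_subsequence[OF this assms(3)] show ?thesis by (simp add: image_Un image_image)
qed

lemma schreier0_small:
  assumes "0 < \<xi>" "finite F" "\<forall>k\<in>F. 1 \<le> k \<and> card F \<le> k"
  shows "F \<in> schreier0 \<sigma> \<xi>"
  using schreier_if_small[OF assms(1), of "Suc ` F"] assms(2,3)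
  by (force simp: schreier0_def card_image)

end

section \<open>The classes defined by Schreier families\<close>

lemma l1_norm_Suc: "l1_norm (Suc ` F) a = l1_norm F (\<lambda>i. a (Suc i))"
  by (simp add: l1_norm_def sum.reindex)

lemma c0_norm_Suc: "c0_norm (Suc ` F) a = c0_norm F (\<lambda>i. a (Suc i))"
  by (simp add: c0_norm_def image_image)

lemma not_schreier_singularD:
  fixes A :: "'a::banach \<Rightarrow> 'b::banach"
  assumes A: "is_operator (X, Y, A)" "(X, Y, A) \<notin> schreier_singular N \<sigma> \<xi>"
    and N: "\<And>F a. N (Suc ` F) a = N F (\<lambda>i. a (Suc i))"
  shows "\<exists>x \<epsilon>. 0 < \<epsilon> \<and> (\<forall>i. x i \<in> X \<and> norm (x i) = 1) \<and> (\<forall>F\<in>schreier0 \<sigma> \<xi>. \<forall>a.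
    \<epsilon> * N F a \<le> norm (\<Sum>i\<in>F. a i *\<^sub>R A (x i)) \<and> \<epsilon> * norm (\<Sum>i\<in>F. a i *\<^sub>R x i) \<le> N F a)"
proof -
  obtain x :: "nat \<Rightarrow> 'a" and \<epsilon> where x: "\<forall>n\<ge>1. x n \<in> X \<and> norm (x n) = 1" "\<epsilon> > 0"
    and est: "\<not> (\<exists>F\<in>schreier \<sigma> \<xi>. \<exists>a. norm (\<Sum>n\<in>F. a n *\<^sub>R A (x n)) < \<epsilon> * N F a \<or>
        N F a < \<epsilon> * norm (\<Sum>n\<in>F. a n *\<^sub>R x n))"
    using A unfolding schreier_singular_def by auto
  have "\<epsilon> * N F a \<le> norm (\<Sum>i\<in>F. a i *\<^sub>R A (x (Suc i))) \<and> \<epsilon> * norm (\<Sum>i\<in>F. a i *\<^sub>R x (Suc i)) \<le> N F a"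
    if F: "F \<in> schreier0 \<sigma> \<xi>" for F a
  proof -
    define b where "b n = a (n - 1)" for n :: nat
    have "Suc ` F \<in> schreier \<sigma> \<xi>" using F by (simp add: schreier0_def)
    then have "\<epsilon> * N (Suc ` F) b \<le> norm (\<Sum>n\<in>Suc ` F. b n *\<^sub>R A (x n)) \<and>
        \<epsilon> * norm (\<Sum>n\<in>Suc ` F. b n *\<^sub>R x n) \<le> N (Suc ` F) b"
      using est not_less by blast
    then show ?thesis by (simp add: N sum.reindex b_def)
  qed
  then show ?thesis using x by (intro exI[of _ "\<lambda>i. x (Suc i)"] exI[of _ \<epsilon>]) simp
qed

lemma not_schreier_singularI:
  fixes A :: "'a::banach \<Rightarrow> 'b::banach"
  assumes \<sigma>: "fundamental_sequences \<sigma>" and x: "\<And>i. x i \<in> X" "\<And>i. norm (x i) = 1" "basic_sequence x"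
    and \<epsilon>: "0 < \<epsilon>" and N: "\<And>F a. N (Suc ` F) a = N F (\<lambda>i. a (Suc i))"
    and est: "\<And>F a. F \<in> schreier0 \<sigma> \<xi> \<Longrightarrow> \<epsilon> * N F a \<le> norm (\<Sum>i\<in>F. a i *\<^sub>R A (x i))"
      "\<And>F a. F \<in> schreier0 \<sigma> \<xi> \<Longrightarrow> \<epsilon> * norm (\<Sum>i\<in>F. a i *\<^sub>R x i) \<le> N F a"
  shows "(X, Y, A) \<notin> schreier_singular N \<sigma> \<xi>"
proof
  assume "(X, Y, A) \<in> schreier_singular N \<sigma> \<xi>"
  then have all: "\<And>(x :: nat \<Rightarrow> 'a) \<epsilon> :: real.
        (\<forall>n\<ge>1. x n \<in> X \<and> norm (x n) = 1) \<and> basic_sequence (\<lambda>n. x (Suc n)) \<and> \<epsilon> > 0 \<Longrightarrow>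
        (\<exists>F\<in>schreier \<sigma> \<xi>. \<exists>a :: nat \<Rightarrow> real.
           norm (\<Sum>n\<in>F. a n *\<^sub>R A (x n)) < \<epsilon> * N F a \<or>
           N F a < \<epsilon> * norm (\<Sum>n\<in>F. a n *\<^sub>R x n))"
    unfolding schreier_singular_def by simp
  obtain F a where F: "F \<in> schreier \<sigma> \<xi>"
    and less: "norm (\<Sum>n\<in>F. a n *\<^sub>R A (x (n - 1))) < \<epsilon> * N F a \<or> N F a < \<epsilon> * norm (\<Sum>n\<in>F. a n *\<^sub>R x (n - 1))"
    using all[of "\<lambda>n. x (n - 1)" \<epsilon>] x \<epsilon> by auto
  define G where "G = {i. Suc i \<in> F}"
  have "k \<in> Suc ` G" if "k \<in> F" for k
    using schreier_finite[OF \<sigma> F] that by (intro image_eqI[of _ _ "k - 1"]) (auto simp: G_def)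
  then have FG: "F = Suc ` G" by (auto simp: G_def)
  then have "G \<in> schreier0 \<sigma> \<xi>" using F by (simp add: schreier0_def)
  then show False
    using less est[of G "\<lambda>i. a (Suc i)"] by (simp add: FG N sum.reindex)
qed

text \<open>The frame shared by the three parts: for each class it remains to find suitable vectors
  \<open>x i\<close> in the domain of an arbitrary operator outside it.\<close>

lemma universal_operator_from_basis:
  fixes z w :: "nat \<Rightarrow> linf" and J' :: "('a::banach, 'b::banach) oper set"
  assumes pb: "projections_bounded C z" and nz: "\<And>i. z i \<noteq> 0"
    and U: "is_operator (closure (span (range z)), UNIV, U)" "\<And>i. U (z i) = w i"
    and J: "(closure (span (range z)), UNIV, U) \<notin> J"
    and factor: "\<And>X Y A. is_operator (X, Y, A) \<Longrightarrow> (X, Y, A) \<notin> J' \<Longrightarrow>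
      \<exists>x K K'. (\<forall>i. x i \<in> X) \<and> dominates K z x \<and> 0 \<le> K' \<and> dominates K' (\<lambda>i. A (x i)) w"
  shows "universal_operator J J' (closure (span (range z)), UNIV, U)"
  unfolding universal_operator_def
proof (intro conjI allI impI U(1) J)
  fix A :: "('a, 'b) oper" assume A: "is_operator A \<and> A \<notin> J'"
  obtain X Y B where XYB: "A = (X, Y, B)" by (cases A) auto
  then obtain x K K' where x: "\<forall>i. x i \<in> X" "dominates K z x" "0 \<le> K'" "dominates K' (\<lambda>i. B (x i)) w"
    using factor A by metis
  show "factors_through (closure (span (range z)), UNIV, U) A"
    unfolding XYB using factors_through_basis_operator[OF pb nz U, of X Y B x K K'] x A XYB by blast
qed

section \<open>Operators on the span of \<open>ubasis\<close>, and the class for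
  \<open>c\<^sub>0\<close>\<close>

lemma ubasis_in_space: "ubasis \<F> i \<in> closure (span (range (ubasis \<F>)))"
  by (meson closure_subset in_mono rangeI span_superset)

lemma ubasis_neq_zero: "covering \<F> \<Longrightarrow> ubasis \<F> i \<noteq> 0"
  using norm_ubasis[of \<F> i] by auto

lemma basic_sequence_ubasis: "covering \<F> \<Longrightarrow> basic_sequence (ubasis \<F>)"
  by (rule basic_sequence_if_projections_bounded[OF projections_bounded_ubasis ubasis_neq_zero])

lemma operator_on_ubasis:
  assumes "covering \<F>" "dominates K (ubasis \<F>) w"
  shows "\<exists>U. is_operator (closure (span (range (ubasis \<F>))), UNIV :: linf set, U) \<and> (\<forall>i. U (ubasis \<F> i) = w i)"
  by (rule operator_from_basis[OF projections_bounded_ubasis[OF assms(1)] ubasis_neq_zero[OF assms(1)] _ _ _ assms(2)]) auto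

lemma ubasis_dominates_unit_seq: "covering \<F> \<Longrightarrow> dominates 1 (ubasis \<F>) unit_seq"
  by (rule dominates_unit_seq) (simp_all add: abs_le_norm_ubasis)

text \<open>Otherwise some functional is at least \<open>e\<close> in absolute value at infinitely
  many terms. Enough of them, taken far out, form a Schreier set, and their sum with matching signs
  violates the upper estimate.\<close>

lemma weakly_null_if_upper_c0:
  fixes y :: "nat \<Rightarrow> 'b::real_normed_vector"
  assumes \<sigma>: "fundamental_sequences \<sigma>" and \<xi>: "0 < \<xi>" and f: "f \<in> dual_ball"
    and B: "\<And>F a. F \<in> schreier0 \<sigma> \<xi> \<Longrightarrow> norm (\<Sum>i\<in>F. a i *\<^sub>R y i) \<le> B * c0_norm F a"
  shows "(\<lambda>n. f (y n)) \<longlonglongrightarrow> 0"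
proof (rule LIMSEQ_I)
  fix e :: real assume e: "0 < e"
  show "\<exists>n0. \<forall>n\<ge>n0. norm (f (y n) - 0) < e"
  proof (rule ccontr)
    assume no: "\<not> ?thesis"
    have inf: "infinite {n. e \<le> \<bar>f (y n)\<bar>}"
      unfolding infinite_nat_iff_unbounded_le using no by (auto simp: not_less)
    obtain m :: nat where m: "\<bar>B\<bar> / e < m" using reals_Archimedean2 by blast
    \<comment> \<open>Beyond \<open>m\<close>, any \<open>Suc m\<close> indices satisfy the
      cardinality condition of \<open>schreier0_small\<close>.\<close>
    have "infinite ({n. e \<le> \<bar>f (y n)\<bar>} - {..m})" using inf by simp
    then obtain F where F: "F \<subseteq> {n. e \<le> \<bar>f (y n)\<bar>} - {..m}" "finite F" "card F = Suc m"
      using infinite_arbitrarily_large by blast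
    have S: "F \<in> schreier0 \<sigma> \<xi>" using F by (intro schreier0_small[OF \<sigma> \<xi>]) auto
    have "real (Suc m) * e \<le> (\<Sum>i\<in>F. \<bar>f (y i)\<bar>)"
      using sum_bounded_below[of F e "\<lambda>i. \<bar>f (y i)\<bar>"] F by auto
    also have "\<dots> = f (\<Sum>i\<in>F. sgn (f (y i)) *\<^sub>R y i)"
      by (simp add: dual_ball_sum[OF f] linordered_idom_class.abs_sgn mult.commute)
    also have "\<dots> \<le> norm (\<Sum>i\<in>F. sgn (f (y i)) *\<^sub>R y i)" using dual_ball_le[OF f] by (meson abs_le_D1)
    also have "\<dots> \<le> B * c0_norm F (\<lambda>i. sgn (f (y i)))" by (rule B[OF S])
    also have "\<dots> \<le> \<bar>B\<bar> * c0_norm F (\<lambda>i. sgn (f (y i)))" by (intro mult_right_mono c0_norm_nonneg F(2)) simp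
    also have "\<dots> \<le> \<bar>B\<bar> * 1" using F(2) by (intro mult_left_mono) (auto simp: c0_norm_le_iff abs_sgn_eq)
    finally have "real (Suc m) \<le> \<bar>B\<bar> / e" using e by (simp add: pos_le_divide_eq)
    then show False using m by simp
  qed
qed

lemma operator_sum:
  assumes A: "is_operator (X, Y, A)" and x: "\<And>i. i \<in> I \<Longrightarrow> x i \<in> X"
  shows "(\<Sum>i\<in>I. a i *\<^sub>R x i) \<in> X \<and> A (\<Sum>i\<in>I. a i *\<^sub>R x i) = (\<Sum>i\<in>I. a i *\<^sub>R A (x i))"
proof -
  have X: "subspace X" and add: "\<And>u v. u \<in> X \<Longrightarrow> v \<in> X \<Longrightarrow> A (u + v) = A u + A v"
    and scale: "\<And>c u. u \<in> X \<Longrightarrow> A (c *\<^sub>R u) = c *\<^sub>R A u"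
    using A by (auto simp: is_operator_def)
  have A0: "A 0 = 0" using scale[of 0 0] subspace_0[OF X] by simp
  show ?thesis using x
    by (induction I rule: infinite_finite_induct)
      (auto simp: A0 subspace_0[OF X] add scale subspace_add[OF X] subspace_scale[OF X])
qed

lemma universal_S_Sc0:
  assumes \<sigma>: "fundamental_sequences \<sigma>" and \<xi>: "0 < \<xi>"
  shows "\<exists>u. universal_operator (S_Sc0 \<sigma> \<xi> :: (linf, linf) oper set) (S_Sc0 \<sigma> \<xi> :: ('a::banach, 'b::banach) oper set) u"
proof -
  define z where "z = ubasis (schreier0 \<sigma> \<xi>)"
  have cov: "covering (schreier0 \<sigma> \<xi>)" by (rule covering_schreier0[OF \<sigma>])
  obtain U where U: "is_operator (closure (span (range z)), UNIV :: linf set, U)" "\<And>i. U (z i) = unit_seq i"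
    using operator_on_ubasis[OF cov ubasis_dominates_unit_seq[OF cov]] unfolding z_def by blast
  have "universal_operator (S_Sc0 \<sigma> \<xi>) (S_Sc0 \<sigma> \<xi> :: ('a, 'b) oper set) (closure (span (range z)), UNIV, U)"
  proof (rule universal_operator_from_basis[OF _ _ U])
    show "projections_bounded 1 z" unfolding z_def by (rule projections_bounded_ubasis[OF cov])
    show "z i \<noteq> 0" for i unfolding z_def by (rule ubasis_neq_zero[OF cov])
    show "(closure (span (range z)), UNIV, U) \<notin> S_Sc0 \<sigma> \<xi>"
    proof (rule not_schreier_singularI[OF \<sigma>, where x = z and \<epsilon> = 1])
      fix F a assume F: "F \<in> schreier0 \<sigma> \<xi>"
      show "1 * c0_norm F a \<le> norm (\<Sum>i\<in>F. a i *\<^sub>R U (z i))"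
        using c0_norm_le_norm_unit_seq[OF schreier0_finite[OF \<sigma> F]] by (simp add: U(2))
      show "1 * norm (\<Sum>i\<in>F. a i *\<^sub>R z i) \<le> c0_norm F a"
        using norm_ubasis_sum_le[OF cov F] by (simp add: z_def)
    qed (simp_all add: z_def ubasis_in_space norm_ubasis[OF cov] basic_sequence_ubasis[OF cov] c0_norm_Suc)
  next
    fix X Y and A :: "'a \<Rightarrow> 'b"
    assume A: "is_operator (X, Y, A)" "(X, Y, A) \<notin> S_Sc0 \<sigma> \<xi>"
    from not_schreier_singularD[OF A c0_norm_Suc] obtain x \<epsilon> where x\<epsilon>: "0 < \<epsilon>"
        "\<forall>i. x i \<in> X \<and> norm (x i) = 1" "\<forall>F\<in>schreier0 \<sigma> \<xi>. \<forall>a. \<epsilon> * c0_norm F a \<le> norm (\<Sum>i\<in>F. a i *\<^sub>R A (x i)) \<and>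
          \<epsilon> * norm (\<Sum>i\<in>F. a i *\<^sub>R x i) \<le> c0_norm F a"
      by blast
    have x: "0 < \<epsilon>" "\<And>i. x i \<in> X" "\<And>i. norm (x i) = 1"
      and low: "\<And>F a. F \<in> schreier0 \<sigma> \<xi> \<Longrightarrow> \<epsilon> * c0_norm F a \<le> norm (\<Sum>i\<in>F. a i *\<^sub>R A (x i))"
      and up: "\<And>F a. F \<in> schreier0 \<sigma> \<xi> \<Longrightarrow> \<epsilon> * norm (\<Sum>i\<in>F. a i *\<^sub>R x i) \<le> c0_norm F a"
      using x\<epsilon> by simp_all
    obtain M where M: "\<forall>v\<in>X. norm (A v) \<le> M * norm v" using A(1) by (auto simp: is_operator_def)
    have up': "norm (\<Sum>i\<in>F. a i *\<^sub>R x i) \<le> 1 / \<epsilon> * c0_norm F a" if "F \<in> schreier0 \<sigma> \<xi>" for F a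
      using up[OF that, of a] x(1) by (simp add: field_simps)
    have upA: "norm (\<Sum>i\<in>F. a i *\<^sub>R A (x i)) \<le> \<bar>M\<bar> / \<epsilon> * c0_norm F a" if F: "F \<in> schreier0 \<sigma> \<xi>" for F a
    proof -
      have v: "(\<Sum>i\<in>F. a i *\<^sub>R x i) \<in> X" "A (\<Sum>i\<in>F. a i *\<^sub>R x i) = (\<Sum>i\<in>F. a i *\<^sub>R A (x i))"
        using operator_sum[OF A(1), of F x a] x(2) by auto
      have "norm (\<Sum>i\<in>F. a i *\<^sub>R A (x i)) \<le> M * norm (\<Sum>i\<in>F. a i *\<^sub>R x i)" using M v by metis
      also have "\<dots> \<le> \<bar>M\<bar> * norm (\<Sum>i\<in>F. a i *\<^sub>R x i)" by (intro mult_right_mono) auto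
      also have "\<dots> \<le> \<bar>M\<bar> * (1 / \<epsilon> * c0_norm F a)" by (intro mult_left_mono up'[OF F]) auto
      finally show ?thesis by simp
    qed
    have wn: "(\<lambda>n. f (A (x n))) \<longlonglongrightarrow> 0" if "f \<in> dual_ball" for f
      by (rule weakly_null_if_upper_c0[OF \<sigma> \<xi> that upA])
    have normA: "\<epsilon> \<le> norm (A (x i))" for i
      using low[OF schreier0_singleton[OF \<sigma>], of i "\<lambda>_. 1"] x(1) by (simp add: c0_norm_def)
    \<comment> \<open>The images are weakly null and bounded away from 0, so every late index meets
      the tolerances imposed by \<open>mazur_selection\<close>.\<close>
    have "\<exists>p. (\<forall>n. \<forall>m<n. p m < p n) \<and> (\<forall>n. \<epsilon> \<le> norm (A (x (p n)))) \<and>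
        projections_bounded 2 (\<lambda>n. A (x (p n)))"
    proof (rule mazur_selection[where P = "\<lambda>p n r. \<forall>m<n. p m < r" and val = "\<lambda>r. A (x r)"])
      fix p :: "nat \<Rightarrow> nat" and n :: nat and G :: "('b \<Rightarrow> real) set" and \<theta> :: real
      assume G: "finite G" "G \<subseteq> dual_ball" "0 < \<theta>"
      have "\<forall>\<^sub>F r in sequentially. \<forall>g\<in>G. \<bar>g (A (x r))\<bar> \<le> \<theta>"
        unfolding eventually_ball_finite_distrib[OF G(1)]
      proof
        fix g assume "g \<in> G"
        then have "(\<lambda>n. g (A (x n))) \<longlonglongrightarrow> 0" using wn G(2) by blast
        from tendstoD[OF this G(3)] show "\<forall>\<^sub>F r in sequentially. \<bar>g (A (x r))\<bar> \<le> \<theta>"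
          by (rule eventually_mono) (simp add: dist_real_def)
      qed
      moreover have "\<forall>\<^sub>F r in sequentially. \<forall>m\<in>{..<n}. p m < r"
        unfolding eventually_ball_finite_distrib[OF finite_lessThan] by (simp add: eventually_gt_at_top)
      ultimately have "\<forall>\<^sub>F r in sequentially. (\<forall>g\<in>G. \<bar>g (A (x r))\<bar> \<le> \<theta>) \<and> (\<forall>m\<in>{..<n}. p m < r)"
        by (rule eventually_conj)
      then obtain r where "(\<forall>g\<in>G. \<bar>g (A (x r))\<bar> \<le> \<theta>) \<and> (\<forall>m\<in>{..<n}. p m < r)"
        using eventually_happens trivial_limit_sequentially by blast
      then show "\<exists>r. (\<forall>m<n. p m < r) \<and> \<epsilon> \<le> norm (A (x r)) \<and> (\<forall>g\<in>G. \<bar>g (A (x r))\<bar> \<le> \<theta>)"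
        using normA by (intro exI[of _ r]) simp
    qed (use x(1) in auto)
    then obtain p where p: "strict_mono p" "projections_bounded 2 (\<lambda>n. A (x (p n)))"
      by (auto simp: strict_mono_def)
    have "dominates (1 / \<epsilon>) z (\<lambda>i. x (p i))"
      unfolding z_def
    proof (rule ubasis_dominates[OF cov])
      fix G and a :: "nat \<Rightarrow> real" assume G: "G \<in> schreier0 \<sigma> \<xi>"
      have inj: "inj_on p G" using inj_on_subset[OF strict_mono_imp_inj_on[OF p(1)] subset_UNIV] .
      define b where "b = a \<circ> the_inv p"
      have b: "b (p i) = a i" for i
        by (simp add: b_def the_inv_f_f[OF strict_mono_imp_inj_on[OF p(1)]])
      have "norm (\<Sum>i\<in>p ` G. b i *\<^sub>R x i) \<le> 1 / \<epsilon> * c0_norm (p ` G) b"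
        by (rule up'[OF schreier0_subsequence[OF \<sigma> G p(1)]])
      then show "norm (\<Sum>i\<in>G. a i *\<^sub>R x (p i)) \<le> 1 / \<epsilon> * c0_norm G a"
        by (simp add: sum.reindex[OF inj] b c0_norm_def image_image)
    qed (use x(1) in simp)
    moreover have "dominates (4 / \<epsilon>) (\<lambda>i. A (x (p i))) unit_seq"
      by (rule dominates_unit_seq_if_projections_bounded[OF p(2) x(1) normA])
    ultimately show "\<exists>x K K'. (\<forall>i. x i \<in> X) \<and> dominates K z x \<and> 0 \<le> K' \<and> dominates K' (\<lambda>i. A (x i)) unit_seq"
      using x(1,2) by (intro exI[of _ "\<lambda>i. x (p i)"] exI[of _ "1 / \<epsilon>"] exI[of _ "4 / \<epsilon>"]) simp
  qed
  then show ?thesis by blast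
qed

section \<open>The class for \<open>\<ell>\<^sub>1\<close>\<close>

text \<open>Up to a factor \<open>2\<close> this is the basis of the Schreier space: testing sets instead of
  signed sets loses at most half of the norm because the Schreier families are hereditary.\<close>

definition schreier_basis :: "(omega1 \<Rightarrow> nat \<Rightarrow> omega1) \<Rightarrow> omega1 \<Rightarrow> nat \<Rightarrow> linf" where
  "schreier_basis \<sigma> \<xi> n =
     linf_of (\<lambda>k. if set_decode k \<in> schreier0 \<sigma> \<xi> \<and> n \<in> set_decode k then 1 else 0)"

lemma coord_sum_schreier_basis:
  assumes "finite I"
  shows "coord (\<Sum>i\<in>I. a i *\<^sub>R schreier_basis \<sigma> \<xi> i) k =
    (if set_decode k \<in> schreier0 \<sigma> \<xi> then \<Sum>i\<in>I \<inter> set_decode k. a i else 0)"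
proof -
  have "coord (schreier_basis \<sigma> \<xi> n) k = (if set_decode k \<in> schreier0 \<sigma> \<xi> \<and> n \<in> set_decode k then 1 else 0)" for n
    unfolding schreier_basis_def by (rule coord_linf_of[where B = 1]) simp
  then have "coord (\<Sum>i\<in>I. a i *\<^sub>R schreier_basis \<sigma> \<xi> i) k =
      (\<Sum>i\<in>I. if i \<in> set_decode k \<and> set_decode k \<in> schreier0 \<sigma> \<xi> then a i else 0)"
    unfolding coord_sum by (intro sum.cong) auto
  then show ?thesis using assms by (simp add: sum.inter_restrict)
qed

lemma norm_schreier_basis_ge:
  assumes \<sigma>: "fundamental_sequences \<sigma>" and "finite I" "F \<in> schreier0 \<sigma> \<xi>"
  shows "\<bar>\<Sum>i\<in>I \<inter> F. a i\<bar> \<le> norm (\<Sum>i\<in>I. a i *\<^sub>R schreier_basis \<sigma> \<xi> i)"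
proof -
  have "set_decode (set_encode F) = F" using schreier0_finite[OF \<sigma> assms(3)] by (rule set_encode_inverse)
  then have "coord (\<Sum>i\<in>I. a i *\<^sub>R schreier_basis \<sigma> \<xi> i) (set_encode F) = (\<Sum>i\<in>I \<inter> F. a i)"
    using coord_sum_schreier_basis[OF assms(2), of a \<sigma> \<xi> "set_encode F"] assms(3) by simp
  then show ?thesis using abs_coord_le by metis
qed

lemma norm_schreier_basis_le:
  assumes "finite I" "0 \<le> b" "\<And>F. F \<in> schreier0 \<sigma> \<xi> \<Longrightarrow> \<bar>\<Sum>i\<in>I \<inter> F. a i\<bar> \<le> b"
  shows "norm (\<Sum>i\<in>I. a i *\<^sub>R schreier_basis \<sigma> \<xi> i) \<le> b"
  using assms by (intro linf_norm_le) (simp add: coord_sum_schreier_basis)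

lemma norm_schreier_basis_le_l1:
  assumes "finite I"
  shows "norm (\<Sum>i\<in>I. a i *\<^sub>R schreier_basis \<sigma> \<xi> i) \<le> (\<Sum>i\<in>I. \<bar>a i\<bar>)"
proof (rule norm_schreier_basis_le[OF assms])
  show "\<bar>\<Sum>i\<in>I \<inter> F. a i\<bar> \<le> (\<Sum>i\<in>I. \<bar>a i\<bar>)" for F
    by (rule order_trans[OF sum_abs sum_mono2]) (use assms in auto)
qed (simp add: sum_nonneg)

lemma l1_norm_le_schreier_basis:
  assumes \<sigma>: "fundamental_sequences \<sigma>" and F: "F \<in> schreier0 \<sigma> \<xi>"
  shows "1 / 2 * l1_norm F a \<le> norm (\<Sum>i\<in>F. a i *\<^sub>R schreier_basis \<sigma> \<xi> i)"
proof -
  have fin: "finite F" by (rule schreier0_finite[OF \<sigma> F])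
  define P where "P = {i\<in>F. 0 \<le> a i}"
  define N where "N = {i\<in>F. a i < 0}"
  have FPN: "F = P \<union> N" "P \<inter> N = {}" by (auto simp: P_def N_def)
  have le: "\<bar>\<Sum>i\<in>G. a i\<bar> \<le> norm (\<Sum>i\<in>F. a i *\<^sub>R schreier_basis \<sigma> \<xi> i)" if "G \<subseteq> F" for G
    using norm_schreier_basis_ge[OF \<sigma> fin schreier0_hereditary[OF \<sigma> F that], of a] that by (simp add: Int_absorb1)
  have finPN: "finite P" "finite N" using fin by (auto simp: P_def N_def)
  have "l1_norm F a = (\<Sum>i\<in>P. \<bar>a i\<bar>) + (\<Sum>i\<in>N. \<bar>a i\<bar>)"
    unfolding l1_norm_def by (subst FPN(1)) (rule sum.union_disjoint[OF finPN FPN(2)])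
  also have "(\<Sum>i\<in>P. \<bar>a i\<bar>) = (\<Sum>i\<in>P. a i)" by (intro sum.cong) (auto simp: P_def)
  also have "(\<Sum>i\<in>N. \<bar>a i\<bar>) = - (\<Sum>i\<in>N. a i)" unfolding sum_negf[symmetric] by (intro sum.cong) (auto simp: N_def)
  finally show ?thesis using le[of P] le[of N] FPN(1) by fastforce
qed

text \<open>A Schreier set that tests the combination is first reduced to the indices with
  nonnegative coefficients. A functional that is at least \<open>\<epsilon>\<close> there and tiny
  elsewhere bounds their sum by the norm, up to an error proportional to \<open>s\<close>, because
  \<open>s\<close> bounds every coefficient. Passing to \<open>- a\<close> covers the other
  sign.\<close>

lemma dominates_schreier_basis:
  fixes y :: "nat \<Rightarrow> 'b::real_normed_vector"
  assumes \<sigma>: "fundamental_sequences \<sigma>" and \<epsilon>: "0 < \<epsilon>"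
    and supp: "\<And>I n. I \<in> schreier0 \<sigma> \<xi> \<Longrightarrow>
      \<exists>f\<in>dual_ball. (\<forall>i\<in>I. \<epsilon> \<le> f (y i)) \<and> (\<forall>i<n. i \<notin> I \<longrightarrow> \<bar>f (y i)\<bar> \<le> \<epsilon> / 8 * (1 / 2) ^ i)"
  shows "dominates (2 / \<epsilon>) y (schreier_basis \<sigma> \<xi>)"
  unfolding dominates_def
proof (intro allI)
  fix a and n :: nat
  define s where "s = norm (\<Sum>i<n. a i *\<^sub>R schreier_basis \<sigma> \<xi> i)"
  define v where "v = norm (\<Sum>i<n. a i *\<^sub>R y i)"
  have s0: "0 \<le> s" by (simp add: s_def)
  have as: "\<bar>a i\<bar> \<le> s" if "i < n" for i
    using norm_schreier_basis_ge[OF \<sigma>, of "{..<n}" "{i}" \<xi> a] schreier0_singleton[OF \<sigma>] that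
    by (simp add: s_def Int_absorb1)
  \<comment> \<open>The tolerances sum to at most a quarter of \<open>\<epsilon>\<close>, so the
    error \<open>s * (\<epsilon> / 4)\<close> can be absorbed by \<open>\<epsilon> * s\<close> at
    the end.\<close>
  have geo: "(\<Sum>i<n. \<epsilon> / 8 * (1 / 2) ^ i) \<le> \<epsilon> / 4"
  proof -
    have "(\<Sum>i<n. (1 / 2) ^ i) = (2 - 2 * (1 / 2) ^ n :: real)" by (subst sum_gp_strict) (simp add: field_simps)
    then have "(\<Sum>i<n. (1 / 2) ^ i) \<le> (2 :: real)" by simp
    then have "\<epsilon> / 8 * (\<Sum>i<n. (1 / 2) ^ i) \<le> \<epsilon> / 8 * 2" using \<epsilon> by (intro mult_left_mono) auto
    then show ?thesis by (simp add: sum_distrib_left)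
  qed
  have pos: "\<epsilon> * (\<Sum>i\<in>I. b i) \<le> norm (\<Sum>i<n. b i *\<^sub>R y i) + s * (\<epsilon> / 4)"
    if I: "I \<in> schreier0 \<sigma> \<xi>" "I \<subseteq> {..<n}" "\<forall>i\<in>I. 0 \<le> b i" and bs: "\<forall>i<n. \<bar>b i\<bar> \<le> s" for I b
  proof -
    obtain f where f: "f \<in> dual_ball" "\<forall>i\<in>I. \<epsilon> \<le> f (y i)" "\<forall>i<n. i \<notin> I \<longrightarrow> \<bar>f (y i)\<bar> \<le> \<epsilon> / 8 * (1 / 2) ^ i"
      using supp[OF I(1)] by blast
    have 1: "\<epsilon> * (\<Sum>i\<in>I. b i) \<le> (\<Sum>i\<in>I. b i * f (y i))"
      unfolding sum_distrib_left using f(2) I(3) by (intro sum_mono) (metis mult.commute mult_left_mono)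
    have 2: "(\<Sum>i<n. b i * f (y i)) = (\<Sum>i\<in>{..<n} - I. b i * f (y i)) + (\<Sum>i\<in>I. b i * f (y i))"
      using sum.subset_diff[OF I(2), of "\<lambda>i. b i * f (y i)"] by simp
    have 3: "(\<Sum>i<n. b i * f (y i)) \<le> norm (\<Sum>i<n. b i *\<^sub>R y i)"
      using dual_ball_le[OF f(1), of "\<Sum>i<n. b i *\<^sub>R y i"] by (simp add: dual_ball_sum[OF f(1)])
    have 4: "- (\<Sum>i\<in>{..<n} - I. b i * f (y i)) \<le> s * (\<epsilon> / 4)"
    proof -
      have "- (\<Sum>i\<in>{..<n} - I. b i * f (y i)) \<le> (\<Sum>i\<in>{..<n} - I. \<bar>b i * f (y i)\<bar>)"
        by (rule order_trans[OF abs_ge_minus_self sum_abs])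
      also have "\<dots> \<le> (\<Sum>i\<in>{..<n} - I. s * (\<epsilon> / 8 * (1 / 2) ^ i))"
      proof (rule sum_mono)
        fix i assume "i \<in> {..<n} - I"
        then have "\<bar>f (y i)\<bar> \<le> \<epsilon> / 8 * (1 / 2) ^ i" "\<bar>b i\<bar> \<le> s" using f(3) bs by auto
        then show "\<bar>b i * f (y i)\<bar> \<le> s * (\<epsilon> / 8 * (1 / 2) ^ i)"
          unfolding abs_mult using s0 by (intro mult_mono) auto
      qed
      also have "\<dots> \<le> (\<Sum>i<n. s * (\<epsilon> / 8 * (1 / 2) ^ i))"
        using s0 \<epsilon> by (intro sum_mono2) auto
      also have "\<dots> = s * (\<Sum>i<n. \<epsilon> / 8 * (1 / 2) ^ i)" by (rule sum_distrib_left[symmetric])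
      also have "\<dots> \<le> s * (\<epsilon> / 4)" by (rule mult_left_mono[OF geo s0])
      finally show ?thesis .
    qed
    show ?thesis using 1 2 3 4 by linarith
  qed
  have side: "\<epsilon> * (\<Sum>i\<in>{..<n} \<inter> F. b i) \<le> norm (\<Sum>i<n. b i *\<^sub>R y i) + s * (\<epsilon> / 4)"
    if F: "F \<in> schreier0 \<sigma> \<xi>" and bs: "\<forall>i<n. \<bar>b i\<bar> \<le> s" for F b
  proof -
    define I where "I = {i\<in>{..<n} \<inter> F. 0 \<le> b i}"
    have "(\<Sum>i\<in>{..<n} \<inter> F. b i) \<le> (\<Sum>i\<in>{..<n} \<inter> F. if 0 \<le> b i then b i else 0)" by (intro sum_mono) auto
    also have "\<dots> = (\<Sum>i\<in>I. b i)" unfolding I_def by (rule sum.inter_filter[symmetric]) simp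
    finally have "\<epsilon> * (\<Sum>i\<in>{..<n} \<inter> F. b i) \<le> \<epsilon> * (\<Sum>i\<in>I. b i)" using \<epsilon> by simp
    also have "\<dots> \<le> norm (\<Sum>i<n. b i *\<^sub>R y i) + s * (\<epsilon> / 4)"
      by (rule pos[OF schreier0_hereditary[OF \<sigma> F] _ _ bs]) (auto simp: I_def)
    finally show ?thesis .
  qed
  have "s \<le> (v + s * (\<epsilon> / 4)) / \<epsilon>"
  proof -
    have "norm (\<Sum>i<n. a i *\<^sub>R schreier_basis \<sigma> \<xi> i) \<le> (v + s * (\<epsilon> / 4)) / \<epsilon>"
    proof (rule norm_schreier_basis_le)
    fix F assume F: "F \<in> schreier0 \<sigma> \<xi>"
    have "\<epsilon> * (\<Sum>i\<in>{..<n} \<inter> F. a i) \<le> v + s * (\<epsilon> / 4)" using side[OF F, of a] as by (simp add: v_def)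
    moreover have "\<epsilon> * (\<Sum>i\<in>{..<n} \<inter> F. - a i) \<le> v + s * (\<epsilon> / 4)"
      using side[OF F, of "\<lambda>i. - a i"] as by (simp add: v_def sum_negf)
    ultimately have "\<epsilon> * \<bar>\<Sum>i\<in>{..<n} \<inter> F. a i\<bar> \<le> v + s * (\<epsilon> / 4)" by (simp add: sum_negf abs_if)
    then show "\<bar>\<Sum>i\<in>{..<n} \<inter> F. a i\<bar> \<le> (v + s * (\<epsilon> / 4)) / \<epsilon>" using \<epsilon> by (simp add: pos_le_divide_eq mult.commute)
    qed (use \<epsilon> s0 in \<open>auto simp: v_def\<close>)
    then show ?thesis unfolding s_def[symmetric] .
  qed
  then have "3 * (\<epsilon> * s) \<le> 4 * v" using \<epsilon> by (simp add: field_simps)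
  then have "\<epsilon> * s \<le> 2 * v" using norm_ge_zero[of "\<Sum>i<n. a i *\<^sub>R y i"] unfolding v_def by linarith
  then have "s \<le> 2 / \<epsilon> * v" using \<epsilon> by (simp add: field_simps)
  then show "norm (\<Sum>i<n. a i *\<^sub>R schreier_basis \<sigma> \<xi> i) \<le> 2 / \<epsilon> * norm (\<Sum>i<n. a i *\<^sub>R y i)"
    by (simp add: s_def v_def)
qed

lemma covering_singletons: "covering (range (\<lambda>n. {n}))"
  by (auto simp: covering_def)

text \<open>For the family of singletons \<^const>\<open>ubasis\<close> is the unit vector basis of \<open>\<ell>\<^sub>1\<close>.\<close>

lemma ubasis_singletons_dominates:
  fixes x :: "nat \<Rightarrow> 'a::real_normed_vector"
  assumes K: "0 < K" "\<And>i. norm (x i) \<le> K"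
  shows "dominates K (ubasis (range (\<lambda>n. {n}))) x"
proof (rule ubasis_dominates[OF covering_singletons K(1)])
  fix G :: "nat set" and a assume "G \<in> range (\<lambda>n. {n})"
  then obtain n where "G = {n}" by auto
  then show "norm (\<Sum>i\<in>G. a i *\<^sub>R x i) \<le> K * c0_norm G a"
    using mult_left_mono[OF K(2)[of n], of "\<bar>a n\<bar>"] by (simp add: c0_norm_def mult.commute)
qed

text \<open>Placing \<open>a i / 2\<close> and \<open>- a i / 2\<close> at the two indices of each
  difference keeps the sum of the absolute values, and by doubling all these indices together again
  form a Schreier set.\<close>

lemma l1_lower_differences:
  fixes y :: "nat \<Rightarrow> 'b::real_normed_vector"
  assumes \<sigma>: "fundamental_sequences \<sigma>" and \<xi>: "0 < \<xi>" and p: "strict_mono p"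
    and low: "\<And>F a. F \<in> schreier0 \<sigma> \<xi> \<Longrightarrow> \<epsilon> * l1_norm F a \<le> norm (\<Sum>i\<in>F. a i *\<^sub>R y i)"
    and F: "F \<in> schreier0 \<sigma> \<xi>"
  shows "\<epsilon> * l1_norm F a \<le> norm (\<Sum>i\<in>F. a i *\<^sub>R ((1 / 2) *\<^sub>R (y (p (2 * i + 1)) - y (p (2 * i + 2)))))"
proof -
  define \<alpha> where "\<alpha> i = p (2 * i + 1)" for i
  define \<beta> where "\<beta> i = p (2 * i + 2)" for i
  define D where "D = \<alpha> ` F \<union> \<beta> ` F"
  have D: "D \<in> schreier0 \<sigma> \<xi>"
    using schreier0_doubling[OF \<sigma> \<xi> F p] by (simp add: D_def \<alpha>_def[abs_def] \<beta>_def[abs_def])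
  have peq: "p i = p j \<longleftrightarrow> i = j" for i j using strict_mono_eq[OF p] by blast
  have inj: "inj \<alpha>" "inj \<beta>" by (auto simp: inj_on_def \<alpha>_def \<beta>_def peq)
  have ne: "\<alpha> i \<noteq> \<beta> j" for i j
  proof
    assume "\<alpha> i = \<beta> j"
    then have "2 * i + 1 = 2 * j + 2" by (simp only: \<alpha>_def \<beta>_def peq)
    then show False by presburger
  qed
  have fin: "finite F" by (rule schreier0_finite[OF \<sigma> F])
  define b where "b k = (if k \<in> range \<alpha> then a (the_inv \<alpha> k) / 2 else - a (the_inv \<beta> k) / 2)" for k
  have b: "b (\<alpha> i) = a i / 2" "b (\<beta> i) = - a i / 2" for i
    using ne by (auto simp: b_def the_inv_f_f inj dest: sym)
  have disj: "\<alpha> ` F \<inter> \<beta> ` F = {}" using ne by auto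
  have inj': "inj_on \<alpha> F" "inj_on \<beta> F" using inj by (auto intro: inj_on_subset)
  have split1: "(\<Sum>k\<in>D. b k *\<^sub>R y k) = (\<Sum>i\<in>F. b (\<alpha> i) *\<^sub>R y (\<alpha> i)) + (\<Sum>i\<in>F. b (\<beta> i) *\<^sub>R y (\<beta> i))"
    and split2: "(\<Sum>k\<in>D. \<bar>b k\<bar>) = (\<Sum>i\<in>F. \<bar>b (\<alpha> i)\<bar>) + (\<Sum>i\<in>F. \<bar>b (\<beta> i)\<bar>)"
    unfolding D_def using fin disj by (simp_all add: sum.union_disjoint sum.reindex inj')
  have "(\<Sum>k\<in>D. b k *\<^sub>R y k) = (\<Sum>i\<in>F. a i *\<^sub>R ((1 / 2) *\<^sub>R (y (\<alpha> i) - y (\<beta> i))))"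
    unfolding split1 b sum.distrib[symmetric] by (intro sum.cong) (auto simp: scaleR_diff_right)
  moreover have "l1_norm D b = l1_norm F a"
    unfolding l1_norm_def split2 b sum.distrib[symmetric] by (intro sum.cong) auto
  ultimately show ?thesis using low[OF D, of b] by (simp add: \<alpha>_def \<beta>_def)
qed

lemma universal_S_Sl1:
  assumes \<sigma>: "fundamental_sequences \<sigma>" and \<xi>: "0 < \<xi>"
  shows "\<exists>u. universal_operator (S_Sl1 \<sigma> \<xi> :: (linf, linf) oper set) (S_Sl1 \<sigma> \<xi> :: ('a::banach, 'b::banach) oper set) u"
proof -
  define z where "z = ubasis (range (\<lambda>n. {n}))"
  let ?w = "schreier_basis \<sigma> \<xi>"
  have "norm (?w i) \<le> 1" for i
    using norm_schreier_basis_le_l1[of "{i}" "\<lambda>_. 1" \<sigma> \<xi>] by simp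
  then obtain U where U: "is_operator (closure (span (range z)), UNIV :: linf set, U)" "\<And>i. U (z i) = ?w i"
    using operator_on_ubasis[OF covering_singletons ubasis_singletons_dominates[of 1 ?w]] unfolding z_def by auto
  have "universal_operator (S_Sl1 \<sigma> \<xi>) (S_Sl1 \<sigma> \<xi> :: ('a, 'b) oper set) (closure (span (range z)), UNIV, U)"
  proof (rule universal_operator_from_basis[OF _ _ U])
    show "projections_bounded 1 z" unfolding z_def by (rule projections_bounded_ubasis[OF covering_singletons])
    show "z i \<noteq> 0" for i unfolding z_def by (rule ubasis_neq_zero[OF covering_singletons])
    show "(closure (span (range z)), UNIV, U) \<notin> S_Sl1 \<sigma> \<xi>"
    proof (rule not_schreier_singularI[OF \<sigma>, where x = z and \<epsilon> = "1 / 2"])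
      fix F a assume F: "F \<in> schreier0 \<sigma> \<xi>"
      show "1 / 2 * l1_norm F a \<le> norm (\<Sum>i\<in>F. a i *\<^sub>R U (z i))"
        using l1_norm_le_schreier_basis[OF \<sigma> F, of a] by (simp add: U(2))
      have "norm (\<Sum>i\<in>F. a i *\<^sub>R z i) \<le> (\<Sum>i\<in>F. \<bar>a i\<bar>)"
        by (rule order_trans[OF norm_sum]) (simp add: z_def norm_ubasis[OF covering_singletons])
      then show "1 / 2 * norm (\<Sum>i\<in>F. a i *\<^sub>R z i) \<le> l1_norm F a"
        using norm_ge_zero[of "\<Sum>i\<in>F. a i *\<^sub>R z i"] unfolding l1_norm_def by linarith
    qed (simp_all add: z_def ubasis_in_space norm_ubasis[OF covering_singletons]
        basic_sequence_ubasis[OF covering_singletons] l1_norm_Suc)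
  next
    fix X Y and A :: "'a \<Rightarrow> 'b"
    assume A: "is_operator (X, Y, A)" "(X, Y, A) \<notin> S_Sl1 \<sigma> \<xi>"
    from not_schreier_singularD[OF A l1_norm_Suc] obtain x \<epsilon> where x\<epsilon>: "0 < \<epsilon>"
        "\<forall>i. x i \<in> X \<and> norm (x i) = 1" "\<forall>F\<in>schreier0 \<sigma> \<xi>. \<forall>a. \<epsilon> * l1_norm F a \<le> norm (\<Sum>i\<in>F. a i *\<^sub>R A (x i)) \<and>
          \<epsilon> * norm (\<Sum>i\<in>F. a i *\<^sub>R x i) \<le> l1_norm F a"
      by blast
    have x: "0 < \<epsilon>" "\<And>i. x i \<in> X" "\<And>i. norm (x i) = 1"
      and low: "\<And>F a. F \<in> schreier0 \<sigma> \<xi> \<Longrightarrow> \<epsilon> * l1_norm F a \<le> norm (\<Sum>i\<in>F. a i *\<^sub>R A (x i))"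
      using x\<epsilon> by simp_all
    have X: "subspace X" and scale: "\<And>c u. u \<in> X \<Longrightarrow> A (c *\<^sub>R u) = c *\<^sub>R A u"
      and add: "\<And>u v. u \<in> X \<Longrightarrow> v \<in> X \<Longrightarrow> A (u + v) = A u + A v"
      using A(1) by (auto simp: is_operator_def)
    obtain M where M: "\<forall>v\<in>X. norm (A v) \<le> M * norm v" using A(1) by (auto simp: is_operator_def)
    have "norm (A (x n)) \<le> M" for n using M x(2,3) by fastforce
    from rosenthal[of "\<lambda>n. A (x n)", OF this] obtain p :: "nat \<Rightarrow> nat" where p: "strict_mono p"
      and dich: "(\<exists>c>0. \<forall>a n. c * (\<Sum>i<n. \<bar>a i\<bar>) \<le> norm (\<Sum>i<n. a i *\<^sub>R A (x (p i)))) \<or>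
        (\<forall>f\<in>dual_ball. convergent (\<lambda>i. f (A (x (p i)))))"
      by blast
    have "\<exists>v K'. (\<forall>i. v i \<in> X \<and> norm (v i) \<le> 1) \<and> 0 \<le> K' \<and> dominates K' (\<lambda>i. A (v i)) ?w"
      using dich
    proof
      assume "\<exists>c>0. \<forall>a n. c * (\<Sum>i<n. \<bar>a i\<bar>) \<le> norm (\<Sum>i<n. a i *\<^sub>R A (x (p i)))"
      then obtain c where c: "0 < c" "\<forall>a n. c * (\<Sum>i<n. \<bar>a i\<bar>) \<le> norm (\<Sum>i<n. a i *\<^sub>R A (x (p i)))" by blast
      have "norm (\<Sum>i<n. a i *\<^sub>R ?w i) \<le> 1 / c * norm (\<Sum>i<n. a i *\<^sub>R A (x (p i)))" for a and n :: nat
      proof -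
        have "norm (\<Sum>i<n. a i *\<^sub>R ?w i) \<le> (\<Sum>i<n. \<bar>a i\<bar>)" by (rule norm_schreier_basis_le_l1) simp
        also have "\<dots> \<le> 1 / c * norm (\<Sum>i<n. a i *\<^sub>R A (x (p i)))"
          using c(2)[rule_format, of a n] c(1) by (simp add: pos_le_divide_eq mult.commute)
        finally show ?thesis .
      qed
      then have "dominates (1 / c) (\<lambda>i. A (x (p i))) ?w" by (simp add: dominates_def)
      then show ?thesis using x c(1) by (intro exI[of _ "\<lambda>i. x (p i)"] exI[of _ "1 / c"]) simp
    next
      assume conv: "\<forall>f\<in>dual_ball. convergent (\<lambda>i. f (A (x (p i))))"
      \<comment> \<open>The factor keeps the differences in the unit ball, so that
        \<open>ubasis_singletons_dominates\<close> applies with constant 1.\<close>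
      define v where "v i = (1 / 2) *\<^sub>R (x (p (2 * i + 1)) - x (p (2 * i + 2)))" for i
      have v: "v i \<in> X" "norm (v i) \<le> 1" for i
      proof -
        show "v i \<in> X" unfolding v_def by (intro subspace_scale subspace_diff X x(2))
        show "norm (v i) \<le> 1"
          using norm_triangle_ineq4[of "x (p (2 * i + 1))" "x (p (2 * i + 2))"] x(3) by (simp add: v_def)
      qed
      have Adiff: "A (u - u') = A u - A u'" if "u \<in> X" "u' \<in> X" for u u'
        using add[of u "- 1 *\<^sub>R u'"] scale[of u' "- 1"] subspace_neg[OF X] that by simp
      have Av: "A (v i) = (1 / 2) *\<^sub>R (A (x (p (2 * i + 1))) - A (x (p (2 * i + 2))))" for i
        unfolding v_def using x(2) by (simp add: scale Adiff subspace_diff[OF X])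
      have lowv: "\<epsilon> * l1_norm F a \<le> norm (\<Sum>i\<in>F. a i *\<^sub>R A (v i))" if "F \<in> schreier0 \<sigma> \<xi>" for F a
        unfolding Av by (rule l1_lower_differences[OF \<sigma> \<xi> p low that])
      have wn: "(\<lambda>n. f (A (v n))) \<longlonglongrightarrow> 0" if f: "f \<in> dual_ball" for f
      proof -
        obtain l where l: "(\<lambda>i. f (A (x (p i)))) \<longlonglongrightarrow> l" using conv f by (auto simp: convergent_def)
        have "(\<lambda>i. f (A (x (p (2 * i + 1))))) \<longlonglongrightarrow> l"
          using LIMSEQ_subseq_LIMSEQ[OF l, of "\<lambda>i. 2 * i + 1"] by (simp add: o_def strict_mono_def)
        moreover have "(\<lambda>i. f (A (x (p (2 * i + 2))))) \<longlonglongrightarrow> l"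
          using LIMSEQ_subseq_LIMSEQ[OF l, of "\<lambda>i. 2 * i + 2"] by (simp add: o_def strict_mono_def)
        ultimately have lim: "(\<lambda>i. (1 / 2) * (f (A (x (p (2 * i + 1)))) - f (A (x (p (2 * i + 2)))))) \<longlonglongrightarrow> (1 / 2) * (l - l)"
          by (intro tendsto_intros)
        have eq: "f (A (v i)) = (1 / 2) * (f (A (x (p (2 * i + 1)))) - f (A (x (p (2 * i + 2)))))" for i
          unfolding Av using dual_ball_linear[OF f] by (simp add: linear_cmul linear_diff)
        show ?thesis using lim unfolding eq[symmetric] by simp
      qed
      have \<delta>: "0 < \<epsilon> / 8 * (1 / 2) ^ i" for i :: nat using x(1) by simp
      obtain q where q: "strict_mono q" and supp: "\<forall>I n. finite I \<and> (\<exists>f\<in>dual_ball. \<forall>i\<in>I. \<epsilon> \<le> f (A (v (q i)))) \<longrightarrow>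
          (\<exists>f\<in>dual_ball. (\<forall>i\<in>I. \<epsilon> \<le> f (A (v (q i)))) \<and> (\<forall>i<n. i \<notin> I \<longrightarrow> \<bar>f (A (v (q i)))\<bar> \<le> \<epsilon> / 8 * (1 / 2) ^ i))"
        using positive_suppression[of "\<lambda>i. A (v i)" "\<lambda>i. \<epsilon> / 8 * (1 / 2) ^ i" \<epsilon>, OF wn \<delta>] by blast
      have "dominates (2 / \<epsilon>) (\<lambda>i. A (v (q i))) ?w"
      proof (rule dominates_schreier_basis[OF \<sigma> x(1)])
        fix I and n :: nat assume I: "I \<in> schreier0 \<sigma> \<xi>"
        have fin: "finite I" by (rule schreier0_finite[OF \<sigma> I])
        have inj: "inj_on q I" using inj_on_subset[OF strict_mono_imp_inj_on[OF q] subset_UNIV] .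
        \<comment> \<open>The image of \<open>I\<close> under \<open>q\<close> is again a Schreier
          set, so the lower estimate lets Hahn-Banach prescribe the value \<open>\<epsilon>\<close>
          at all its points.\<close>
        have "\<exists>g\<in>dual_ball. \<forall>i\<in>I. g (A (v (q i))) = \<epsilon>"
        proof (rule functional_on_finite[OF fin])
          fix a :: "nat \<Rightarrow> real"
          define b where "b = a \<circ> the_inv q"
          have b: "b (q i) = a i" for i
            by (simp add: b_def the_inv_f_f[OF strict_mono_imp_inj_on[OF q]])
          have "\<bar>\<Sum>i\<in>I. a i * \<epsilon>\<bar> \<le> \<epsilon> * (\<Sum>i\<in>I. \<bar>a i\<bar>)"
            using sum_abs[of "\<lambda>i. a i * \<epsilon>" I] x(1) by (simp add: abs_mult sum_distrib_left mult.commute)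
          also have "\<dots> = \<epsilon> * l1_norm (q ` I) b" by (simp add: l1_norm_def sum.reindex[OF inj] b)
          also have "\<dots> \<le> norm (\<Sum>i\<in>q ` I. b i *\<^sub>R A (v i))" by (rule lowv[OF schreier0_subsequence[OF \<sigma> I q]])
          also have "\<dots> = norm (\<Sum>i\<in>I. a i *\<^sub>R A (v (q i)))" by (simp add: sum.reindex[OF inj] b)
          finally show "\<bar>\<Sum>i\<in>I. a i * \<epsilon>\<bar> \<le> norm (\<Sum>i\<in>I. a i *\<^sub>R A (v (q i)))" .
        qed
        then have "\<exists>g\<in>dual_ball. \<forall>i\<in>I. \<epsilon> \<le> g (A (v (q i)))" by force
        then show "\<exists>f\<in>dual_ball. (\<forall>i\<in>I. \<epsilon> \<le> f (A (v (q i)))) \<and>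
            (\<forall>i<n. i \<notin> I \<longrightarrow> \<bar>f (A (v (q i)))\<bar> \<le> \<epsilon> / 8 * (1 / 2) ^ i)"
          using supp fin by blast
      qed
      then show ?thesis using v x(1) by (intro exI[of _ "\<lambda>i. v (q i)"] exI[of _ "2 / \<epsilon>"]) simp
    qed
    then obtain v K' where v: "\<forall>i. v i \<in> X \<and> norm (v i) \<le> 1" "0 \<le> K'" "dominates K' (\<lambda>i. A (v i)) ?w" by blast
    have "dominates 1 z v" unfolding z_def using v(1) by (intro ubasis_singletons_dominates) auto
    then show "\<exists>x K K'. (\<forall>i. x i \<in> X) \<and> dominates K z x \<and> 0 \<le> K' \<and> dominates K' (\<lambda>i. A (x i)) ?w"
      using v by blast
  qed
  then show ?thesis by blast
qed

section \<open>Ordinal arithmetic\<close>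

lemma less_osupD: "\<delta> < osup A \<Longrightarrow> \<exists>a\<in>A. \<delta> < a"
  using osup_least[of A \<delta>] by (meson not_le)

lemma oadd_mono_right: "\<beta> \<le> \<gamma> \<Longrightarrow> oadd \<alpha> \<beta> \<le> oadd \<alpha> \<gamma>"
  by (metis oadd_upper le_less)

lemma oadd_leI:
  assumes "\<alpha> \<le> u" "\<And>\<gamma>. \<gamma> < \<beta> \<Longrightarrow> oadd \<alpha> \<gamma> < u"
  shows "oadd \<alpha> \<beta> \<le> u"
proof (cases "\<beta> = 0")
  case False
  have "osuc (oadd \<alpha> \<gamma>) \<le> u" if "\<gamma> < \<beta>" for \<gamma>
    using assms(2)[OF that] less_osuc_iff by (meson not_le)
  then show ?thesis using False by (subst oadd.simps) (auto intro!: osup_least)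
qed (use assms(1) in \<open>simp add: oadd_zero\<close>)

lemma less_oaddD:
  assumes "\<delta> < oadd \<alpha> \<beta>" "\<beta> \<noteq> 0"
  shows "\<exists>\<gamma><\<beta>. \<delta> \<le> oadd \<alpha> \<gamma>"
proof -
  have "oadd \<alpha> \<beta> = osup ((\<lambda>\<gamma>. osuc (oadd \<alpha> \<gamma>)) ` {..<\<beta>})"
    using oadd.simps[of \<alpha> \<beta>] assms(2) by simp
  then obtain \<gamma> where "\<gamma> < \<beta>" "\<delta> < osuc (oadd \<alpha> \<gamma>)" using assms(1) less_osupD by fastforce
  then show ?thesis by (auto simp: less_osuc_iff)
qed

lemma le_oadd: "\<alpha> \<le> oadd \<alpha> \<beta>"
  using oadd_mono_right[of 0 \<beta> \<alpha>] by (simp add: oadd_zero)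

lemma oadd_mono_left: "\<alpha> \<le> \<alpha>' \<Longrightarrow> oadd \<alpha> \<beta> \<le> oadd \<alpha>' \<beta>"
proof (induction \<beta> rule: less_induct)
  case (less \<beta>)
  show ?case
  proof (rule oadd_leI)
    show "\<alpha> \<le> oadd \<alpha>' \<beta>" using less.prems le_oadd order_trans by blast
    show "oadd \<alpha> \<gamma> < oadd \<alpha>' \<beta>" if "\<gamma> < \<beta>" for \<gamma>
      using less.IH[OF that less.prems] oadd_upper[OF that] by (rule order_le_less_trans)
  qed
qed

lemma oadd_assoc_le: "oadd (oadd \<alpha> \<beta>) \<gamma> \<le> oadd \<alpha> (oadd \<beta> \<gamma>)"
proof (induction \<gamma> rule: less_induct)
  case (less \<gamma>)
  show ?case
  proof (rule oadd_leI)
    show "oadd \<alpha> \<beta> \<le> oadd \<alpha> (oadd \<beta> \<gamma>)" by (intro oadd_mono_right le_oadd)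
    show "oadd (oadd \<alpha> \<beta>) \<delta> < oadd \<alpha> (oadd \<beta> \<gamma>)" if "\<delta> < \<gamma>" for \<delta>
      using less.IH[OF that] oadd_upper[OF oadd_upper[OF that]] by (rule order_le_less_trans)
  qed
qed

text \<open>This is \<open>\<omega> \<cdot> \<alpha>\<close>, not \<open>\<alpha> \<cdot> \<omega>\<close>.\<close>

function omega_mult :: "omega1 \<Rightarrow> omega1" where
  "omega_mult \<alpha> = osup ((\<lambda>\<beta>. oadd (omega_mult \<beta>) omega) ` {..<\<alpha>})"
  by pat_completeness auto
termination
  by (relation "{(x, y). x < y}") (auto intro: wf)

declare omega_mult.simps [simp del]

text \<open>This gap between the ranks assigned to a parent and to its child leaves room for
  segments of every finite length.\<close>

lemma omega_mult_less: "\<beta> < \<alpha> \<Longrightarrow> oadd (omega_mult \<beta>) omega \<le> omega_mult \<alpha>"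
  by (subst (2) omega_mult.simps) (auto intro!: osup_upper countable_lessThan_omega1)

lemma omega_mult_leI: "(\<And>\<beta>. \<beta> < \<alpha> \<Longrightarrow> oadd (omega_mult \<beta>) omega \<le> u) \<Longrightarrow> omega_mult \<alpha> \<le> u"
  by (subst omega_mult.simps) (auto intro!: osup_least)

lemma omega_mult_mono: "\<alpha> \<le> \<beta> \<Longrightarrow> omega_mult \<alpha> \<le> omega_mult \<beta>"
  using omega_mult_less order_less_le_trans by (intro omega_mult_leI) blast

lemma omega_mult_zero: "omega_mult 0 = 0"
proof (rule antisym)
  show "omega_mult 0 \<le> 0" by (rule omega_mult_leI) (use leD zero_le_omega1 in blast)
qed simp

lemma omega_mult_oadd: "omega_mult (oadd \<alpha> \<beta>) \<le> oadd (omega_mult \<alpha>) (omega_mult \<beta>)"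
proof (induction \<beta> rule: less_induct)
  case (less \<beta>)
  show ?case
  proof (cases "\<beta> = 0")
    case True
    then show ?thesis by (simp add: oadd_zero omega_mult_zero)
  next
    case False
    show ?thesis
    proof (rule omega_mult_leI)
      fix \<delta> assume "\<delta> < oadd \<alpha> \<beta>"
      then obtain \<gamma> where \<gamma>: "\<gamma> < \<beta>" "\<delta> \<le> oadd \<alpha> \<gamma>"
        using False less_oaddD by blast
      have "oadd (omega_mult \<delta>) omega \<le> oadd (oadd (omega_mult \<alpha>) (omega_mult \<gamma>)) omega"
        by (intro oadd_mono_left order_trans[OF omega_mult_mono[OF \<gamma>(2)] less.IH[OF \<gamma>(1)]])
      also have "\<dots> \<le> oadd (omega_mult \<alpha>) (oadd (omega_mult \<gamma>) omega)" by (rule oadd_assoc_le)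
      also have "\<dots> \<le> oadd (omega_mult \<alpha>) (omega_mult \<beta>)"
        by (intro oadd_mono_right omega_mult_less \<gamma>(1))
      finally show "oadd (omega_mult \<delta>) omega \<le> oadd (omega_mult \<alpha>) (omega_mult \<beta>)" .
    qed
  qed
qed

lemma omul_nat_Suc: "omul_nat \<alpha> (Suc n) = oadd (omul_nat \<alpha> n) \<alpha>"
  by (simp add: omul_nat_def)

lemma omul_nat_mono: "\<alpha> \<le> \<beta> \<Longrightarrow> omul_nat \<alpha> n \<le> omul_nat \<beta> n"
proof (induction n)
  case (Suc n)
  then show ?case
    unfolding omul_nat_Suc by (meson oadd_mono_left oadd_mono_right order_trans)
qed (simp add: omul_nat_def)

lemma omega_mult_omul_nat: "omega_mult (omul_nat \<alpha> n) \<le> omul_nat (omega_mult \<alpha>) n"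
proof (induction n)
  case 0
  then show ?case by (simp add: omul_nat_def omega_mult_zero)
next
  case (Suc n)
  have "omega_mult (omul_nat \<alpha> (Suc n)) \<le> oadd (omega_mult (omul_nat \<alpha> n)) (omega_mult \<alpha>)"
    unfolding omul_nat_Suc by (rule omega_mult_oadd)
  also have "\<dots> \<le> omul_nat (omega_mult \<alpha>) (Suc n)" unfolding omul_nat_Suc by (rule oadd_mono_left[OF Suc])
  finally show ?case .
qed

lemma finite_ordinal_less_omega: "(osuc ^^ n) 0 \<le> omega"
  unfolding omega_def by (rule osup_upper) auto

lemma omul_nat_one: "omul_nat (osuc 0) n = (osuc ^^ n) 0"
proof (induction n)
  case (Suc n)
  then show ?case unfolding omul_nat_Suc by (simp add: oadd_osuc oadd_zero)
qed (simp add: omul_nat_def)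

lemma less_omega_powD:
  assumes "\<delta> < omega_pow \<beta>" "\<beta> \<noteq> 0"
  shows "\<exists>\<gamma> n. \<gamma> < \<beta> \<and> \<delta> < omul_nat (omega_pow \<gamma>) n"
proof -
  have "omega_pow \<beta> = osup (\<Union> ((\<lambda>\<gamma>. range (omul_nat (omega_pow \<gamma>))) ` {..<\<beta>}))"
    using omega_pow.simps[of \<beta>] assms(2) by simp
  then show ?thesis using assms(1) less_osupD by fastforce
qed

text \<open>An ordinal below \<open>omega_pow \<beta>\<close> lies under a finite multiple of a
  smaller power, and \<open>omega_mult\<close> passes through finite multiples. The exponent is
  \<open>1 + \<beta>\<close>, not \<open>\<beta> + 1\<close>; in this order the 1 is absorbed by
  infinite \<open>\<beta>\<close>.\<close>

lemma omega_mult_omega_pow: "omega_mult (omega_pow \<beta>) \<le> omega_pow (oadd (osuc 0) \<beta>)"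
proof (induction \<beta> rule: less_induct)
  case (less \<beta>)
  show ?case
  proof (cases "\<beta> = 0")
    case True
    have "omega_mult (osuc 0) \<le> oadd 0 omega"
    proof (rule omega_mult_leI)
      fix \<delta> assume "\<delta> < osuc 0"
      then have "\<delta> = 0" using zero_le_omega1 by (metis antisym less_osuc_iff)
      then show "oadd (omega_mult \<delta>) omega \<le> oadd 0 omega" by (simp add: omega_mult_zero)
    qed
    also have "\<dots> = omega" by (rule oadd_zero_left)
    also have "\<dots> \<le> omega_pow (osuc 0)"
      unfolding omega_pow_osuc omega_pow_zero omega_def omul_nat_one by simp
    finally show ?thesis using True by (simp add: omega_pow_zero oadd_zero)
  next
    case False
    show ?thesis
    proof (rule omega_mult_leI)
      fix \<delta> assume "\<delta> < omega_pow \<beta>"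
      then obtain \<gamma> n where \<gamma>: "\<gamma> < \<beta>" "\<delta> < omul_nat (omega_pow \<gamma>) n"
        using False less_omega_powD by blast
      have "oadd (omega_mult \<delta>) omega \<le> omega_mult (omul_nat (omega_pow \<gamma>) n)" by (rule omega_mult_less[OF \<gamma>(2)])
      also have "\<dots> \<le> omul_nat (omega_mult (omega_pow \<gamma>)) n" by (rule omega_mult_omul_nat)
      also have "\<dots> \<le> omul_nat (omega_pow (oadd (osuc 0) \<gamma>)) n" by (rule omul_nat_mono[OF less.IH[OF \<gamma>(1)]])
      also have "\<dots> \<le> omega_pow (oadd (osuc 0) \<beta>)" by (rule omul_nat_le_omega_pow[OF oadd_upper[OF \<gamma>(1)]])
      finally show "oadd (omega_mult \<delta>) omega \<le> omega_pow (oadd (osuc 0) \<beta>)" .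
    qed
  qed
qed

lemma one_oadd_finite: "oadd (osuc 0) ((osuc ^^ n) 0) = (osuc ^^ Suc n) 0"
  by (induction n) (simp_all add: oadd_zero oadd_osuc)

lemma one_oadd_infinite: "omega \<le> \<beta> \<Longrightarrow> oadd (osuc 0) \<beta> \<le> \<beta>"
proof (induction \<beta> rule: less_induct)
  case (less \<beta>)
  show ?case
  proof (rule oadd_leI)
    show "osuc 0 \<le> \<beta>" using finite_ordinal_less_omega[of 1] less.prems by simp
    fix \<gamma> assume \<gamma>: "\<gamma> < \<beta>"
    show "oadd (osuc 0) \<gamma> < \<beta>"
    proof (cases "omega \<le> \<gamma>")
      case True
      then show ?thesis using less.IH[OF \<gamma>] \<gamma> by simp
    next
      case False
      then have "\<gamma> < osup (range (\<lambda>n. (osuc ^^ n) 0))" by (simp add: omega_def)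
      then obtain n where "\<gamma> < (osuc ^^ n) 0" using less_osupD by blast
      then have "oadd (osuc 0) \<gamma> < (osuc ^^ Suc n) 0"
        using oadd_upper[of \<gamma> "(osuc ^^ n) 0" "osuc 0"] by (simp only: one_oadd_finite)
      also have "\<dots> \<le> omega" by (rule finite_ordinal_less_omega)
      also have "\<dots> \<le> \<beta>" by (rule less.prems)
      finally show ?thesis .
    qed
  qed
qed

text \<open>This is where \<open>\<xi> \<ge> \<omega>\<close> is needed: \<open>\<omega> \<cdot> \<omega>\<^sup>\<xi> = \<omega>\<^sup>\<xi>\<close>.\<close>

lemma omega_mult_less_omega_pow:
  assumes "omega \<le> \<xi>" "\<alpha> < omega_pow \<xi>"
  shows "oadd (omega_mult \<alpha>) omega \<le> omega_pow \<xi>"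
  using omega_mult_less[OF assms(2)] omega_mult_omega_pow[of \<xi>] omega_pow_mono[OF one_oadd_infinite[OF assms(1)]]
  by simp

section \<open>Derivatives of trees\<close>

lemma tree_deriv_iter_antimono: "\<zeta> \<le> \<eta> \<Longrightarrow> tree_deriv_iter T \<eta> \<subseteq> tree_deriv_iter T \<zeta>"
proof (induction \<eta> rule: less_induct)
  case (less \<eta>)
  show ?case
  proof (cases "\<zeta> = \<eta>")
    case False
    then have \<zeta>: "\<zeta> < \<eta>" using less.prems by simp
    show ?thesis
    proof (cases \<eta> rule: omega1_cases)
      case 1
      then show ?thesis using \<zeta> zero_le_omega1 leD by blast
    next
      case (2 \<theta>)
      then have "tree_deriv_iter T \<eta> \<subseteq> tree_deriv_iter T \<theta>"
        by (auto simp: tree_deriv_iter_osuc tree_derivative_def)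
      also have "\<dots> \<subseteq> tree_deriv_iter T \<zeta>" using less.IH[OF 2(2)] \<zeta> 2(1) by (simp add: less_osuc_iff)
      finally show ?thesis .
    next
      case 3
      then show ?thesis using \<zeta> by (auto simp: tree_deriv_iter_limit)
    qed
  qed simp
qed

lemma tree_deriv_iter_prefix_closed:
  assumes "\<And>s t. t \<in> T \<Longrightarrow> prefix s t \<Longrightarrow> s \<in> T"
  shows "t \<in> tree_deriv_iter T \<eta> \<Longrightarrow> prefix s t \<Longrightarrow> s \<in> tree_deriv_iter T \<eta>"
proof (induction \<eta> arbitrary: s t rule: less_induct)
  case (less \<eta>)
  show ?case
  proof (cases \<eta> rule: omega1_cases)
    case 1
    then show ?thesis using less.prems assms by (simp add: tree_deriv_iter_zero)
  next
    case (2 \<theta>)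
    then obtain r where r: "t \<in> tree_deriv_iter T \<theta>" "r \<in> tree_deriv_iter T \<theta>" "strict_prefix t r"
      using less.prems(1) by (auto simp: tree_deriv_iter_osuc tree_derivative_def)
    have "s \<in> tree_deriv_iter T \<theta>" by (rule less.IH[OF 2(2) r(1) less.prems(2)])
    moreover have "strict_prefix s r" using less.prems(2) r(3) by (rule prefix_order.le_less_trans)
    ultimately show ?thesis using r(2) 2(1) by (auto simp: tree_deriv_iter_osuc tree_derivative_def)
  next
    case 3
    show ?thesis
      unfolding tree_deriv_iter_limit[OF 3]
    proof
      fix \<zeta> assume \<zeta>: "\<zeta> \<in> {..<\<eta>}"
      then have "t \<in> tree_deriv_iter T \<zeta>" using less.prems(1) unfolding tree_deriv_iter_limit[OF 3] by blast
      then show "s \<in> tree_deriv_iter T \<zeta>" using less.IH[of \<zeta>] \<zeta> less.prems(2) by simp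
    qed
  qed
qed

text \<open>Each of the last \<open>n\<close> derivatives that \<open>u\<close> survives provides
  one more proper extension.\<close>

lemma tree_deriv_iter_extend:
  "u \<in> tree_deriv_iter T (oadd \<zeta> ((osuc ^^ n) 0)) \<Longrightarrow> \<exists>w. n \<le> length w \<and> u @ w \<in> tree_deriv_iter T \<zeta>"
proof (induction n arbitrary: u)
  case 0
  then show ?case by (intro exI[of _ "[]"]) (simp add: oadd_zero)
next
  case (Suc n)
  then obtain s where s: "s \<in> tree_deriv_iter T (oadd \<zeta> ((osuc ^^ n) 0))" "strict_prefix u s"
    by (auto simp: oadd_osuc tree_deriv_iter_osuc tree_derivative_def)
  then obtain v where v: "s = u @ v" "v \<noteq> []" by (auto simp: strict_prefix_def prefix_def)
  obtain w where "n \<le> length w" "s @ w \<in> tree_deriv_iter T \<zeta>" using Suc.IH[OF s(1)] by blast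
  then show ?case using v by (intro exI[of _ "v @ w"]) (cases v, auto)
qed

lemma tree_order_le_iff: "tree_order T \<le> Fin \<kappa> \<longleftrightarrow> tree_deriv_iter T \<kappa> = {}"
proof
  assume le: "tree_order T \<le> Fin \<kappa>"
  then have ex: "\<exists>\<xi>. tree_deriv_iter T \<xi> = {}" by (auto simp: tree_order_def split: if_splits)
  then have "(LEAST \<xi>. tree_deriv_iter T \<xi> = {}) \<le> \<kappa>" using le by (simp add: tree_order_def)
  from tree_deriv_iter_antimono[OF this, of T] show "tree_deriv_iter T \<kappa> = {}"
    using LeastI_ex[OF ex] by simp
next
  assume "tree_deriv_iter T \<kappa> = {}"
  then show "tree_order T \<le> Fin \<kappa>" by (auto simp: tree_order_def intro: Least_le)
qed

section \<open>A forest on the natural numbers\<close>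

lemma sum_extend_zero:
  fixes g :: "nat \<Rightarrow> 'a::real_vector"
  assumes "m \<le> n"
  shows "(\<Sum>i<n. (if i < m then a i else 0) *\<^sub>R g i) = (\<Sum>i<m. a i *\<^sub>R g i)"
  by (rule sum.mono_neutral_cong_right) (use assms in auto)

lemma c0_norm_extend_zero:
  assumes "m \<le> n"
  shows "c0_norm {..<n} (\<lambda>i. if i < m then a i else 0) = c0_norm {..<m} a"
proof (rule antisym)
  show "c0_norm {..<n} (\<lambda>i. if i < m then a i else 0) \<le> c0_norm {..<m} a"
    by (subst c0_norm_le_iff) (auto simp: c0_norm_nonneg intro: abs_le_c0_norm)
  have "\<bar>a i\<bar> \<le> c0_norm {..<n} (\<lambda>i. if i < m then a i else 0)" if "i < m" for i
    using abs_le_c0_norm[of "{..<n}" i "\<lambda>i. if i < m then a i else 0"] assms that by simp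
  then show "c0_norm {..<m} a \<le> c0_norm {..<n} (\<lambda>i. if i < m then a i else 0)"
    by (subst c0_norm_le_iff) (auto simp: c0_norm_nonneg)
qed

text \<open>Coefficients on the prefix are padded with zeros, which changes neither the sums nor the
  \<open>c\<^sub>0\<close> norm.\<close>

lemma tree_Sc0_prefix_closed:
  fixes A :: "'a::banach \<Rightarrow> 'b::banach"
  assumes t: "t \<in> tree_Sc0 (X, Y, A) K" and "prefix s t"
  shows "s \<in> tree_Sc0 (X, Y, A) K"
proof -
  obtain r where r: "t = s @ r" using assms(2) by (auto simp: prefix_def)
  let ?m = "length s" and ?n = "length t"
  have mn: "?m \<le> ?n" by (simp add: r)
  define e where "e a i = (if i < ?m then a i else 0)" for a :: "nat \<Rightarrow> real" and i
  have sA: "(\<Sum>i<k. a i *\<^sub>R A (t ! i)) = (\<Sum>i<k. a i *\<^sub>R A (s ! i))" if "k \<le> ?m" for k and a :: "nat \<Rightarrow> real"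
    using that by (intro sum.cong) (auto simp: r nth_append)
  have sX: "(\<Sum>i<?m. a i *\<^sub>R t ! i) = (\<Sum>i<?m. a i *\<^sub>R s ! i)" for a :: "nat \<Rightarrow> real"
    by (intro sum.cong) (auto simp: r nth_append)
  have eA: "(\<Sum>i<?n. e a i *\<^sub>R A (t ! i)) = (\<Sum>i<?m. a i *\<^sub>R A (s ! i))" for a
    unfolding e_def sum_extend_zero[OF mn] by (rule sA) simp
  have eAm: "(\<Sum>i<k. e a i *\<^sub>R A (t ! i)) = (\<Sum>i<k. a i *\<^sub>R A (s ! i))" if "k \<le> ?m" for k a
    unfolding sA[OF that] using that by (intro sum.cong) (auto simp: e_def)
  have eX: "(\<Sum>i<?n. e a i *\<^sub>R t ! i) = (\<Sum>i<?m. a i *\<^sub>R s ! i)" for a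
    unfolding e_def sum_extend_zero[OF mn] by (rule sX)
  have ec: "c0_norm {..<?n} (e a) = c0_norm {..<?m} a" for a
    unfolding e_def by (rule c0_norm_extend_zero[OF mn])
  have mapA: "(\<Sum>i<k. a i *\<^sub>R map A u ! i) = (\<Sum>i<k. a i *\<^sub>R A (u ! i))" if "k \<le> length u" for k u and a :: "nat \<Rightarrow> real"
    using that by (intro sum.cong) auto
  have T: "set t \<subseteq> {x \<in> X. norm x = 1}" "K_basic K (map A t)"
     "\<And>a. c0_norm {..<?n} a \<le> K * norm (\<Sum>i<?n. a i *\<^sub>R A (t ! i))"
     "\<And>a. norm (\<Sum>i<?n. a i *\<^sub>R t ! i) \<le> c0_norm {..<?n} a"
    using t unfolding tree_Sc0_def by auto
  have T2: "a i = 0" if "(\<Sum>i<?n. a i *\<^sub>R A (t ! i)) = 0" "i < ?n" for a i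
    using conjunct1[OF T(2)[unfolded K_basic_def], rule_format, of a i] that
    unfolding length_map mapA[OF order_refl] by simp
  have T3: "norm (\<Sum>i<m. a i *\<^sub>R A (t ! i)) \<le> K * norm (\<Sum>i<?n. a i *\<^sub>R A (t ! i))" if "m \<le> ?n" for a m
    using conjunct2[OF T(2)[unfolded K_basic_def], rule_format, of m a] that
    unfolding length_map mapA[OF order_refl] mapA[OF that] by simp
  have "K_basic K (map A s)"
    unfolding K_basic_def length_map
  proof (intro conjI allI impI)
    fix a :: "nat \<Rightarrow> real" and i assume 0: "(\<Sum>i<?m. a i *\<^sub>R map A s ! i) = 0" and i: "i < ?m"
    have "(\<Sum>i<?n. e a i *\<^sub>R A (t ! i)) = 0" using 0 by (simp add: eA mapA)
    from T2[OF this, of i] show "a i = 0" using i mn by (simp add: e_def)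
  next
    fix a :: "nat \<Rightarrow> real" and m assume m: "m \<le> ?m"
    then show "norm (\<Sum>i<m. a i *\<^sub>R map A s ! i) \<le> K * norm (\<Sum>i<?m. a i *\<^sub>R map A s ! i)"
      using T3[of m "e a"] mn by (simp add: mapA eA eAm)
  qed
  moreover have "set s \<subseteq> {x \<in> X. norm x = 1}" using T(1) r by auto
  moreover have "c0_norm {..<?m} a \<le> K * norm (\<Sum>i<?m. a i *\<^sub>R A (s ! i))" for a
    using T(3)[of "e a"] by (simp add: eA ec)
  moreover have "norm (\<Sum>i<?m. a i *\<^sub>R s ! i) \<le> c0_norm {..<?m} a" for a
    using T(4)[of "e a"] by (simp add: eX ec)
  ultimately show ?thesis unfolding tree_Sc0_def by simp
qed

text \<open>A dimension count with a bound that depends on \<open>G\<close> alone. Each further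
  functional doubles the number of points: two disjoint combinations annihilated by the old
  functionals are combined so that the new one vanishes too.\<close>

lemma vanishing_combination:
  assumes "finite G"
  shows "\<exists>N. \<forall>(h :: 'g \<Rightarrow> nat \<Rightarrow> real) I. finite I \<and> N \<le> card I \<longrightarrow> (\<exists>c. (\<forall>g\<in>G. (\<Sum>i\<in>I. c i * h g i) = 0) \<and> (\<exists>i\<in>I. c i \<noteq> 0))"
  using assms
proof (induction G rule: finite_induct)
  case empty
  show ?case
  proof (intro exI[of _ 1] allI impI)
    fix h :: "'g \<Rightarrow> nat \<Rightarrow> real" and I :: "nat set" assume "finite I \<and> 1 \<le> card I"
    then have "I \<noteq> {}" by auto
    then show "\<exists>c. (\<forall>g\<in>{}. (\<Sum>i\<in>I. c i * h g i) = 0) \<and> (\<exists>i\<in>I. c i \<noteq> 0)"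
      by (intro exI[of _ "\<lambda>_. 1"]) auto
  qed
next
  case (insert g G)
  then obtain N where N: "\<And>(h :: 'g \<Rightarrow> nat \<Rightarrow> real) I. finite I \<Longrightarrow> N \<le> card I \<Longrightarrow>
      \<exists>c. (\<forall>g\<in>G. (\<Sum>i\<in>I. c i * h g i) = 0) \<and> (\<exists>i\<in>I. c i \<noteq> 0)" by blast
  show ?case
  proof (intro exI[of _ "N + N"] allI impI)
    fix h :: "'g \<Rightarrow> nat \<Rightarrow> real" and I :: "nat set" assume I: "finite I \<and> N + N \<le> card I"
    then have "N \<le> card I" by simp
    then obtain J where J: "J \<subseteq> I" "card J = N" by (rule obtain_subset_with_card_n) blast
    then have finJ: "finite J" "finite (I - J)" using I finite_subset by auto
    have "card (I - J) = card I - N" using card_Diff_subset[OF finJ(1) J(1)] J(2) by simp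
    then have "N \<le> card (I - J)" using I by linarith
    then obtain c where c: "\<forall>g\<in>G. (\<Sum>i\<in>I - J. c i * h g i) = 0" "\<exists>i\<in>I - J. c i \<noteq> 0"
      using N[OF finJ(2), of h] by blast
    obtain d where d: "\<forall>g\<in>G. (\<Sum>i\<in>J. d i * h g i) = 0" "\<exists>i\<in>J. d i \<noteq> 0"
      using N[OF finJ(1), of h] J(2) by auto
    define s where "s = (\<Sum>i\<in>I - J. c i * h g i)"
    define r where "r = (\<Sum>i\<in>J. d i * h g i)"
    \<comment> \<open>If \<open>s = 0\<close>, the combination \<open>c\<close> already works.
      Otherwise the weights \<open>s\<close> on \<open>J\<close> and \<open>- r\<close> off
      \<open>J\<close> make the values of the new functional cancel, and the part on
      \<open>J\<close> is not zero.\<close>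
    define b where "b i = (if s = 0 then if i \<in> J then 0 else c i else if i \<in> J then s * d i else - r * c i)" for i
    have split: "(\<Sum>i\<in>I. b i * h g' i) = (\<Sum>i\<in>I - J. b i * h g' i) + (\<Sum>i\<in>J. b i * h g' i)" for g'
      by (rule sum.subset_diff[OF J(1)]) (use I in blast)
    show "\<exists>c. (\<forall>g\<in>insert g G. (\<Sum>i\<in>I. c i * h g i) = 0) \<and> (\<exists>i\<in>I. c i \<noteq> 0)"
    proof (cases "s = 0")
      case True
      then have b: "b i = (if i \<in> J then 0 else c i)" for i by (simp add: b_def)
      have "(\<Sum>i\<in>I. b i * h g' i) = (\<Sum>i\<in>I - J. c i * h g' i)" for g'
        unfolding split by (simp add: b)
      then have "\<forall>g\<in>insert g G. (\<Sum>i\<in>I. b i * h g i) = 0" using c(1) True by (simp add: s_def)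
      moreover have "\<exists>i\<in>I. b i \<noteq> 0" using c(2) by (auto simp: b)
      ultimately show ?thesis by blast
    next
      case False
      then have b: "b i = (if i \<in> J then s * d i else - r * c i)" for i by (simp add: b_def)
      have "(\<Sum>i\<in>I. b i * h g' i) = - r * (\<Sum>i\<in>I - J. c i * h g' i) + s * (\<Sum>i\<in>J. d i * h g' i)" for g'
        unfolding split sum_distrib_left by (simp add: b mult.assoc)
      then have "\<forall>g\<in>insert g G. (\<Sum>i\<in>I. b i * h g i) = 0" using c(1) d(1) by (simp add: s_def[symmetric] r_def[symmetric])
      moreover have "\<exists>i\<in>I. b i \<noteq> 0" using d(2) False J(1) by (auto simp: b)
      ultimately show ?thesis by blast
    qed
  qed
qed

lemma vanishing_normalized_combination:
  assumes "finite G"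
  shows "\<exists>N. \<forall>(h :: 'g \<Rightarrow> nat \<Rightarrow> real) n. N \<le> n \<longrightarrow> (\<exists>c. (\<forall>g\<in>G. (\<Sum>i<n. c i * h g i) = 0) \<and>
    (\<exists>j<n. \<bar>c j\<bar> = 1) \<and> (\<forall>i<n. \<bar>c i\<bar> \<le> 1))"
proof -
  obtain N where N: "\<And>(h :: 'g \<Rightarrow> nat \<Rightarrow> real) I. finite I \<Longrightarrow> N \<le> card I \<Longrightarrow>
      \<exists>c. (\<forall>g\<in>G. (\<Sum>i\<in>I. c i * h g i) = 0) \<and> (\<exists>i\<in>I. c i \<noteq> 0)"
    using vanishing_combination[OF assms] by blast
  have "\<exists>c. (\<forall>g\<in>G. (\<Sum>i<n. c i * h g i) = 0) \<and> (\<exists>j<n. \<bar>c j\<bar> = 1) \<and> (\<forall>i<n. \<bar>c i\<bar> \<le> 1)"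
    if n: "n \<ge> N" for n and h :: "'g \<Rightarrow> nat \<Rightarrow> real"
  proof -
    obtain c where c: "\<forall>g\<in>G. (\<Sum>i<n. c i * h g i) = 0" "\<exists>i\<in>{..<n}. c i \<noteq> 0"
      using N[of "{..<n}" h] n by auto
    define M where "M = c0_norm {..<n} c"
    obtain k where k: "k < n" "c k \<noteq> 0" using c(2) by auto
    have M: "\<bar>c i\<bar> \<le> M" if "i < n" for i unfolding M_def using that by (intro abs_le_c0_norm) auto
    then have Mpos: "0 < M" using k by fastforce
    have "\<exists>j<n. \<bar>c j\<bar> = M"
    proof -
      have "M \<in> insert 0 ((\<lambda>i. \<bar>c i\<bar>) ` {..<n})" unfolding M_def c0_norm_def by (rule Max_in) auto
      then show ?thesis using Mpos by auto
    qed
    moreover have "(\<Sum>i<n. c i / M * h g i) = (\<Sum>i<n. c i * h g i) / M" for g by (simp add: sum_divide_distrib)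
    ultimately show ?thesis using c(1) M Mpos by (intro exI[of _ "\<lambda>i. c i / M"]) auto
  qed
  then show ?thesis by blast
qed

text \<open>Node \<open>n\<close> codes a pair of a label and a parent. Pairs whose label is not smaller than the
  label of the parent are made roots, so that every number is a node and no index is wasted.\<close>

context
  fixes \<alpha> :: "nat \<Rightarrow> omega1"
begin

definition label :: "nat \<Rightarrow> omega1" where
  "label n = \<alpha> (fst (prod_decode n))"

definition parent :: "nat \<Rightarrow> nat option" where
  \<comment> \<open>Second component 0 stands for no parent, \<open>m > 0\<close> for the parent
    \<open>m - 1\<close>.\<close>
  "parent n = (let m = snd (prod_decode n) in
     if 0 < m \<and> label n < label (m - 1) then Some (m - 1) else None)"

lemma parent_less: "parent n = Some k \<Longrightarrow> k < n"
  and label_parent: "parent n = Some k \<Longrightarrow> label n < label k"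
proof -
  assume "parent n = Some k"
  then have k: "0 < snd (prod_decode n)" "label n < label (snd (prod_decode n) - 1)" "k = snd (prod_decode n) - 1"
    by (auto simp: parent_def Let_def split: if_splits)
  have "snd (prod_decode n) \<le> n"
    using le_prod_encode_2[of "snd (prod_decode n)" "fst (prod_decode n)"] by simp
  then show "k < n" using k by linarith
  show "label n < label k" using k by simp
qed

lemma ex_child: "\<beta> \<in> range \<alpha> \<Longrightarrow> \<beta> < label k \<Longrightarrow> \<exists>n. parent n = Some k \<and> label n = \<beta>"
proof -
  assume "\<beta> \<in> range \<alpha>" "\<beta> < label k"
  then obtain x where "\<beta> = \<alpha> x" by blast
  then show ?thesis using \<open>\<beta> < label k\<close>
    by (intro exI[of _ "prod_encode (x, Suc k)"]) (simp add: parent_def label_def)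
qed

lemma ex_root: "\<beta> \<in> range \<alpha> \<Longrightarrow> \<exists>n. parent n = None \<and> label n = \<beta>"
proof -
  assume "\<beta> \<in> range \<alpha>"
  then obtain x where "\<beta> = \<alpha> x" by blast
  then show ?thesis by (intro exI[of _ "prod_encode (x, 0)"]) (simp add: parent_def label_def)
qed

function branch :: "nat \<Rightarrow> nat list" where
  "branch n = (case parent n of None \<Rightarrow> [n] | Some k \<Rightarrow> branch k @ [n])"
  by pat_completeness auto
termination
  by (relation less_than) (auto intro: parent_less)

declare branch.simps [simp del]

lemma branch_root: "parent n = None \<Longrightarrow> branch n = [n]"
  and branch_child: "parent n = Some k \<Longrightarrow> branch n = branch k @ [n]"
  by (subst branch.simps; simp)+

lemma branch_le: "k \<in> set (branch n) \<Longrightarrow> k \<le> n"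
proof (induction n rule: less_induct)
  case (less n)
  show ?case
  proof (cases "parent n")
    case None
    then show ?thesis using less.prems by (simp add: branch_root)
  next
    case (Some m)
    then show ?thesis using less parent_less[OF Some] by (fastforce simp: branch_child)
  qed
qed

lemma distinct_branch: "distinct (branch n)"
proof (induction n rule: less_induct)
  case (less n)
  show ?case
  proof (cases "parent n")
    case None
    then show ?thesis by (simp add: branch_root)
  next
    case (Some m)
    then have "n \<notin> set (branch m)" using branch_le[of n m] parent_less[OF Some] by auto
    then show ?thesis using less.IH[OF parent_less[OF Some]] by (simp add: branch_child[OF Some])
  qed
qed

lemma in_branch: "n \<in> set (branch n)"
  by (cases "parent n") (simp_all add: branch_root branch_child)

lemma covering_branches: "covering (range (\<lambda>n. set (branch n)))"
  unfolding covering_def using in_branch by auto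

end

section \<open>The class defined by trees\<close>

text \<open>All constants are 1: the branch is a member of the family, and its images are distinct
  unit vectors of \<open>c\<^sub>0\<close>.\<close>

lemma branch_in_tree:
  assumes \<F>: "\<F> = range (\<lambda>n. set (branch \<alpha> n))"
    and U: "\<And>i. U (ubasis \<F> i) = unit_seq i"
  shows "map (ubasis \<F>) (branch \<alpha> n) \<in> tree_Sc0 (closure (span (range (ubasis \<F>))), UNIV, U) 1"
proof -
  let ?z = "ubasis \<F>" and ?l = "branch \<alpha> n"
  let ?N = "length ?l"
  have cov: "covering \<F>" unfolding \<F> by (rule covering_branches)
  have dist: "distinct ?l" by (rule distinct_branch)
  have coord: "coord (\<Sum>i<m. a i *\<^sub>R unit_seq (?l ! i)) (?l ! j) = (if j < m then a j else 0)"
    if "m \<le> ?N" "j < ?N" for m j a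
  proof -
    have "coord (\<Sum>i<m. a i *\<^sub>R unit_seq (?l ! i)) (?l ! j) = (\<Sum>i<m. if i = j then a i else 0)"
      unfolding coord_sum coord_unit_seq using that nth_eq_iff_index_eq[OF dist] by (intro sum.cong) auto
    then show ?thesis by simp
  qed
  have coord0: "coord (\<Sum>i<m. a i *\<^sub>R unit_seq (?l ! i)) k = 0" if "m \<le> ?N" "k \<notin> set ?l" for m k a
    unfolding coord_sum coord_unit_seq using that by (intro sum.neutral) auto
  have coeff: "\<bar>a j\<bar> \<le> norm (\<Sum>i<?N. a i *\<^sub>R unit_seq (?l ! i))" if "j < ?N" for a j
    using abs_coord_le[of "\<Sum>i<?N. a i *\<^sub>R unit_seq (?l ! i)" "?l ! j"] coord[of ?N j a] that by simp
  have mapU: "(\<Sum>i<m. a i *\<^sub>R map U (map ?z ?l) ! i) = (\<Sum>i<m. a i *\<^sub>R unit_seq (?l ! i))" if "m \<le> ?N" for m a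
    using that by (intro sum.cong) (auto simp: U)
  have "K_basic 1 (map U (map ?z ?l))"
    unfolding K_basic_def length_map
  proof (intro conjI allI impI)
    fix a i assume 0: "(\<Sum>i<?N. a i *\<^sub>R map U (map ?z ?l) ! i) = 0" and i: "i < ?N"
    show "a i = 0" using coeff[OF i, of a] 0 by (simp only: mapU[OF order_refl] norm_zero)
  next
    fix a m assume m: "m \<le> ?N"
    have "norm (\<Sum>i<m. a i *\<^sub>R unit_seq (?l ! i)) \<le> norm (\<Sum>i<?N. a i *\<^sub>R unit_seq (?l ! i))"
    proof (rule linf_norm_le)
      fix k
      show "\<bar>coord (\<Sum>i<m. a i *\<^sub>R unit_seq (?l ! i)) k\<bar> \<le> norm (\<Sum>i<?N. a i *\<^sub>R unit_seq (?l ! i))"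
      proof (cases "k \<in> set ?l")
        case True
        then obtain j where "k = ?l ! j" "j < ?N" by (auto simp: in_set_conv_nth)
        then show ?thesis using coord[OF m, of j a] coeff[of j a] by auto
      qed (simp add: coord0[OF m])
    qed
    then show "norm (\<Sum>i<m. a i *\<^sub>R map U (map ?z ?l) ! i) \<le> 1 * norm (\<Sum>i<?N. a i *\<^sub>R map U (map ?z ?l) ! i)"
      by (simp only: mapU[OF m] mapU[OF order_refl] mult_1)
  qed
  moreover have "c0_norm {..<?N} a \<le> 1 * norm (\<Sum>i<?N. a i *\<^sub>R U (map ?z ?l ! i))" for a
  proof -
    have "(\<Sum>i<?N. a i *\<^sub>R U (map ?z ?l ! i)) = (\<Sum>i<?N. a i *\<^sub>R unit_seq (?l ! i))"
      by (intro sum.cong) (auto simp: U)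
    then show ?thesis using coeff[of _ a] by (simp add: c0_norm_le_iff)
  qed
  moreover have "norm (\<Sum>i<?N. a i *\<^sub>R map ?z ?l ! i) \<le> c0_norm {..<?N} a" for a
  proof -
    have bij: "bij_betw ((!) ?l) {..<?N} (set ?l)" by (rule bij_betw_nth[OF dist]) auto
    define b where "b = a \<circ> the_inv_into {..<?N} ((!) ?l)"
    have b: "b (?l ! i) = a i" if "i < ?N" for i
      using bij that by (simp add: b_def the_inv_into_f_f bij_betw_def)
    have "(\<Sum>i<?N. a i *\<^sub>R map ?z ?l ! i) = (\<Sum>i<?N. b (?l ! i) *\<^sub>R ?z (?l ! i))"
      by (intro sum.cong) (auto simp: b)
    also have "\<dots> = (\<Sum>k\<in>set ?l. b k *\<^sub>R ?z k)" by (rule sum.reindex_bij_betw[OF bij])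
    also have "norm \<dots> \<le> c0_norm (set ?l) b" by (rule norm_ubasis_sum_le[OF cov]) (simp add: \<F>)
    also have "\<dots> \<le> c0_norm {..<?N} a"
      using abs_le_c0_norm[of "{..<?N}" _ a]
      by (subst c0_norm_le_iff) (auto simp: c0_norm_nonneg in_set_conv_nth b)
    finally show ?thesis .
  qed
  moreover have "set (map ?z ?l) \<subseteq> {x \<in> closure (span (range ?z)). norm x = 1}"
    using ubasis_in_space norm_ubasis[OF cov] by auto
  ultimately show ?thesis unfolding tree_Sc0_def by simp
qed

lemma nil_in_tree_Sc0: "1 \<le> K \<Longrightarrow> [] \<in> tree_Sc0 (X, Y, A) K"
  by (simp add: tree_Sc0_def K_basic_def c0_norm_def)

text \<open>Every ordinal below a label occurs as the label of a child: such a child survives as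
  many derivatives as its own label, hence its parent survives one more.\<close>

lemma branch_in_tree_deriv:
  assumes \<alpha>: "range \<alpha> = {..<\<kappa>}" and T: "\<And>n. map z (branch \<alpha> n) \<in> T"
  shows "\<beta> \<le> label \<alpha> n \<Longrightarrow> map z (branch \<alpha> n) \<in> tree_deriv_iter T \<beta>"
proof (induction \<beta> arbitrary: n rule: less_induct)
  case (less \<beta>)
  have "label \<alpha> n \<in> range \<alpha>" by (simp add: label_def)
  then have lab: "label \<alpha> n < \<kappa>" using \<alpha> by simp
  show ?case
  proof (cases \<beta> rule: omega1_cases)
    case 1
    then show ?thesis using T by (simp add: tree_deriv_iter_zero)
  next
    case (2 \<gamma>)
    then have \<gamma>: "\<gamma> < label \<alpha> n" using less.prems by simp
    then obtain m where m: "parent \<alpha> m = Some n" "label \<alpha> m = \<gamma>"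
      using ex_child[of \<gamma> \<alpha> n] order_less_trans[OF \<gamma> lab] \<alpha> by auto
    have "map z (branch \<alpha> n) \<in> tree_deriv_iter T \<gamma>" "map z (branch \<alpha> m) \<in> tree_deriv_iter T \<gamma>"
      using less.IH[OF 2(2)] \<gamma> m(2) by simp_all
    moreover have "strict_prefix (map z (branch \<alpha> n)) (map z (branch \<alpha> m))"
      unfolding branch_child[OF m(1)] by (simp add: strict_prefix_def)
    ultimately show ?thesis unfolding 2(1) tree_deriv_iter_osuc tree_derivative_def by blast
  next
    case 3
    show ?thesis
      unfolding tree_deriv_iter_limit[OF 3]
    proof
      fix \<gamma> assume "\<gamma> \<in> {..<\<beta>}"
      then show "map z (branch \<alpha> n) \<in> tree_deriv_iter T \<gamma>" using less.IH[of \<gamma> n] less.prems by simp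
    qed
  qed
qed

text \<open>Roots with all labels below \<open>\<kappa>\<close> extend the empty sequence, so it
  survives even the derivative \<open>\<kappa>\<close> and the order of the tree exceeds
  \<open>\<kappa>\<close>.\<close>

lemma nil_in_tree_deriv:
  assumes \<alpha>: "range \<alpha> = {..<\<kappa>}" and T: "\<And>n. map z (branch \<alpha> n) \<in> T" "[] \<in> T"
  shows "\<beta> \<le> \<kappa> \<Longrightarrow> [] \<in> tree_deriv_iter T \<beta>"
proof (induction \<beta> rule: less_induct)
  case (less \<beta>)
  show ?case
  proof (cases \<beta> rule: omega1_cases)
    case 1
    then show ?thesis using T(2) by (simp add: tree_deriv_iter_zero)
  next
    case (2 \<gamma>)
    then have "\<gamma> < \<kappa>" using less.prems by simp
    then obtain m where m: "parent \<alpha> m = None" "label \<alpha> m = \<gamma>" using ex_root[of \<gamma> \<alpha>] \<alpha> by auto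
    have "map z (branch \<alpha> m) \<in> tree_deriv_iter T \<gamma>" using branch_in_tree_deriv[OF \<alpha> T(1)] m(2) by simp
    moreover have "[] \<in> tree_deriv_iter T \<gamma>" using less.IH[OF 2(2)] \<open>\<gamma> < \<kappa>\<close> by simp
    moreover have "strict_prefix [] (map z (branch \<alpha> m))" unfolding branch_root[OF m(1)] by simp
    ultimately show ?thesis unfolding 2(1) tree_deriv_iter_osuc tree_derivative_def by blast
  next
    case 3
    show ?thesis
      unfolding tree_deriv_iter_limit[OF 3]
    proof
      fix \<gamma> assume "\<gamma> \<in> {..<\<beta>}"
      then show "[] \<in> tree_deriv_iter T \<gamma>" using less.IH[of \<gamma>] less.prems by simp
    qed
  qed
qed

lemma sum_append_block:
  fixes pu w :: "'a::real_vector list"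
  shows "(\<Sum>i<length (pu @ w). (if i < length pu then a i else b (i - length pu)) *\<^sub>R g ((pu @ w) ! i)) =
    (\<Sum>i<length pu. a i *\<^sub>R g (pu ! i)) + (\<Sum>i<length w. b i *\<^sub>R (g (w ! i) :: 'c::real_vector))"
proof -
  let ?h = "\<lambda>i. (if i < length pu then a i else b (i - length pu)) *\<^sub>R g ((pu @ w) ! i)"
  have "(\<Sum>i<length (pu @ w). ?h i) = (\<Sum>i<length pu. ?h i) + (\<Sum>i<length w. ?h (i + length pu))"
    using sum.atLeastLessThan_concat[of 0 "length pu" "length (pu @ w)" ?h]
      sum.shift_bounds_nat_ivl[of ?h 0 "length pu" "length w"]
    by (simp add: atLeast0LessThan add.commute)
  also have "(\<Sum>i<length pu. ?h i) = (\<Sum>i<length pu. a i *\<^sub>R g (pu ! i))"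
    by (intro sum.cong) (auto simp: nth_append)
  also have "(\<Sum>i<length w. ?h (i + length pu)) = (\<Sum>i<length w. b i *\<^sub>R g (w ! i))"
    by (intro sum.cong) (auto simp: nth_append)
  finally show ?thesis .
qed

text \<open>\<open>chosen_block S \<alpha> f n (u, v)\<close>: \<open>v\<close> is a block, with \<open>c\<^sub>0\<close>-coefficients, of the segment by which
  \<open>u\<close> extends the sequence chosen for the parent of \<open>n\<close>.\<close>

definition chosen_block :: "'a::real_vector list set \<Rightarrow> (nat \<Rightarrow> omega1) \<Rightarrow> (nat \<Rightarrow> 'a list \<times> 'a) \<Rightarrow> nat \<Rightarrow> 'a list \<times> 'a \<Rightarrow> bool" where
  "chosen_block S \<alpha> f n r \<longleftrightarrow> fst r \<in> tree_deriv_iter S (omega_mult (label \<alpha> n)) \<and>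
     (\<exists>w c. fst r = (case parent \<alpha> n of None \<Rightarrow> [] | Some k \<Rightarrow> fst (f k)) @ w \<and>
       snd r = (\<Sum>i<length w. c i *\<^sub>R w ! i) \<and> (\<forall>i<length w. \<bar>c i\<bar> \<le> 1))"

text \<open>The sequences chosen along a branch extend each other, so the blocks on the branch are
  disjoint blocks of the single sequence \<open>fst (f n)\<close>. The upper estimate of that one
  node thereby becomes an estimate along the branch.\<close>

lemma branch_block_combination:
  fixes f :: "nat \<Rightarrow> 'a::real_vector list \<times> 'a"
  assumes f: "\<And>n. chosen_block S \<alpha> f n (f n)"
  shows "(\<forall>i\<in>set (branch \<alpha> n). \<bar>a i\<bar> \<le> R) \<Longrightarrow>
    \<exists>b. (\<Sum>i\<in>set (branch \<alpha> n). a i *\<^sub>R snd (f i)) = (\<Sum>j<length (fst (f n)). b j *\<^sub>R fst (f n) ! j) \<and>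
      (\<forall>j<length (fst (f n)). \<bar>b j\<bar> \<le> R)"
proof (induction n rule: less_induct)
  case (less n)
  define pu where "pu = (case parent \<alpha> n of None \<Rightarrow> [] | Some k \<Rightarrow> fst (f k))"
  obtain w c where w: "fst (f n) = pu @ w" "snd (f n) = (\<Sum>i<length w. c i *\<^sub>R w ! i)" "\<forall>i<length w. \<bar>c i\<bar> \<le> 1"
    using f[of n] unfolding chosen_block_def pu_def by blast
  have an: "\<bar>a n\<bar> \<le> R" using less.prems in_branch by blast
  have "\<exists>b. (\<Sum>i\<in>set (branch \<alpha> n) - {n}. a i *\<^sub>R snd (f i)) = (\<Sum>j<length pu. b j *\<^sub>R pu ! j) \<and>
      (\<forall>j<length pu. \<bar>b j\<bar> \<le> R)"
  proof (cases "parent \<alpha> n")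
    case None
    then show ?thesis by (simp add: branch_root pu_def)
  next
    case (Some k)
    have "n \<notin> set (branch \<alpha> k)" using branch_le[of n \<alpha> k] parent_less[OF Some] by auto
    then have "set (branch \<alpha> n) - {n} = set (branch \<alpha> k)" by (simp add: branch_child[OF Some])
    then show ?thesis
      using less.IH[OF parent_less[OF Some]] less.prems by (simp add: pu_def Some branch_child[OF Some])
  qed
  then obtain b where b: "(\<Sum>i\<in>set (branch \<alpha> n) - {n}. a i *\<^sub>R snd (f i)) = (\<Sum>j<length pu. b j *\<^sub>R pu ! j)"
      "\<forall>j<length pu. \<bar>b j\<bar> \<le> R" by blast
  define e where "e i = (if i < length pu then b i else a n * c (i - length pu))" for i
  have "(\<Sum>i\<in>set (branch \<alpha> n). a i *\<^sub>R snd (f i)) = a n *\<^sub>R snd (f n) + (\<Sum>i\<in>set (branch \<alpha> n) - {n}. a i *\<^sub>R snd (f i))"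
    by (rule sum.remove) (simp_all add: in_branch)
  also have "\<dots> = (\<Sum>j<length (fst (f n)). e j *\<^sub>R fst (f n) ! j)"
    using sum_append_block[where g = "\<lambda>x. x" and pu = pu and w = w and a = b and b = "\<lambda>i. a n * c i"]
    unfolding b(1) w(1,2) e_def by (simp add: scaleR_sum_right add.commute)
  finally have "(\<Sum>i\<in>set (branch \<alpha> n). a i *\<^sub>R snd (f i)) = (\<Sum>j<length (fst (f n)). e j *\<^sub>R fst (f n) ! j)" .
  moreover have "\<bar>e j\<bar> \<le> R" if "j < length (fst (f n))" for j
  proof (cases "j < length pu")
    case False
    then have "\<bar>c (j - length pu)\<bar> \<le> 1" using that w(1,3) by simp
    then have "\<bar>a n\<bar> * \<bar>c (j - length pu)\<bar> \<le> R * 1" using an by (intro mult_mono) auto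
    then show ?thesis using False by (simp add: e_def abs_mult)
  qed (use b(2) in \<open>simp add: e_def\<close>)
  ultimately show ?case by blast
qed

text \<open>Every node can be extended by arbitrarily long segments, which leaves room to annihilate
  finitely many functionals.\<close>

lemma ex_chosen_block:
  fixes A :: "'a::banach \<Rightarrow> 'b::banach" and X :: "'a set" and Y :: "'b set"
  defines "S K \<equiv> tree_Sc0 (X, Y, A) K"
  assumes A: "is_operator (X, Y, A)" and K: "1 \<le> K" and \<xi>: "omega \<le> \<xi>"
    and \<alpha>: "range \<alpha> = {..<omega_pow \<xi>}" and nil: "[] \<in> tree_deriv_iter (S K) (omega_pow \<xi>)"
    and f: "\<And>m. m < n \<Longrightarrow> chosen_block (S K) \<alpha> f m (f m)" and G: "finite G" "G \<subseteq> dual_ball"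
  shows "\<exists>r. (chosen_block (S K) \<alpha> f n r \<and> snd r \<in> X) \<and> 1 / K \<le> norm (A (snd r)) \<and> (\<forall>g\<in>G. g (A (snd r)) = 0)"
proof -
  define pu where "pu = (case parent \<alpha> n of None \<Rightarrow> [] | Some k \<Rightarrow> fst (f k))"
  have lab: "label \<alpha> n < omega_pow \<xi>"
  proof -
    have "label \<alpha> n \<in> range \<alpha>" by (simp add: label_def)
    then show ?thesis using \<alpha> by simp
  qed
  have fin: "oadd \<zeta> ((osuc ^^ N) 0) \<le> oadd \<zeta> omega" for \<zeta> N
    by (rule oadd_mono_right[OF finite_ordinal_less_omega])
  \<comment> \<open>The rank of the parent's sequence exceeds that of node \<open>n\<close> by at
    least \<omega>. For a root the empty sequence takes its place, and it survives
    \<open>omega_pow \<xi>\<close> derivatives.\<close>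
  have pu: "pu \<in> tree_deriv_iter (S K) (oadd (omega_mult (label \<alpha> n)) ((osuc ^^ N) 0))" for N
  proof (cases "parent \<alpha> n")
    case None
    have "oadd (omega_mult (label \<alpha> n)) ((osuc ^^ N) 0) \<le> omega_pow \<xi>"
      using fin omega_mult_less_omega_pow[OF \<xi> lab] by (rule order_trans)
    from tree_deriv_iter_antimono[OF this] show ?thesis using nil None by (auto simp: pu_def)
  next
    case (Some k)
    have "oadd (omega_mult (label \<alpha> n)) ((osuc ^^ N) 0) \<le> omega_mult (label \<alpha> k)"
      using fin omega_mult_less[OF label_parent[OF Some]] by (rule order_trans)
    from tree_deriv_iter_antimono[OF this] show ?thesis
      using f[OF parent_less[OF Some]] Some by (auto simp: pu_def chosen_block_def)
  qed
  have "\<exists>w c. pu @ w \<in> tree_deriv_iter (S K) (omega_mult (label \<alpha> n)) \<and>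
      (\<forall>g\<in>G. (\<Sum>i<length w. c i * g (A (w ! i))) = 0) \<and> (\<exists>j<length w. \<bar>c j\<bar> = 1) \<and> (\<forall>i<length w. \<bar>c i\<bar> \<le> 1)"
  proof -
    \<comment> \<open>the bound \<open>N\<close> has to be known before the segment \<open>w\<close> on which the functionals are evaluated\<close>
    obtain N where N: "\<And>(h :: ('b \<Rightarrow> real) \<Rightarrow> nat \<Rightarrow> real) n. N \<le> n \<Longrightarrow>
        \<exists>c. (\<forall>g\<in>G. (\<Sum>i<n. c i * h g i) = 0) \<and> (\<exists>j<n. \<bar>c j\<bar> = 1) \<and> (\<forall>i<n. \<bar>c i\<bar> \<le> 1)"
      using vanishing_normalized_combination[OF G(1)] by blast
    obtain w where w: "N \<le> length w" "pu @ w \<in> tree_deriv_iter (S K) (omega_mult (label \<alpha> n))"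
      using tree_deriv_iter_extend[OF pu[of N]] by blast
    show ?thesis using N[OF w(1), of "\<lambda>g i. g (A (w ! i))"] w(2) by blast
  qed
  then obtain w c where w: "pu @ w \<in> tree_deriv_iter (S K) (omega_mult (label \<alpha> n))"
    and c: "\<forall>g\<in>G. (\<Sum>i<length w. c i * g (A (w ! i))) = 0" "\<exists>j<length w. \<bar>c j\<bar> = 1" "\<forall>i<length w. \<bar>c i\<bar> \<le> 1"
    by blast
  define v where "v = (\<Sum>i<length w. c i *\<^sub>R w ! i)"
  have "pu @ w \<in> S K" using tree_deriv_iter_antimono[OF zero_le_omega1] w by (auto simp: tree_deriv_iter_zero)
  then have uX: "set (pu @ w) \<subseteq> {x \<in> X. norm x = 1}"
    and low: "\<And>a. c0_norm {..<length (pu @ w)} a \<le> K * norm (\<Sum>i<length (pu @ w). a i *\<^sub>R A ((pu @ w) ! i))"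
    unfolding S_def tree_Sc0_def by simp_all
  have wX: "w ! i \<in> X" if "i \<in> {..<length w}" for i
  proof -
    have "w ! i \<in> set (pu @ w)" using that by simp
    then show ?thesis using uX by blast
  qed
  have v: "v \<in> X" "A v = (\<Sum>i<length w. c i *\<^sub>R A (w ! i))"
    using operator_sum[OF A, of "{..<length w}" "\<lambda>i. w ! i" c] wX by (auto simp: v_def)
  obtain j where j: "j < length w" "\<bar>c j\<bar> = 1" using c(2) by blast
  \<comment> \<open>Zeros on the parent's part turn \<open>A v\<close> into a combination of the
    whole node, to which its lower estimate applies; one coefficient of absolute value 1 gives the
    bound \<open>1 / K\<close>.\<close>
  define a where "a i = (if i < length pu then 0 else c (i - length pu))" for i
  have "\<bar>a (length pu + j)\<bar> \<le> c0_norm {..<length (pu @ w)} a" using j by (intro abs_le_c0_norm) auto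
  then have "1 \<le> c0_norm {..<length (pu @ w)} a" using j by (simp add: a_def)
  also have "\<dots> \<le> K * norm (\<Sum>i<length (pu @ w). a i *\<^sub>R A ((pu @ w) ! i))" by (rule low)
  also have "(\<Sum>i<length (pu @ w). a i *\<^sub>R A ((pu @ w) ! i)) = A v"
    using sum_append_block[where g = A and pu = pu and w = w and a = "\<lambda>_. 0" and b = c]
    unfolding a_def v(2) by simp
  finally have norm: "1 / K \<le> norm (A v)" using K by (simp add: pos_divide_le_eq mult.commute)
  have "g (A v) = 0" if "g \<in> G" for g
    using c(1) that dual_ball_sum[of g c "\<lambda>i. A (w ! i)" "{..<length w}"] G(2) by (auto simp: v(2))
  moreover have "chosen_block (S K) \<alpha> f n (pu @ w, v)"
    unfolding chosen_block_def using w c(3) by (auto simp: v_def pu_def)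
  ultimately show ?thesis using v(1) norm by (intro exI[of _ "(pu @ w, v)"]) simp
qed

lemma universal_Sc0:
  assumes \<xi>: "omega \<le> \<xi>"
  shows "\<exists>u. universal_operator (Sc0 \<xi> :: (linf, linf) oper set) (Sc0 \<xi> :: ('a::banach, 'b::banach) oper set) u"
proof -
  define \<kappa> where "\<kappa> = omega_pow \<xi>"
  have "osuc 0 \<le> \<kappa>" using omega_pow_mono[OF zero_le_omega1[of \<xi>]] by (simp add: \<kappa>_def omega_pow_zero)
  then have "0 \<in> {..<\<kappa>}" using less_osuc[of 0] by simp
  \<comment> \<open>There are only countably many ordinals below \<open>\<kappa>\<close>, so the
    natural numbers suffice to label the forest.\<close>
  then have "range (from_nat_into {..<\<kappa>}) = {..<\<kappa>}"
    by (intro range_from_nat_into countable_lessThan_omega1) auto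
  then obtain \<alpha> :: "nat \<Rightarrow> omega1" where \<alpha>: "range \<alpha> = {..<\<kappa>}" by blast
  define \<F> where "\<F> = range (\<lambda>n. set (branch \<alpha> n))"
  define z where "z = ubasis \<F>"
  have cov: "covering \<F>" unfolding \<F>_def by (rule covering_branches)
  obtain U where U: "is_operator (closure (span (range z)), UNIV :: linf set, U)" "\<And>i. U (z i) = unit_seq i"
    using operator_on_ubasis[OF cov ubasis_dominates_unit_seq[OF cov]] unfolding z_def by blast
  have "universal_operator (Sc0 \<xi>) (Sc0 \<xi> :: ('a, 'b) oper set) (closure (span (range z)), UNIV, U)"
  proof (rule universal_operator_from_basis[OF _ _ U])
    show "projections_bounded 1 z" unfolding z_def by (rule projections_bounded_ubasis[OF cov])
    show "z i \<noteq> 0" for i unfolding z_def by (rule ubasis_neq_zero[OF cov])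
    let ?T = "tree_Sc0 (closure (span (range z)), UNIV, U) 1"
    have "map z (branch \<alpha> n) \<in> ?T" for n
      using branch_in_tree[OF \<F>_def, of U n] U(2) unfolding z_def by blast
    then have "[] \<in> tree_deriv_iter ?T \<kappa>"
      using nil_in_tree_deriv[OF \<alpha> _ nil_in_tree_Sc0[OF order_refl] order_refl] by blast
    then have "\<not> tree_order ?T \<le> Fin (omega_pow \<xi>)" unfolding tree_order_le_iff \<kappa>_def by blast
    then show "(closure (span (range z)), UNIV, U) \<notin> Sc0 \<xi>" unfolding Sc0_def by auto
  next
    fix X Y and A :: "'a \<Rightarrow> 'b"
    assume A: "is_operator (X, Y, A)" "(X, Y, A) \<notin> Sc0 \<xi>"
    then obtain K where K: "1 \<le> K" "\<not> tree_order (tree_Sc0 (X, Y, A) K) \<le> Fin (omega_pow \<xi>)"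
      unfolding Sc0_def by blast
    define S where "S = tree_Sc0 (X, Y, A) K"
    obtain t where t: "t \<in> tree_deriv_iter S (omega_pow \<xi>)" using K(2) unfolding tree_order_le_iff S_def by blast
    have nil: "[] \<in> tree_deriv_iter S (omega_pow \<xi>)"
      by (rule tree_deriv_iter_prefix_closed[OF _ t]) (auto simp: S_def intro: tree_Sc0_prefix_closed)
    have K0: "0 < 1 / K" using K(1) by simp
    have "\<exists>f. (\<forall>n. chosen_block S \<alpha> f n (f n) \<and> snd (f n) \<in> X) \<and> (\<forall>n. 1 / K \<le> norm (A (snd (f n)))) \<and>
        projections_bounded 2 (\<lambda>n. A (snd (f n)))"
    proof (rule mazur_selection[where P = "\<lambda>f n r. chosen_block S \<alpha> f n r \<and> snd r \<in> X" and val = "\<lambda>r. A (snd r)", OF _ K0])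
      fix r and f g :: "nat \<Rightarrow> 'a list \<times> 'a" and n :: nat assume "\<And>m. m < n \<Longrightarrow> f m = g m"
      \<comment> \<open>Parents have smaller numbers than their children, so the constraint at
        \<open>n\<close> refers to earlier choices only.\<close>
      then have "(case parent \<alpha> n of None \<Rightarrow> [] | Some k \<Rightarrow> fst (f k)) = (case parent \<alpha> n of None \<Rightarrow> [] | Some k \<Rightarrow> fst (g k))"
        using parent_less[of \<alpha> n] by (auto split: option.split)
      then show "(chosen_block S \<alpha> f n r \<and> snd r \<in> X) = (chosen_block S \<alpha> g n r \<and> snd r \<in> X)"
        unfolding chosen_block_def by simp
    next
      fix f :: "nat \<Rightarrow> 'a list \<times> 'a" and n :: nat and G :: "('b \<Rightarrow> real) set" and \<theta> :: real
      assume f: "\<And>m. m < n \<Longrightarrow> chosen_block S \<alpha> f m (f m) \<and> snd (f m) \<in> X" and G: "finite G" "G \<subseteq> dual_ball" "0 < \<theta>"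
      have f': "\<And>m. m < n \<Longrightarrow> chosen_block (tree_Sc0 (X, Y, A) K) \<alpha> f m (f m)" using f by (simp add: S_def)
      from ex_chosen_block[OF A(1) K(1) \<xi> \<alpha>[unfolded \<kappa>_def] nil[unfolded S_def] f' G(1,2)]
      obtain r where "chosen_block S \<alpha> f n r \<and> snd r \<in> X" "1 / K \<le> norm (A (snd r))" "\<forall>g\<in>G. g (A (snd r)) = 0"
        unfolding S_def by blast
      moreover from this have "\<forall>g\<in>G. \<bar>g (A (snd r))\<bar> \<le> \<theta>" using G(3) by (metis abs_zero less_imp_le)
      ultimately show "\<exists>r. (chosen_block S \<alpha> f n r \<and> snd r \<in> X) \<and> 1 / K \<le> norm (A (snd r)) \<and> (\<forall>g\<in>G. \<bar>g (A (snd r))\<bar> \<le> \<theta>)"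
        by (intro exI[of _ r]) simp
    qed
    then obtain f where fall: "\<forall>n. chosen_block S \<alpha> f n (f n) \<and> snd (f n) \<in> X" "\<forall>n. 1 / K \<le> norm (A (snd (f n)))"
        "projections_bounded 2 (\<lambda>n. A (snd (f n)))" by (elim exE conjE)
    then have f: "\<And>n. chosen_block S \<alpha> f n (f n)" "\<And>n. snd (f n) \<in> X" "\<And>n. 1 / K \<le> norm (A (snd (f n)))"
        "projections_bounded 2 (\<lambda>n. A (snd (f n)))" by simp_all
    have "dominates 1 z (\<lambda>i. snd (f i))"
      unfolding z_def
    proof (rule ubasis_dominates[OF cov])
      fix H and a :: "nat \<Rightarrow> real" assume "H \<in> \<F>"
      then obtain n where H: "H = set (branch \<alpha> n)" by (auto simp: \<F>_def)
      have "\<forall>i\<in>set (branch \<alpha> n). \<bar>a i\<bar> \<le> c0_norm H a" unfolding H by (auto intro: abs_le_c0_norm)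
      from branch_block_combination[OF f(1) this] obtain b where
        b: "(\<Sum>i\<in>H. a i *\<^sub>R snd (f i)) = (\<Sum>j<length (fst (f n)). b j *\<^sub>R fst (f n) ! j)"
          "\<forall>j<length (fst (f n)). \<bar>b j\<bar> \<le> c0_norm H a" unfolding H by blast
      have "fst (f n) \<in> S"
        using f(1)[of n] tree_deriv_iter_antimono[OF zero_le_omega1, of S] by (auto simp: chosen_block_def tree_deriv_iter_zero)
      then have "norm (\<Sum>j<length (fst (f n)). b j *\<^sub>R fst (f n) ! j) \<le> c0_norm {..<length (fst (f n))} b"
        unfolding S_def tree_Sc0_def by simp
      also have "\<dots> \<le> c0_norm H a" using b(2) by (subst c0_norm_le_iff) (auto simp: H c0_norm_nonneg)
      finally show "norm (\<Sum>i\<in>H. a i *\<^sub>R snd (f i)) \<le> 1 * c0_norm H a" by (simp add: b(1))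
    qed simp
    moreover have "dominates (4 / (1 / K)) (\<lambda>i. A (snd (f i))) unit_seq"
      by (rule dominates_unit_seq_if_projections_bounded[OF f(4) K0 f(3)])
    ultimately show "\<exists>x K K'. (\<forall>i. x i \<in> X) \<and> dominates K z x \<and> 0 \<le> K' \<and> dominates K' (\<lambda>i. A (x i)) unit_seq"
      using f(2) K(1) by (intro exI[of _ "\<lambda>i. snd (f i)"] exI[of _ 1] exI[of _ "4 / (1 / K)"]) simp
  qed
  then show ?thesis by blast
qed

theorem theorem3p3:
  fixes \<xi> :: omega1 and \<sigma> :: "omega1 \<Rightarrow> nat \<Rightarrow> omega1"
  assumes "fundamental_sequences \<sigma>" and "0 < \<xi>"
  shows "complement_admits_universal (S_Sl1 \<sigma> \<xi>) (S_Sl1 \<sigma> \<xi> :: ('a::banach, 'b::banach) oper set)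
    \<and> complement_admits_universal (S_Sc0 \<sigma> \<xi>) (S_Sc0 \<sigma> \<xi> :: ('a, 'b) oper set)
    \<and> (omega \<le> \<xi> \<longrightarrow> complement_admits_universal (Sc0 \<xi>) (Sc0 \<xi> :: ('a, 'b) oper set))"
  \<comment> \<open>Universal operators factor through each other, so it suffices to find one for
    every pair of types separately.\<close>
  unfolding complement_admits_universal_iff
  by (intro conjI impI universal_S_Sl1[OF assms] universal_S_Sc0[OF assms] universal_Sc0)

end
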